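(* Let $\alpha>0$. Let $Z$ be a real random variable with $0<\mathbb{E}Z<\infty$, whose law is non-arithmetic and such that for some $r>0$, $\mathbb{P}(Z\le x)=o(e^{rx})$ as $x\to-\infty$. Let $\mathbf{H}$ be the renewal measure of the random walk with step $Z$. Let $B$ be a real random variable and $L$ a slowly varying function with $\mathbb{P}(B>x)=x^{-\alpha}L(x)$ for $x>0$, and put $\widetilde L(x)=\int_0^x\frac{L(t)}{t}dt$. Let $g:\mathbb{R}\to\mathbb{R}$ be a bounded $C^1$ function with $\operatorname{supp}g\subset[1,\infty)$ for which there is a constant $c$ such that $$\Big|\frac{d}{dt}\big(e^{-\alpha t}g(e^{t})\big)\Big|\le c\,e^{-\alpha t},\qquad t>0 .$$ Then $$\lim_{x\to\infty}\widetilde L(e^x)^{-1}\int_{\mathbb{R}}e^{\alpha(x-z)}\,\mathbb{E}\,g(e^{z-x}B)\,\mathbf{H}(dz)=\frac{\alpha}{\mathbb{E}Z}\int_{[1,\infty)}g(r)r^{-\alpha-1}\,dr .$$ Assume additionally that $\mathbb{E}\exp(\varepsilon Z)<\infty$ for some $\varepsilon>0$ and that the law of $Z$ is strongly non-lattice. Then, as $x\to\infty$, $$\left|\int_{\mathbb{R}}e^{\alpha(x-z)}\,\mathbb{E}\,g(e^{z-x}B)\,\mathbf{H}(dz)-\frac{\alpha}{\mathbb{E}Z}\widetilde L(e^x)\int_{[1,\infty)}g(r)r^{-\alpha-1}\,dr\right|\le C\,L(e^x),$$ where $C$ depends on $g$ through $\|g\|_{\sup}=\sup_{x\in\mathbb{R}}|g(x)|$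 and the constant $c$ above, with $C\to\infty$ if either $\|g\|_{\sup}\to\infty$ or $c\to\infty$.
   Context: A measurable $L:(0,\infty)\to(0,\infty)$ is slowly varying if $L(\lambda x)/L(x)\to1$ as $x\to\infty$ for every $\lambda>0$. A law on $\mathbb{R}$ is arithmetic if it is supported in $d\mathbb{Z}$ for some $d>0$, and non-arithmetic otherwise. The law of $Z$ is strongly non-lattice if its characteristic function $f_Z$ satisfies $\limsup_{|t|\to\infty}|f_Z(t)|<1$. With $Z_1,Z_2,\dots$ i.i.d. copies of $Z$, $S_0=0$, $S_n=Z_1+\dots+Z_n$, the renewal measure is $\mathbf{H}(D)=\sum_{n=0}^\infty\mathbb{P}(S_n\in D)$ for Borel $D\subset\mathbb{R}$. *)

theory Defs
  imports "HOL-Probability.Probability" "HOL-Library.Landau_Symbols"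
begin

definition slowly_varying :: "(real \<Rightarrow> real) \<Rightarrow> bool" where
  "slowly_varying L \<longleftrightarrow>
     L \<in> borel_measurable (restrict_space borel {0<..}) \<and>
     (\<forall>x>0. 0 < L x) \<and>
     (\<forall>a>0. ((\<lambda>x. L (a * x) / L x) \<longlongrightarrow> 1) at_top)"

definition arithmetic_law :: "real measure \<Rightarrow> bool" where
  "arithmetic_law \<mu> \<longleftrightarrow> (\<exists>d>0. AE x in \<mu>. \<exists>k::int. x = d * of_int k)"

(* On the reals, at_infinity is the filter of \<bar>t\<bar> \<rightarrow> \<infinity>. *)
definition strongly_nonlattice_law :: "real measure \<Rightarrow> bool" where
  "strongly_nonlattice_law \<mu> \<longleftrightarrow> Limsup at_infinity (\<lambda>t. ereal (cmod (char \<mu> t))) < 1"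

(* The steps Z_1, Z_2, ... are X 0, X 1, ..., so S_n is the sum of X i over i < n. *)
definition renewal_measure :: "'a measure \<Rightarrow> (nat \<Rightarrow> 'a \<Rightarrow> real) \<Rightarrow> real measure" where
  "renewal_measure M X = measure_of UNIV (sets borel)
     (\<lambda>D. \<Sum>n. emeasure M {\<omega> \<in> space M. (\<Sum>i<n. X i \<omega>) \<in> D})"

lemma sets_renewal_measure [simp, measurable_cong]: "sets (renewal_measure M X) = sets borel"
  unfolding renewal_measure_def using sets.sigma_sets_eq[of borel] by simp

lemma space_renewal_measure [simp]: "space (renewal_measure M X) = UNIV"
  by (simp add: renewal_measure_def)

(* measure_of yields the null measure when its argument is not countably additive;
   this shows that this does not happen here. *)
lemma emeasure_renewal_measure:
  assumes X [measurable]: "\<And>i. X i \<in> borel_measurable M" and D: "D \<in> sets borel"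
  shows "emeasure (renewal_measure M X) D =
    (\<Sum>n. emeasure M {\<omega> \<in> space M. (\<Sum>i<n. X i \<omega>) \<in> D})"
proof (rule emeasure_measure_of[OF renewal_measure_def])
  let ?S = "\<lambda>n. distr M borel (\<lambda>\<omega>. \<Sum>i<n. X i \<omega>)"
  let ?H = "\<lambda>D. \<Sum>n. emeasure M {\<omega> \<in> space M. (\<Sum>i<n. X i \<omega>) \<in> D}"
  have S: "emeasure M {\<omega> \<in> space M. (\<Sum>i<n. X i \<omega>) \<in> A} = emeasure (?S n) A"
    if "A \<in> sets borel" for n A
    using that by (subst emeasure_distr) (auto intro!: arg_cong[where f = "emeasure M"])
  show "countably_additive (sets (renewal_measure M X)) ?H"
  proof (rule countably_additiveI)
    fix A :: "nat \<Rightarrow> real set"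
    assume A: "range A \<subseteq> sets (renewal_measure M X)" "disjoint_family A"
    then have A': "A i \<in> sets borel" "(\<Union>i. A i) \<in> sets borel" for i
      by auto
    have "(\<Sum>i. ?H (A i)) = (\<Sum>i. \<integral>\<^sup>+n. emeasure (?S n) (A i) \<partial>count_space UNIV)"
      by (simp add: S A' nn_integral_count_space_nat)
    also have "\<dots> = (\<integral>\<^sup>+n. (\<Sum>i. emeasure (?S n) (A i)) \<partial>count_space UNIV)"
      by (rule nn_integral_suminf[symmetric]) simp
    also have "\<dots> = (\<integral>\<^sup>+n. emeasure (?S n) (\<Union>i. A i) \<partial>count_space UNIV)"
      using A A' by (intro nn_integral_cong suminf_emeasure) auto
    also have "\<dots> = ?H (\<Union>i. A i)"
      by (simp only: S A' nn_integral_count_space_nat)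
    finally show "(\<Sum>i. ?H (A i)) = ?H (\<Union>i. A i)" .
  qed
qed (use D in \<open>auto simp: positive_def\<close>)

definition L_tilde :: "(real \<Rightarrow> real) \<Rightarrow> real \<Rightarrow> real" where
  "L_tilde L x = (LINT t:{0<..x}|lborel. L t / t)"

definition admissible :: "real \<Rightarrow> real \<Rightarrow> (real \<Rightarrow> real) \<Rightarrow> bool" where
  "admissible \<alpha> c g \<longleftrightarrow>
     bounded (range g) \<and> g C1_differentiable_on UNIV \<and>
     closure {r. g r \<noteq> 0} \<subseteq> {1..} \<and>
     (\<forall>t>0. \<bar>deriv (\<lambda>t. exp (- \<alpha> * t) * g (exp t)) t\<bar> \<le> c * exp (- \<alpha> * t))"

definition renewal_integrand ::
    "'a measure \<Rightarrow> ('a \<Rightarrow> real) \<Rightarrow> real \<Rightarrow> (real \<Rightarrow> real) \<Rightarrow> real \<Rightarrow> real \<Rightarrow> real" where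
  "renewal_integrand M B \<alpha> g x z =
     exp (\<alpha> * (x - z)) * (LINT \<omega>|M. g (exp (z - x) * B \<omega>))"

end

theory Submission
  imports Defs "HOL-Complex_Analysis.Complex_Analysis" "HOL-Real_Asymp.Real_Asymp"
begin

text \<open>Let \<open>\<kappa> r = (1 + \<alpha>) g r - r g' r\<close> and \<open>K y = e\<^bsup>\<alpha>y\<^esup> E \<kappa> (e\<^bsup>-y\<^esup> B)\<close>. Since \<open>e\<^bsup>\<alpha>y\<^esup> E g (e\<^bsup>-y\<^esup> B)\<close> is the convolution of \<open>K\<close>
  with \<open>e\<^bsup>-u\<^esup> 1\<^bsub>u \<ge> 0\<^esub>\<close>, the integral against the renewal measure equals the convolution of \<open>K\<close> with
  \<open>Q\<close>, the renewal measure smoothed by that exponential kernel. Here \<open>|K y| \<le> (sup |g| + c) L (e\<^sup>y)\<close>, and the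
  integral of \<open>K\<close> up to \<open>x\<close> differs from \<open>\<alpha>\<close> times the integral of \<open>g r r\<^bsup>-\<alpha>-1\<^esup>\<close> times the integral of \<open>L (e\<^sup>y)\<close> up to
  \<open>x\<close> by \<open>O(L (e\<^sup>x))\<close>. So everything rests on \<open>q = Q - 1\<^bsub>u > 0\<^esub> / E Z\<close>.

  For the first claim one needs \<open>q \<rightarrow> 0\<close>. The Gaussian averages of the renewal measure converge by the
  Feller-Orey argument (discounted renewal sums, real parts of the transform, Riemann-Lebesgue), and \<open>Q\<close> inherits the
  limit because \<open>e\<^sup>x Q x\<close> is monotone. For the second claim the Laplace transform of \<open>q\<close> extends holomorphically
  across the imaginary axis with decay \<open>1 / (1 + |Im s|)\<close>, so \<open>e\<^bsup>\<theta>u\<^esup> q\<close> is square integrable for a small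
  \<open>\<theta> > 0\<close>. Potter's bounds for \<open>L\<close> then control the convolution in both cases.\<close>

section \<open>Gaussian kernels and the Bessel inequality\<close>

text \<open>Put G y = e^{\<alpha>y} E g(e^{-y} B). Formally G + G' = K, so convolution with e^{-u}
  on u \<ge> 0 inverts 1 + d/dy; this is the origin of \<kappa>, and the derivative hypothesis on g
  is what keeps \<kappa> bounded. The detour is forced by the renewal measure, which in general has
  neither a density nor a decaying transform: moving one smoothing from g to the measure multiplies
  1/(1 - F s) by 1/(1 + s). The resulting decay of order 1/|t| is square integrable on vertical
  lines but not integrable, so what is learnt about q is an L2 bound, and a slightly smaller
  exponential weight turns it into L1. Weighted L1 is the right target because Potter's bounds
  compare L (e^{x-u}) with L (e^x) only up to e^{\<eta>|u|}. Without the strong non-lattice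
  condition 1 - F may come back close to 0 far out on the axis; the Gaussians are there to suppress
  high frequencies. Uniformity in g costs no separate argument: g enters only through the bound on K
  and the integral of K, whence a final constant linear in sup |g| + c.\<close>

lemma cnj_measurable [measurable]: "cnj \<in> borel_measurable borel"
  by (intro borel_measurable_continuous_onI continuous_intros)

lemma integrable_gauss:
  assumes "(a::real) > 0"
  shows "integrable lborel (\<lambda>t::real. exp (- (a^2 * t^2 / 2)))"
proof -
  have "integrable lborel (\<lambda>t. sqrt (2 * pi / a^2) * normal_density 0 (1/a) t)"
    using assms by (intro integrable_mult_right integrable_normal_density) auto
  also have "(\<lambda>t. sqrt (2 * pi / a^2) * normal_density 0 (1/a) t) = (\<lambda>t. exp (- (a^2 * t^2 / 2)))"
    using assms by (auto simp: normal_density_def fun_eq_iff power_divide)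
  finally show ?thesis .
qed

text \<open>The Gaussian is its own Fourier transform: the substitution t = u / a reduces the
  integral to the characteristic function of the standard normal law.\<close>

lemma normal_density_fourier:
  assumes "(a::real) > 0"
  shows "complex_of_real (normal_density 0 a y) =
    1 / (2 * pi) * (CLINT t|lborel. complex_of_real (exp (- (a^2 * t^2 / 2))) * iexp (t * y))"
proof -
  have 1: "(CLINT x|lborel. normal_density 0 1 x * iexp (s * x)) = complex_of_real (exp (- (s^2) / 2))" for s :: real
  proof -
    have "char std_normal_distribution s = (CLINT x|lborel. normal_density 0 1 x *\<^sub>R iexp (s * x))"
      unfolding char_def by (subst integral_density) (auto simp: normal_density_nonneg)
    then show ?thesis by (simp add: char_std_normal_distribution scaleR_conv_of_real)
  qed
  have "(CLINT t|lborel. complex_of_real (exp (- (a^2 * t^2 / 2))) * iexp (t * y))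
      = (1 / a) *\<^sub>R (CLINT u|lborel. complex_of_real (exp (- (a^2 * (u/a)^2 / 2))) * iexp (u / a * y))"
    using lborel_integral_real_affine[of "1/a" "\<lambda>t. complex_of_real (exp (- (a^2 * t^2 / 2))) * iexp (t * y)" 0] assms
    by simp
  also have "(CLINT u|lborel. complex_of_real (exp (- (a^2 * (u/a)^2 / 2))) * iexp (u / a * y))
     = (CLINT x|lborel. complex_of_real (sqrt (2*pi)) * (normal_density 0 1 x * iexp (y / a * x)))"
    using assms by (intro Bochner_Integration.integral_cong) (auto simp: normal_density_def power_divide mult_ac)
  also have "\<dots> = complex_of_real (sqrt (2*pi) * exp (- ((y/a)^2)/2))"
    by (subst integral_mult_right_zero, subst 1) simp
  finally have 2: "(CLINT t|lborel. complex_of_real (exp (- (a^2 * t^2 / 2))) * iexp (t * y)) = complex_of_real (1 / a * (sqrt (2*pi) * exp (- ((y/a)^2)/2)))"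
    by (simp add: scaleR_conv_of_real)
  have 3: "1 / (2*pi) * (1 / a * (sqrt (2*pi) * exp (- ((y/a)^2)/2))) = normal_density 0 a y"
  proof -
    have "sqrt (2*pi*a^2) = sqrt (2*pi) * a" using assms by (simp add: real_sqrt_mult)
    moreover have "sqrt (2*pi) * sqrt (2*pi) = 2 * pi" by simp
    ultimately show ?thesis using assms
      by (simp add: normal_density_def power_divide field_simps)
  qed
  show ?thesis unfolding 2 by (simp add: 3[symmetric])
qed

lemma nn_integral_normal_density:
  assumes "(a::real) > 0"
  shows "(\<integral>\<^sup>+x. ennreal (normal_density m a (x - t)) \<partial>lborel) = 1" 
        "(\<integral>\<^sup>+x. ennreal (normal_density 0 a (t - x)) \<partial>lborel) = 1"
proof -
  have 0: "(\<integral>\<^sup>+x. ennreal (normal_density m a x) \<partial>lborel) = 1" for m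
    using assms by (subst nn_integral_eq_integral) (auto simp: integral_normal_density)
  show "(\<integral>\<^sup>+x. ennreal (normal_density m a (x - t)) \<partial>lborel) = 1"
    using 0[of "m + t"] by (simp add: normal_density_def algebra_simps)
  show "(\<integral>\<^sup>+x. ennreal (normal_density 0 a (t - x)) \<partial>lborel) = 1"
    using 0[of t] by (simp add: normal_density_def power2_commute)
qed

text \<open>Expanding the square turns the left side into a quadratic form in \<open>\<psi>\<close> whose kernel is a normal density, and
  the bound \<open>|\<psi> s \<psi> t| \<le> (|\<psi> s|\<^sup>2 + |\<psi> t|\<^sup>2) / 2\<close> finishes.\<close>

lemma bessel_gauss:
  fixes \<psi> :: "real \<Rightarrow> complex"
  assumes int: "integrable lborel \<psi>" and int2: "integrable lborel (\<lambda>t. (cmod (\<psi> t))^2)" and k: "k > 0"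
  shows "(\<integral>\<^sup>+x. ennreal (exp (- (k^2 * x^2 / 2)) * (cmod (CLINT t|lborel. \<psi> t * iexp (t * x)))^2) \<partial>lborel)
     \<le> ennreal (2 * pi * (LINT t|lborel. (cmod (\<psi> t))^2))"
proof -
  have [measurable]: "\<psi> \<in> borel_measurable borel" using int by auto
  define A where "A = (\<lambda>x. CLINT t|lborel. \<psi> t * iexp (t * x))"
  have Am[measurable]: "A \<in> borel_measurable borel" unfolding A_def by measurable
  have inti: "integrable lborel (\<lambda>t. \<psi> t * iexp (t * x))" for x
    by (rule Bochner_Integration.integrable_bound[OF int]) (auto simp: norm_mult)
  have A_bd: "cmod (A x) \<le> (LINT t|lborel. cmod (\<psi> t))" for x
    unfolding A_def by (rule integral_norm_bound[THEN order_trans]) (simp add: norm_mult)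
  have igA: "integrable lborel (\<lambda>x. exp (- (k^2 * x^2 / 2)) * (cmod (A x))^2)"
  proof (rule Bochner_Integration.integrable_bound)
    show "integrable lborel (\<lambda>x. exp (- (k^2 * x^2 / 2)) * (LINT t|lborel. cmod (\<psi> t))^2)"
      using integrable_gauss[OF k] by (rule integrable_mult_left)
  qed (use A_bd in \<open>auto intro!: mult_left_mono power_mono\<close>)
  have int3: "integrable (lborel \<Otimes>\<^sub>M lborel) (\<lambda>(t,s). \<psi> t * cnj (\<psi> s))"
  proof (rule lborel_pair.Fubini_integrable)
    show "integrable lborel (\<lambda>x. LINT y|lborel. norm (case (x, y) of (t, s) \<Rightarrow> \<psi> t * cnj (\<psi> s)))"
      using int by (simp add: norm_mult)
    show "AE x in lborel. integrable lborel (\<lambda>y. case (x, y) of (t, s) \<Rightarrow> \<psi> t * cnj (\<psi> s))"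
      using int by simp
  qed measurable

  let ?P = "lborel \<Otimes>\<^sub>M lborel :: (real \<times> real) measure"
  interpret P: pair_sigma_finite ?P "lborel :: real measure"
    by (simp add: pair_sigma_finite_def sigma_finite_lborel lborel_prod)
  define \<Phi> where "\<Phi> = (\<lambda>ts x. \<psi> (fst ts) * cnj (\<psi> (snd ts)) * (complex_of_real (exp (- (k^2 * x^2 / 2))) * iexp (x * (fst ts - snd ts))))"
  have \<Phi>m: "(\<lambda>(ts, x). \<Phi> ts x) \<in> borel_measurable (?P \<Otimes>\<^sub>M lborel)"
    unfolding \<Phi>_def by measurable
  \<comment> \<open>The Gaussian weight in x makes the triple integrand absolutely integrable, so
    that x can be integrated first.\<close>
  have int4: "integrable (?P \<Otimes>\<^sub>M lborel) (\<lambda>(ts, x). \<Phi> ts x)"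
  proof (rule P.Fubini_integrable[OF \<Phi>m])
    have "integrable ?P (\<lambda>ts. norm ((\<lambda>(t,s). \<psi> t * cnj (\<psi> s)) ts) * (LINT x|lborel. exp (- (k^2 * x^2 / 2))))"
      using integrable_norm[OF int3] by (rule integrable_mult_left)
    then show "integrable ?P (\<lambda>ts. LINT x|lborel. norm (case (ts, x) of (ts, x) \<Rightarrow> \<Phi> ts x))"
      by (simp add: \<Phi>_def norm_mult case_prod_beta)
    show "AE ts in ?P. integrable lborel (\<lambda>x. case (ts, x) of (ts, x) \<Rightarrow> \<Phi> ts x)"
      unfolding \<Phi>_def
      by (intro AE_I2)
         (auto intro!: integrable_mult_right Bochner_Integration.integrable_bound[OF integrable_gauss[OF k]] simp: norm_mult)
  qed
  have sq: "complex_of_real (exp (- (k^2 * x^2 / 2)) * (cmod (A x))^2) = (CLINT ts|?P. \<Phi> ts x)" for x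
  proof -
    have i5: "integrable ?P (\<lambda>(t,s). (\<psi> t * iexp (t * x)) * cnj (\<psi> s * iexp (s * x)))"
      by (rule Bochner_Integration.integrable_bound[OF int3]) (auto simp: norm_mult)
    have "complex_of_real ((cmod (A x))^2) = A x * cnj (A x)"
      by (simp add: complex_mult_cnj cmod_def)
    also have "\<dots> = (CLINT t|lborel. CLINT s|lborel. (\<psi> t * iexp (t * x)) * cnj (\<psi> s * iexp (s * x)))"
    proof -
      have "cnj (A x) = (CLINT s|lborel. cnj (\<psi> s * iexp (s * x)))"
        unfolding A_def by (rule Bochner_Integration.integral_cnj[symmetric])
      then have "(CLINT s|lborel. (\<psi> t * iexp (t * x)) * cnj (\<psi> s * iexp (s * x))) = (\<psi> t * iexp (t * x)) * cnj (A x)" for t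
        by (simp only: integral_mult_right_zero)
      then show ?thesis by (simp only:) (simp only: A_def integral_mult_left_zero)
    qed
    also have "\<dots> = (CLINT ts|?P. (\<lambda>(t,s). (\<psi> t * iexp (t * x)) * cnj (\<psi> s * iexp (s * x))) ts)"
      using lborel_pair.integral_fst'[OF i5] by simp
    finally have "complex_of_real ((cmod (A x))^2) = (CLINT ts|?P. (\<lambda>(t,s). (\<psi> t * iexp (t * x)) * cnj (\<psi> s * iexp (s * x))) ts)" .
    then have "complex_of_real (exp (- (k^2 * x^2 / 2)) * (cmod (A x))^2)
      = complex_of_real (exp (- (k^2 * x^2 / 2))) * (CLINT ts|?P. (\<lambda>(t,s). (\<psi> t * iexp (t * x)) * cnj (\<psi> s * iexp (s * x))) ts)"
      by (simp only: of_real_mult)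
    also have "\<dots> = (CLINT ts|?P. \<Phi> ts x)"
      unfolding integral_mult_right_zero[symmetric]
    proof (rule Bochner_Integration.integral_cong[OF refl])
      fix ts :: "real \<times> real"
      have "iexp (fst ts * x) * cnj (iexp (snd ts * x)) = iexp (x * (fst ts - snd ts))"
        by (simp add: exp_cnj exp_add[symmetric] algebra_simps)
      then show "complex_of_real (exp (- (k^2 * x^2 / 2))) * (case ts of (t, s) \<Rightarrow> \<psi> t * iexp (t * x) * cnj (\<psi> s * iexp (s * x))) = \<Phi> ts x"
        unfolding \<Phi>_def by (simp add: case_prod_beta)
    qed
    finally show ?thesis .
  qed
  \<comment> \<open>\<open>normal_density_fourier\<close> with x as the frequency variable: width k,
    evaluated at the difference of the two times.\<close>
  have inner: "(CLINT x|lborel. \<Phi> ts x) = \<psi> (fst ts) * cnj (\<psi> (snd ts)) * (2 * pi * normal_density 0 k (fst ts - snd ts))" for ts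
    unfolding \<Phi>_def by (subst integral_mult_right_zero) (simp add: normal_density_fourier[OF k])
  have "complex_of_real (LINT x|lborel. exp (- (k^2 * x^2 / 2)) * (cmod (A x))^2) = (CLINT x|lborel. CLINT ts|?P. \<Phi> ts x)"
    by (simp only: sq[symmetric] integral_complex_of_real)
  also have "\<dots> = (CLINT ts|?P. CLINT x|lborel. \<Phi> ts x)"
    using P.Fubini_integral[OF int4] by simp
  also have "\<dots> = (CLINT ts|?P. \<psi> (fst ts) * cnj (\<psi> (snd ts)) * (2 * pi * normal_density 0 k (fst ts - snd ts)))"
    by (simp only: inner)
  finally have eq: "complex_of_real (LINT x|lborel. exp (- (k^2 * x^2 / 2)) * (cmod (A x))^2) = \<dots>" .
  have igR: "integrable ?P (\<lambda>ts. \<psi> (fst ts) * cnj (\<psi> (snd ts)) * (2 * pi * normal_density 0 k (fst ts - snd ts)))"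
    using P.integrable_fst'[OF int4] by (simp add: inner)
  define N where "N = (LINT t|lborel. (cmod (\<psi> t))^2)"
  have N: "(\<integral>\<^sup>+t. ennreal ((cmod (\<psi> t))^2) \<partial>lborel) = ennreal N"
    unfolding N_def by (subst nn_integral_eq_integral[OF int2]) auto
  have N0: "N \<ge> 0" unfolding N_def by simp
  have nd: "normal_density 0 k x \<ge> 0" for x by (simp add: normal_density_nonneg)
  have half: "(\<integral>\<^sup>+ts. ennreal (pi * (cmod (\<psi> (fst ts)))^2 * normal_density 0 k (fst ts - snd ts)) \<partial>?P) = ennreal (pi * N)"
  proof -
    have "(\<integral>\<^sup>+ts. ennreal (pi * (cmod (\<psi> (fst ts)))^2 * normal_density 0 k (fst ts - snd ts)) \<partial>?P)
      = (\<integral>\<^sup>+t. \<integral>\<^sup>+s. ennreal (pi * (cmod (\<psi> t))^2 * normal_density 0 k (t - s)) \<partial>lborel \<partial>lborel)"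
      by (subst lborel.nn_integral_fst[symmetric]) auto
    also have "\<dots> = (\<integral>\<^sup>+t. ennreal (pi * (cmod (\<psi> t))^2) \<partial>lborel)"
      by (simp add: ennreal_mult'' nd nn_integral_cmult nn_integral_normal_density[OF k])
    also have "\<dots> = ennreal (pi * N)"
      by (simp add: ennreal_mult' nn_integral_cmult N)
    finally show ?thesis .
  qed
  have half': "(\<integral>\<^sup>+ts. ennreal (pi * (cmod (\<psi> (snd ts)))^2 * normal_density 0 k (fst ts - snd ts)) \<partial>?P) = ennreal (pi * N)"
  proof -
    have "(\<integral>\<^sup>+ts. ennreal (pi * (cmod (\<psi> (snd ts)))^2 * normal_density 0 k (fst ts - snd ts)) \<partial>?P)
      = (\<integral>\<^sup>+s. \<integral>\<^sup>+t. ennreal (pi * (cmod (\<psi> s))^2 * normal_density 0 k (t - s)) \<partial>lborel \<partial>lborel)"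
      by (subst lborel_pair.nn_integral_snd[symmetric]) auto
    also have "\<dots> = (\<integral>\<^sup>+t. ennreal (pi * (cmod (\<psi> t))^2) \<partial>lborel)"
      by (simp add: ennreal_mult'' nd nn_integral_cmult nn_integral_normal_density[OF k])
    also have "\<dots> = ennreal (pi * N)"
      by (simp add: ennreal_mult' nn_integral_cmult N)
    finally show ?thesis .
  qed
  have "ennreal (LINT x|lborel. exp (- (k^2 * x^2 / 2)) * (cmod (A x))^2)
      \<le> ennreal (cmod (complex_of_real (LINT x|lborel. exp (- (k^2 * x^2 / 2)) * (cmod (A x))^2)))"
    by (intro ennreal_leI) auto
  also have "\<dots> \<le> (\<integral>\<^sup>+ts. ennreal (norm (\<psi> (fst ts) * cnj (\<psi> (snd ts)) * (2 * pi * normal_density 0 k (fst ts - snd ts)))) \<partial>?P)"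
    unfolding eq by (rule integral_norm_bound_ennreal[OF igR])
  also have "\<dots> \<le> (\<integral>\<^sup>+ts. ennreal (pi * (cmod (\<psi> (fst ts)))^2 * normal_density 0 k (fst ts - snd ts))
       + ennreal (pi * (cmod (\<psi> (snd ts)))^2 * normal_density 0 k (fst ts - snd ts)) \<partial>?P)"
  proof (intro nn_integral_mono)
    fix ts :: "real \<times> real"
    have "2 * cmod (\<psi> (fst ts)) * cmod (\<psi> (snd ts)) \<le> (cmod (\<psi> (fst ts)))^2 + (cmod (\<psi> (snd ts)))^2"
      using sum_squares_bound by blast
    then have "pi * normal_density 0 k (fst ts - snd ts) * (2 * cmod (\<psi> (fst ts)) * cmod (\<psi> (snd ts)))
      \<le> pi * normal_density 0 k (fst ts - snd ts) * ((cmod (\<psi> (fst ts)))^2 + (cmod (\<psi> (snd ts)))^2)"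
      by (intro mult_left_mono) (auto simp: nd)
    then have "ennreal (norm (\<psi> (fst ts) * cnj (\<psi> (snd ts)) * (2 * pi * normal_density 0 k (fst ts - snd ts))))
      \<le> ennreal (pi * (cmod (\<psi> (fst ts)))^2 * normal_density 0 k (fst ts - snd ts)
        + pi * (cmod (\<psi> (snd ts)))^2 * normal_density 0 k (fst ts - snd ts))"
      by (intro ennreal_leI) (auto simp: norm_mult algebra_simps)
    also have "\<dots> = ennreal (pi * (cmod (\<psi> (fst ts)))^2 * normal_density 0 k (fst ts - snd ts))
       + ennreal (pi * (cmod (\<psi> (snd ts)))^2 * normal_density 0 k (fst ts - snd ts))"
      by (rule ennreal_plus) auto
    finally show "ennreal (norm (\<psi> (fst ts) * cnj (\<psi> (snd ts)) * (2 * pi * normal_density 0 k (fst ts - snd ts))))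
      \<le> ennreal (pi * (cmod (\<psi> (fst ts)))^2 * normal_density 0 k (fst ts - snd ts))
       + ennreal (pi * (cmod (\<psi> (snd ts)))^2 * normal_density 0 k (fst ts - snd ts))" .
  qed
  also have "\<dots> = ennreal (pi * N) + ennreal (pi * N)"
    by (subst nn_integral_add) (auto simp: half half')
  also have "\<dots> = ennreal (2 * pi * N)"
    using N0 by (subst ennreal_plus[symmetric]) (auto simp: algebra_simps)
  finally have fin: "ennreal (LINT x|lborel. exp (- (k^2 * x^2 / 2)) * (cmod (A x))^2) \<le> ennreal (2 * pi * N)" .
  have "(\<integral>\<^sup>+x. ennreal (exp (- (k^2 * x^2 / 2)) * (cmod (A x))^2) \<partial>lborel)
     = ennreal (LINT x|lborel. exp (- (k^2 * x^2 / 2)) * (cmod (A x))^2)"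
    by (rule nn_integral_eq_integral[OF igA]) auto
  then show ?thesis using fin unfolding A_def N_def by simp
qed

text \<open>The inequality half of Plancherel is all that is used. The weight is removed by k =
  1/(n+1) tending to 0 and Fatou, since the bound of \<open>bessel_gauss\<close> does not depend on
  k.\<close>

lemma bessel:
  fixes \<psi> :: "real \<Rightarrow> complex"
  assumes int: "integrable lborel \<psi>" and int2: "integrable lborel (\<lambda>t. (cmod (\<psi> t))^2)"
  shows "(\<integral>\<^sup>+x. ennreal ((cmod (CLINT t|lborel. \<psi> t * iexp (t * x)))^2) \<partial>lborel)
     \<le> ennreal (2 * pi * (LINT t|lborel. (cmod (\<psi> t))^2))"
proof -
  have [measurable]: "\<psi> \<in> borel_measurable borel" using int by auto
  define A where "A = (\<lambda>x. CLINT t|lborel. \<psi> t * iexp (t * x))"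
  have Am[measurable]: "A \<in> borel_measurable borel" unfolding A_def by measurable
  define k :: "nat \<Rightarrow> real" where "k = (\<lambda>n. inverse (real (Suc n)))"
  have k: "k \<longlonglongrightarrow> 0" unfolding k_def by (rule LIMSEQ_inverse_real_of_nat)
  have "(\<integral>\<^sup>+x. ennreal ((cmod (A x))^2) \<partial>lborel) =
    (\<integral>\<^sup>+x. liminf (\<lambda>n. ennreal (exp (- ((k n)^2 * x^2 / 2)) * (cmod (A x))^2)) \<partial>lborel)"
  proof (intro nn_integral_cong)
    fix x
    have "(\<lambda>n. ennreal (exp (- ((k n)^2 * x^2 / 2)) * (cmod (A x))^2)) \<longlonglongrightarrow> ennreal (exp (- (0^2 * x^2 / 2)) * (cmod (A x))^2)"
      by (intro tendsto_intros k) auto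
    then show "ennreal ((cmod (A x))^2) = liminf (\<lambda>n. ennreal (exp (- ((k n)^2 * x^2 / 2)) * (cmod (A x))^2))"
      using lim_imp_Liminf[OF trivial_limit_sequentially] by (metis (no_types, lifting) div_0 exp_zero minus_zero mult_1 mult_zero_left power_zero_numeral)
  qed
  also have "\<dots> \<le> liminf (\<lambda>n. \<integral>\<^sup>+x. ennreal (exp (- ((k n)^2 * x^2 / 2)) * (cmod (A x))^2) \<partial>lborel)"
    by (rule nn_integral_liminf) measurable
  also have "\<dots> \<le> liminf (\<lambda>n. ennreal (2 * pi * (LINT t|lborel. (cmod (\<psi> t))^2)))"
    unfolding A_def by (intro Liminf_mono always_eventually allI bessel_gauss[OF int int2]) (simp add: k_def)
  also have "\<dots> = ennreal (2 * pi * (LINT t|lborel. (cmod (\<psi> t))^2))"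
    by (simp add: Liminf_const)
  finally show ?thesis by (simp add: A_def)
qed

section \<open>Shifting the line of integration\<close>

text \<open>On the convex strip K has a primitive \<Phi>, so a truncated vertical integral is a
  difference of two values of \<Phi>. Comparing the two lines leaves only horizontal increments of
  \<Phi> at heights n and -n, and the Gaussian bound sends these to 0.\<close>

lemma shift_line:
  fixes K :: "complex \<Rightarrow> complex"
  assumes hol: "K holomorphic_on {s. -\<delta> < Re s \<and> Re s < \<delta>}" and th: "0 < \<theta>" "\<theta> < \<delta>"
    and c: "c > 0" and bd: "\<And>s. \<bar>Re s\<bar> < \<delta> \<Longrightarrow> cmod (K s) \<le> D * exp (- (c^2 * (Im s)^2 / 2))"
  shows "(CLINT t|lborel. K (Complex \<theta> t)) = (CLINT t|lborel. K (Complex (-\<theta>) t))"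
proof -
  let ?S = "{s. -\<delta> < Re s \<and> Re s < \<delta>}"
  have S: "open ?S" "convex ?S"
    by (auto simp: Collect_conj_eq convex_halfspace_Re_lt convex_halfspace_Re_gt
       intro!: open_Int convex_Int open_halfspace_Re_lt open_halfspace_Re_gt)
  obtain \<Phi> where \<Phi>': "\<And>s. s \<in> ?S \<Longrightarrow> (\<Phi> has_field_derivative K s) (at s within ?S)"
    using holomorphic_convex_primitive'[OF S(2,1) hol] by blast
  have \<Phi>: "(\<Phi> has_field_derivative K s) (at s)" if "s \<in> ?S" for s
    using \<Phi>'[OF that] unfolding at_within_open[OF that S(1)] .
  have cont: "continuous_on UNIV (\<lambda>t. K (Complex a t))" if "\<bar>a\<bar> < \<delta>" for a
    using that by (intro continuous_on_compose2[OF holomorphic_on_imp_continuous_on[OF hol]])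
       (auto simp: Complex_eq intro!: continuous_intros)
  have int: "integrable lborel (\<lambda>t. K (Complex a t))" if "\<bar>a\<bar> < \<delta>" for a
  proof (rule Bochner_Integration.integrable_bound)
    show "integrable lborel (\<lambda>t. D * exp (- (c^2 * t^2 / 2)))"
      using integrable_gauss[OF c] by (rule integrable_mult_right)
    show "(\<lambda>t. K (Complex a t)) \<in> borel_measurable lborel"
      using cont[OF that] by (simp add: borel_measurable_continuous_onI)
    have "cmod (K (Complex a t)) \<le> \<bar>D * exp (- (c^2 * t^2 / 2))\<bar>" for t
      using bd[of "Complex a t"] that by simp
    then show "AE t in lborel. cmod (K (Complex a t)) \<le> norm (D * exp (- (c^2 * t^2 / 2)))" by simp
  qed
  have lim: "(\<lambda>n. CLINT t:{-real n..real n}|lborel. K (Complex a t)) \<longlonglongrightarrow> (CLINT t|lborel. K (Complex a t))"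
    if "\<bar>a\<bar> < \<delta>" for a
    unfolding set_lebesgue_integral_def
  proof (rule integral_dominated_convergence[where w = "\<lambda>t. cmod (K (Complex a t))"])
    show "integrable lborel (\<lambda>t. cmod (K (Complex a t)))" using int[OF that] by (rule integrable_norm)
    show "AE t in lborel. (\<lambda>n. indicat_real {-real n..real n} t *\<^sub>R K (Complex a t)) \<longlonglongrightarrow> K (Complex a t)"
    proof (intro AE_I2 tendsto_eventually)
      fix t
      obtain N :: nat where N: "\<bar>t\<bar> \<le> real N" using real_arch_simple by blast
      show "\<forall>\<^sub>F n in sequentially. indicat_real {-real n..real n} t *\<^sub>R K (Complex a t) = K (Complex a t)"
        using eventually_ge_at_top[of N] by eventually_elim (use N in \<open>auto simp: indicator_def\<close>)
    qed
  qed (use int[OF that] in \<open>auto simp: indicator_def\<close>)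
  \<comment> \<open>Along a vertical line ds = i dt, whence the factor -i.\<close>
  have FTC: "(CLINT t:{-real n..real n}|lborel. K (Complex a t)) = - \<i> * (\<Phi> (Complex a n) - \<Phi> (Complex a (- real n)))"
    if "\<bar>a\<bar> < \<delta>" for a n
  proof -
    have "((\<lambda>t. - \<i> * \<Phi> (Complex a t)) has_vector_derivative K (Complex a t)) (at t within {-real n..real n})" for t
    proof -
      have "((\<lambda>t. Complex a t) has_vector_derivative \<i>) (at t within {-real n..real n})"
        by (auto simp: Complex_eq intro!: derivative_eq_intros)
      moreover have "(\<Phi> has_field_derivative K (Complex a t)) (at (Complex a t))"
        using that by (intro \<Phi>) auto
      ultimately have "((\<Phi> \<circ> (\<lambda>t. Complex a t)) has_vector_derivative \<i> * K (Complex a t)) (at t within {-real n..real n})"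
        by (intro field_vector_diff_chain_within) (auto intro: has_field_derivative_at_within)
      from has_vector_derivative_mult_right[OF this, of "-\<i>"] show ?thesis
        by (simp add: o_def)
    qed
    then have I: "((\<lambda>t. K (Complex a t)) has_integral (- \<i> * \<Phi> (Complex a n) - (- \<i> * \<Phi> (Complex a (- real n))))) {-real n..real n}"
      by (intro fundamental_theorem_of_calculus) auto
    have J: "set_integrable lborel {-real n..real n} (\<lambda>t. K (Complex a t))"
      unfolding set_integrable_def using int[OF that] by (intro integrable_mult_indicator) simp_all
    show ?thesis
      unfolding set_borel_integral_eq_integral(2)[OF J] integral_unique[OF I] by (simp add: algebra_simps)
  qed
  have hor: "cmod (\<Phi> (Complex \<theta> t) - \<Phi> (Complex (-\<theta>) t)) \<le> \<bar>D\<bar> * exp (- (c^2 * t^2 / 2)) * (2 * \<theta>)" for t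
  proof -
    have "cmod (\<Phi> (Complex \<theta> t) - \<Phi> (Complex (-\<theta>) t)) \<le> \<bar>D\<bar> * exp (- (c^2 * t^2 / 2)) * cmod (Complex \<theta> t - Complex (-\<theta>) t)"
    proof (rule field_differentiable_bound[where S = "closed_segment (Complex (-\<theta>) t) (Complex \<theta> t)" and f' = K])
      have seg: "s \<in> ?S \<and> Im s = t" if s: "s \<in> closed_segment (Complex (-\<theta>) t) (Complex \<theta> t)" for s
      proof -
        have "closed_segment (Complex (-\<theta>) t) (Complex \<theta> t) \<subseteq> {s. -\<theta> \<le> Re s \<and> Re s \<le> \<theta> \<and> Im s = t}"
          using closed_segment_same_Im[of "Complex (-\<theta>) t" "Complex \<theta> t"] th
          by (auto simp: closed_segment_eq_real_ivl)
        then show ?thesis using s th by auto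
      qed
      show "convex (closed_segment (Complex (-\<theta>) t) (Complex \<theta> t))" by simp
      fix s assume s: "s \<in> closed_segment (Complex (-\<theta>) t) (Complex \<theta> t)"
      show "(\<Phi> has_field_derivative K s) (at s within closed_segment (Complex (-\<theta>) t) (Complex \<theta> t))"
        using \<Phi> seg[OF s] by (auto intro: has_field_derivative_at_within)
      have "cmod (K s) \<le> D * exp (- (c^2 * t^2 / 2))"
        using bd[of s] seg[OF s] by auto
      also have "\<dots> \<le> \<bar>D\<bar> * exp (- (c^2 * t^2 / 2))" by (intro mult_right_mono) auto
      finally show "cmod (K s) \<le> \<bar>D\<bar> * exp (- (c^2 * t^2 / 2))" .
    qed auto
    moreover have "Complex \<theta> t - Complex (-\<theta>) t = of_real (2 * \<theta>)" by (simp add: complex_eq_iff)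
    ultimately show ?thesis using th by simp
  qed
  have g0: "(\<lambda>n. \<bar>D\<bar> * exp (- (c^2 * (real n)^2 / 2)) * (2 * \<theta>) + \<bar>D\<bar> * exp (- (c^2 * (real n)^2 / 2)) * (2 * \<theta>)) \<longlonglongrightarrow> 0"
    using c by real_asymp
  have "(\<lambda>n. (CLINT t:{-real n..real n}|lborel. K (Complex \<theta> t)) - (CLINT t:{-real n..real n}|lborel. K (Complex (-\<theta>) t))) \<longlonglongrightarrow> 0"
  proof (rule Lim_null_comparison[OF _ g0], intro always_eventually allI)
    fix n :: nat
    have "(CLINT t:{-real n..real n}|lborel. K (Complex \<theta> t)) - (CLINT t:{-real n..real n}|lborel. K (Complex (-\<theta>) t))
      = - \<i> * ((\<Phi> (Complex \<theta> n) - \<Phi> (Complex (-\<theta>) n)) - (\<Phi> (Complex \<theta> (- real n)) - \<Phi> (Complex (-\<theta>) (- real n))))"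
      using th FTC[of \<theta> n] FTC[of "-\<theta>" n] by (simp add: algebra_simps)
    also have "cmod \<dots> \<le> cmod (\<Phi> (Complex \<theta> n) - \<Phi> (Complex (-\<theta>) n)) + cmod (\<Phi> (Complex \<theta> (- real n)) - \<Phi> (Complex (-\<theta>) (- real n)))"
      by (simp add: norm_mult norm_triangle_ineq4)
    also have "\<dots> \<le> \<bar>D\<bar> * exp (- (c^2 * (real n)^2 / 2)) * (2 * \<theta>) + \<bar>D\<bar> * exp (- (c^2 * (real n)^2 / 2)) * (2 * \<theta>)"
      using hor[of n] hor[of "- real n"] by (intro add_mono) auto
    finally show "cmod ((CLINT t:{-real n..real n}|lborel. K (Complex \<theta> t)) - (CLINT t:{-real n..real n}|lborel. K (Complex (-\<theta>) t)))
       \<le> \<bar>D\<bar> * exp (- (c^2 * (real n)^2 / 2)) * (2 * \<theta>) + \<bar>D\<bar> * exp (- (c^2 * (real n)^2 / 2)) * (2 * \<theta>)" .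
  qed
  moreover have "(\<lambda>n. (CLINT t:{-real n..real n}|lborel. K (Complex \<theta> t)) - (CLINT t:{-real n..real n}|lborel. K (Complex (-\<theta>) t)))
     \<longlonglongrightarrow> (CLINT t|lborel. K (Complex \<theta> t)) - (CLINT t|lborel. K (Complex (-\<theta>) t))"
    using th by (intro tendsto_diff lim) auto
  ultimately show ?thesis using LIMSEQ_unique by fastforce
qed

text \<open>Inversion integral of the Gaussian along an arbitrary vertical line. Completing the
  square moves the argument to y + \<sigma>^2 \<theta>, and the prefactor exp (\<theta> y +
  \<sigma>^2 \<theta>^2 / 2) undoes exactly that shift, so the value does not depend on
  \<theta>.\<close>

lemma gauss_vertical:
  assumes \<sigma>: "\<sigma> > 0"
  shows "(CLINT t|lborel. exp (Complex \<theta> t * of_real y + of_real (\<sigma>^2) * (Complex \<theta> t)^2 / 2)) = of_real (2 * pi * normal_density 0 \<sigma> y)"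
proof -
  have e: "exp (Complex \<theta> t * of_real y + of_real (\<sigma>^2) * (Complex \<theta> t)^2 / 2)
    = of_real (exp (\<theta> * y + \<sigma>^2 * \<theta>^2 / 2)) * (complex_of_real (exp (- (\<sigma>^2 * t^2 / 2))) * iexp (t * (y + \<sigma>^2 * \<theta>)))" for t
    unfolding exp_of_real[symmetric] exp_add[symmetric]
    by (rule arg_cong[where f = exp]) (simp add: Complex_eq power2_eq_square algebra_simps add_divide_distrib diff_divide_distrib)
  have "(CLINT t|lborel. exp (Complex \<theta> t * of_real y + of_real (\<sigma>^2) * (Complex \<theta> t)^2 / 2))
    = of_real (exp (\<theta> * y + \<sigma>^2 * \<theta>^2 / 2)) * of_real (2 * pi * normal_density 0 \<sigma> (y + \<sigma>^2 * \<theta>))"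
    unfolding e by (subst integral_mult_right_zero) (simp add: normal_density_fourier[OF \<sigma>])
  also have "\<dots> = of_real (2 * pi * normal_density 0 \<sigma> y)"
  proof -
    have "- ((y + \<sigma>^2 * \<theta>)^2) / (2 * \<sigma>^2) = - (y^2) / (2 * \<sigma>^2) - (\<theta> * y + \<sigma>^2 * \<theta>^2 / 2)"
      using \<sigma> by (simp add: field_simps power2_eq_square)
    then have "exp (\<theta> * y + \<sigma>^2 * \<theta>^2 / 2) * normal_density 0 \<sigma> (y + \<sigma>^2 * \<theta>) = normal_density 0 \<sigma> y"
      by (simp add: normal_density_def exp_diff)
    then have "exp (\<theta> * y + \<sigma>^2 * \<theta>^2 / 2) * (2 * pi * normal_density 0 \<sigma> (y + \<sigma>^2 * \<theta>)) = 2 * pi * normal_density 0 \<sigma> y"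
      by (simp add: mult_ac)
    then show ?thesis by (simp only: of_real_mult[symmetric])
  qed
  finally show ?thesis .
qed

text \<open>Up to the factor e^{1/2}, the functions e^y and e^{-y} times the standard normal density
  are the normal densities with means 1 and -1.\<close>

lemma integrable_exp_abs_normal:
  "integrable lborel (\<lambda>y. exp \<bar>y\<bar> * normal_density 0 1 y)"
proof (rule Bochner_Integration.integrable_bound)
  show "integrable lborel (\<lambda>y. exp (1/2) * normal_density 1 1 y + exp (1/2) * normal_density (-1) 1 y)"
    by (intro Bochner_Integration.integrable_add integrable_mult_right integrable_normal_density) auto
  have e: "exp (1/2) * normal_density s 1 y = exp (s * y) * normal_density 0 1 y" if "s^2 = 1" for s y :: real
  proof -
    have "1/2 - (y - s)^2 / 2 = s * y - y^2/2" using that by (simp add: power2_eq_square field_simps)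
    then have "exp (1/2) * exp (- ((y - s)^2 / 2)) = exp (s * y) * exp (- (y^2 / 2))"
      unfolding exp_add[symmetric] by simp
    then show ?thesis by (simp add: normal_density_def)
  qed
  have "exp \<bar>y\<bar> * normal_density 0 1 y \<le> exp y * normal_density 0 1 y + exp (- y) * normal_density 0 1 y" for y :: real
    by (cases "y \<ge> 0") auto
  then show "AE y in lborel. norm (exp \<bar>y\<bar> * normal_density 0 1 y) \<le> norm (exp (1/2) * normal_density 1 1 y + exp (1/2) * normal_density (-1) 1 y)"
    using e[of 1] e[of "-1"] by (auto simp: abs_of_nonneg add_nonneg_nonneg)
qed measurable

lemma gauss_smooth_affine:
  assumes \<sigma>: "\<sigma> > 0"
  shows "(LINT u|lborel. q u * normal_density 0 \<sigma> (x - u)) = (LINT y|lborel. q (x - \<sigma> * y) * normal_density 0 1 y)"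
proof -
  have "(LINT u|lborel. q u * normal_density 0 \<sigma> (x - u))
    = \<bar>-\<sigma>\<bar> *\<^sub>R (LINT y|lborel. q (x + (-\<sigma>) * y) * normal_density 0 \<sigma> (x - (x + (-\<sigma>) * y)))"
    using \<sigma> by (intro lborel_integral_real_affine) auto
  also have "\<dots> = (LINT y|lborel. \<sigma> * (q (x - \<sigma> * y) * normal_density 0 \<sigma> (\<sigma> * y)))"
    using \<sigma> by simp
  also have "\<dots> = (LINT y|lborel. q (x - \<sigma> * y) * normal_density 0 1 y)"
  proof (rule Bochner_Integration.integral_cong[OF refl])
    fix y
    have "\<sigma> * normal_density 0 \<sigma> (\<sigma> * y) = normal_density 0 1 y"
      using \<sigma> by (simp add: normal_density_def real_sqrt_mult power_mult_distrib field_simps)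
    then show "\<sigma> * (q (x - \<sigma> * y) * normal_density 0 \<sigma> (\<sigma> * y)) = q (x - \<sigma> * y) * normal_density 0 1 y"
      by (metis mult.left_commute)
  qed
  finally show ?thesis .
qed

text \<open>Approximate identity at a continuity point. Exponential growth of q is harmless because
  \<sigma> \<le> 1: after rescaling, a multiple of exp |x| exp |y| times the normal density
  dominates.\<close>

lemma gauss_smooth_tendsto:
  fixes q :: "real \<Rightarrow> real"
  assumes [measurable]: "q \<in> borel_measurable borel" and bd: "\<And>u. \<bar>q u\<bar> \<le> A * exp \<bar>u\<bar>"
    and cont: "isCont q x" and \<sigma>: "\<And>n. 0 < \<sigma> n" "\<And>n. \<sigma> n \<le> 1" "\<sigma> \<longlonglongrightarrow> 0"
  shows "(\<lambda>n. LINT u|lborel. q u * normal_density 0 (\<sigma> n) (x - u)) \<longlonglongrightarrow> q x"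
proof -
  have A: "A \<ge> 0" using bd[of 0] by simp
  have "(\<lambda>n. LINT y|lborel. q (x - \<sigma> n * y) * normal_density 0 1 y) \<longlonglongrightarrow> (LINT y|lborel. q x * normal_density 0 1 y)"
  proof (rule integral_dominated_convergence[where w = "\<lambda>y. (A * exp \<bar>x\<bar>) * (exp \<bar>y\<bar> * normal_density 0 1 y)"])
    show "integrable lborel (\<lambda>y. (A * exp \<bar>x\<bar>) * (exp \<bar>y\<bar> * normal_density 0 1 y))"
      using integrable_exp_abs_normal by (rule integrable_mult_right)
    show "AE y in lborel. (\<lambda>n. q (x - \<sigma> n * y) * normal_density 0 1 y) \<longlonglongrightarrow> q x * normal_density 0 1 y"
    proof (intro AE_I2 tendsto_mult tendsto_const)
      fix y
      have "(\<lambda>n. x - \<sigma> n * y) \<longlonglongrightarrow> x - 0 * y" by (intro tendsto_intros \<sigma>)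
      then show "(\<lambda>n. q (x - \<sigma> n * y)) \<longlonglongrightarrow> q x" by (intro isCont_tendsto_compose[OF cont]) simp
    qed
    show "AE y in lborel. norm (q (x - \<sigma> n * y) * normal_density 0 1 y) \<le> (A * exp \<bar>x\<bar>) * (exp \<bar>y\<bar> * normal_density 0 1 y)" for n
    proof (intro AE_I2)
      fix y :: real
      have "\<bar>\<sigma> n * y\<bar> \<le> 1 * \<bar>y\<bar>" unfolding abs_mult using \<sigma>(1,2)[of n] by (intro mult_right_mono) auto
      then have "\<bar>x - \<sigma> n * y\<bar> \<le> \<bar>x\<bar> + \<bar>y\<bar>" by linarith
      then have "A * exp \<bar>x - \<sigma> n * y\<bar> \<le> A * (exp \<bar>x\<bar> * exp \<bar>y\<bar>)"
        using A by (intro mult_left_mono) (auto simp: exp_add[symmetric])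
      then have "\<bar>q (x - \<sigma> n * y)\<bar> \<le> A * (exp \<bar>x\<bar> * exp \<bar>y\<bar>)" using bd order_trans by blast
      then have "\<bar>q (x - \<sigma> n * y)\<bar> * normal_density 0 1 y \<le> A * (exp \<bar>x\<bar> * exp \<bar>y\<bar>) * normal_density 0 1 y"
        by (intro mult_right_mono) auto
      then show "norm (q (x - \<sigma> n * y) * normal_density 0 1 y) \<le> (A * exp \<bar>x\<bar>) * (exp \<bar>y\<bar> * normal_density 0 1 y)"
        by (simp add: abs_mult mult_ac)
    qed
  qed measurable
  then show ?thesis using \<sigma>(1) by (simp add: gauss_smooth_affine)
qed

lemma integrable_inverse_sq: "integrable lborel (\<lambda>t::real. inverse (1 + t^2))"
  and integral_inverse_sq: "(LINT t|lborel. inverse (1 + t^2)) = pi"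
proof -
  show "integrable lborel (\<lambda>t::real. inverse (1 + t^2))"
    using integrable_inverse_1_plus_square by (simp add: set_integrable_def)
  show "(LINT t|lborel. inverse (1 + t^2)) = pi"
    using LBINT_inverse_1_plus_square by (simp add: interval_lebesgue_integral_def set_lebesgue_integral_def)
qed

lemma integrable_inverse_abs_sq: "integrable lborel (\<lambda>t::real. 1 / (1 + \<bar>t\<bar>)^2)"
proof (rule Bochner_Integration.integrable_bound[OF integrable_inverse_sq])
  have le: "1 / (1 + \<bar>t\<bar>)^2 \<le> inverse (1 + t^2)" for t :: real
  proof -
    have "1 + t^2 \<le> (1 + \<bar>t\<bar>)^2" by (simp add: power2_sum)
    moreover have "0 < 1 + t^2" by (simp add: add_pos_nonneg)
    ultimately show ?thesis unfolding inverse_eq_divide by (intro divide_left_mono mult_pos_pos) auto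
  qed
  have "norm (1 / (1 + \<bar>t\<bar>)^2) \<le> norm (inverse (1 + t^2))" for t :: real
    using order_trans[OF le[of t] abs_ge_self] unfolding real_norm_def by (subst abs_of_nonneg) auto
  then show "AE t in lborel. norm (1 / (1 + \<bar>t\<bar>)^2) \<le> norm (inverse (1 + (t::real)^2))" by (intro AE_I2)
qed measurable

text \<open>The transform of \<open>q\<close> is known to equal \<open>h\<close> only to the right of \<open>0\<close>. Smoothing \<open>q\<close> with a Gaussian makes the
  inversion integral absolutely convergent, so its line can be moved to \<open>Re s = -\<theta>\<close>; the Bessel inequality is
  uniform in the smoothing.\<close>

lemma paley_wiener_weight:
  fixes q :: "real \<Rightarrow> real" and h :: "complex \<Rightarrow> complex"
  assumes hol: "h holomorphic_on {s. -\<delta> < Re s \<and> Re s < \<delta>}"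
    and hbd: "\<And>s. \<bar>Re s\<bar> < \<delta> \<Longrightarrow> cmod (h s) \<le> C / (1 + \<bar>Im s\<bar>)"
    and [measurable]: "q \<in> borel_measurable borel" and qbd: "\<And>u. \<bar>q u\<bar> \<le> A * exp \<bar>u\<bar>"
    and lapi: "\<And>s. 0 < Re s \<Longrightarrow> Re s < \<delta> \<Longrightarrow> integrable lborel (\<lambda>u. exp (- s * of_real u) * of_real (q u))"
    and lap: "\<And>s. 0 < Re s \<Longrightarrow> Re s < \<delta> \<Longrightarrow> (CLINT u|lborel. exp (- s * of_real u) * of_real (q u)) = h s"
    and cont: "AE x in lborel. isCont q x"
    and th: "0 < \<theta>" "\<theta> < \<delta>"
  shows "(\<integral>\<^sup>+x. ennreal ((exp (\<theta> * x) * q x)^2) \<partial>lborel) < \<infinity>"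
proof -
  define R where "R \<sigma> x = (LINT u|lborel. q u * normal_density 0 \<sigma> (x - u))" for \<sigma> x
  define G where "G \<sigma> s = exp (of_real (\<sigma>^2) * s^2 / 2) * h s" for \<sigma> :: real and s
  have C: "C \<ge> 0" using hbd[of 0] th by (smt (verit) abs_zero div_by_1 norm_ge_zero zero_complex.sel)
  have normG: "cmod (exp (of_real (\<sigma>^2) * s^2 / 2)) = exp (\<sigma>^2 * (Re s)^2 / 2) * exp (- (\<sigma>^2 * (Im s)^2 / 2))" for \<sigma> s
    by (simp add: exp_add[symmetric] power2_eq_square algebra_simps diff_divide_distrib)
  have hcont: "continuous_on UNIV (\<lambda>t. h (Complex a t))" if "\<bar>a\<bar> < \<delta>" for a
    using that by (intro continuous_on_compose2[OF holomorphic_on_imp_continuous_on[OF hol]])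
       (auto simp: Complex_eq intro!: continuous_intros)
  have Cmeas [measurable]: "(\<lambda>t. Complex a t) \<in> borel_measurable borel" for a
    by (intro borel_measurable_continuous_onI) (auto simp: Complex_eq intro!: continuous_intros)
  have hmeas: "(\<lambda>t. h (Complex a t)) \<in> borel_measurable borel" if "\<bar>a\<bar> < \<delta>" for a
    using hcont[OF that] by (simp add: borel_measurable_continuous_onI)
  have hC: "cmod (h s) \<le> C" if "\<bar>Re s\<bar> < \<delta>" for s
  proof -
    have "C / (1 + \<bar>Im s\<bar>) \<le> C / 1" using C by (intro divide_left_mono) auto
    then show ?thesis using hbd[OF that] by simp
  qed
  \<comment> \<open>On Re s = \<theta> > 0 the transform of q converges absolutely, so Fubini turns
    the Gaussian average of q into an inversion integral with the convergence factor exp (\<sigma>^2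
    s^2 / 2).\<close>
  have inv: "of_real (2 * pi * R \<sigma> x) = (CLINT t|lborel. exp (Complex \<theta> t * of_real x) * G \<sigma> (Complex \<theta> t))"
    if \<sigma>: "\<sigma> > 0" for \<sigma> x
  proof -
    let ?E = "\<lambda>t. exp (Complex \<theta> t * of_real x + of_real (\<sigma>^2) * (Complex \<theta> t)^2 / 2)"
    let ?f = "\<lambda>(u, t). of_real (q u) * (?E t * exp (- Complex \<theta> t * of_real u)) :: complex"
    have qi: "integrable lborel (\<lambda>u. exp (- \<theta> * u) * \<bar>q u\<bar>)"
      using integrable_norm[OF lapi[of "of_real \<theta>"]] th by (simp add: norm_mult)
    have nf: "norm (?f (u, t)) = (exp (- \<theta> * u) * \<bar>q u\<bar>) * (exp (\<theta> * x + \<sigma>^2 * \<theta>^2 / 2) * exp (- (\<sigma>^2 * t^2 / 2)))" for u t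
      using normG[of \<sigma> "Complex \<theta> t"]
      by (simp add: norm_mult exp_add del: norm_exp_eq_Re) (simp add: mult_ac)
    have fm: "?f \<in> borel_measurable (lborel \<Otimes>\<^sub>M lborel)" by measurable
    have fi: "integrable (lborel \<Otimes>\<^sub>M lborel) ?f"
    proof (rule lborel_pair.Fubini_integrable[OF fm])
      show "integrable lborel (\<lambda>u. LINT t|lborel. norm (?f (u, t)))"
        unfolding nf using qi by (subst integral_mult_right_zero) (rule integrable_mult_left)
      show "AE u in lborel. integrable lborel (\<lambda>t. ?f (u, t))"
      proof (intro AE_I2)
        fix u :: real
        have "integrable lborel (\<lambda>t. norm (?f (u, t)))"
          unfolding nf by (intro integrable_mult_right integrable_gauss \<sigma>)
        moreover have "(\<lambda>t. ?f (u, t)) \<in> borel_measurable lborel"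
          by (rule measurable_Pair2[OF fm]) simp
        ultimately show "integrable lborel (\<lambda>t. ?f (u, t))"
          using integrable_norm_iff by blast
      qed
    qed
    have "of_real (2 * pi * R \<sigma> x) = (CLINT u|lborel. complex_of_real (2 * pi * (q u * normal_density 0 \<sigma> (x - u))))"
      unfolding R_def integral_complex_of_real by (subst integral_mult_right_zero) (rule refl)
    also have "\<dots> = (CLINT u|lborel. CLINT t|lborel. ?f (u, t))"
    proof (rule Bochner_Integration.integral_cong[OF refl])
      fix u
      have "(CLINT t|lborel. ?f (u, t)) = of_real (q u) * (CLINT t|lborel. exp (Complex \<theta> t * of_real (x - u) + of_real (\<sigma>^2) * (Complex \<theta> t)^2 / 2))"
        unfolding prod.case by (subst integral_mult_right_zero) (simp add: exp_add[symmetric] algebra_simps)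
      then show "complex_of_real (2 * pi * (q u * normal_density 0 \<sigma> (x - u))) = (CLINT t|lborel. ?f (u, t))"
        unfolding gauss_vertical[OF \<sigma>] by (auto simp: mult.assoc)
    qed
    also have "\<dots> = (CLINT t|lborel. CLINT u|lborel. ?f (u, t))"
      using lborel_pair.Fubini_integral[OF fi] by simp
    also have "\<dots> = (CLINT t|lborel. exp (Complex \<theta> t * of_real x) * G \<sigma> (Complex \<theta> t))"
    proof (rule Bochner_Integration.integral_cong[OF refl])
      fix t
      have "(CLINT u|lborel. ?f (u, t)) = (CLINT u|lborel. ?E t * (exp (- Complex \<theta> t * of_real u) * of_real (q u)))"
        by (intro Bochner_Integration.integral_cong) auto
      also have "\<dots> = ?E t * h (Complex \<theta> t)"
        by (subst integral_mult_right_zero) (subst lap, use th in auto)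
      finally show "(CLINT u|lborel. ?f (u, t)) = exp (Complex \<theta> t * of_real x) * G \<sigma> (Complex \<theta> t)"
        unfolding G_def by (simp add: exp_add mult.assoc)
    qed
    finally show ?thesis .
  qed
  have shift: "(CLINT t|lborel. exp (Complex \<theta> t * of_real x) * G \<sigma> (Complex \<theta> t)) = (CLINT t|lborel. exp (Complex (-\<theta>) t * of_real x) * G \<sigma> (Complex (-\<theta>) t))"
    if \<sigma>: "\<sigma> > 0" for \<sigma> x
  proof (rule shift_line[where K = "\<lambda>s. exp (s * of_real x) * G \<sigma> s", OF _ th \<sigma>])
    show "(\<lambda>s. exp (s * of_real x) * G \<sigma> s) holomorphic_on {s. - \<delta> < Re s \<and> Re s < \<delta>}"
      unfolding G_def by (intro holomorphic_intros hol) auto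
    fix s :: complex assume s: "\<bar>Re s\<bar> < \<delta>"
    have "(Re s)^2 \<le> \<delta>^2" using s by (metis abs_le_square_iff abs_of_pos less_eq_real_def order_le_less_trans abs_ge_zero)
    then have 1: "exp (\<sigma>^2 * (Re s)^2 / 2) \<le> exp (\<sigma>^2 * \<delta>^2 / 2)" by (simp add: mult_left_mono)
    have "\<bar>Re s * x\<bar> \<le> \<delta> * \<bar>x\<bar>" unfolding abs_mult using s by (intro mult_right_mono) auto
    then have 2: "exp (Re s * x) \<le> exp (\<delta> * \<bar>x\<bar>)" by simp
    have "cmod (exp (s * of_real x) * G \<sigma> s) = exp (Re s * x) * (exp (\<sigma>^2 * (Re s)^2 / 2) * exp (- (\<sigma>^2 * (Im s)^2 / 2)) * cmod (h s))"
      unfolding G_def norm_mult normG by simp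
    also have "\<dots> \<le> exp (\<delta> * \<bar>x\<bar>) * (exp (\<sigma>^2 * \<delta>^2 / 2) * exp (- (\<sigma>^2 * (Im s)^2 / 2)) * C)"
      using 1 2 hC[OF s] by (intro mult_mono) auto
    finally show "cmod (exp (s * of_real x) * G \<sigma> s) \<le> (exp (\<delta> * \<bar>x\<bar>) * exp (\<sigma>^2 * \<delta>^2 / 2) * C) * exp (- (\<sigma>^2 * (Im s)^2 / 2))"
      by (simp add: mult_ac)
  qed
  have iexp: "exp (Complex (-\<theta>) t * of_real x) = of_real (exp (- \<theta> * x)) * iexp (t * x)" for t x
    unfolding exp_of_real[symmetric] exp_add[symmetric] by (rule arg_cong[where f = exp]) (simp add: Complex_eq algebra_simps)
  have R_eq: "2 * pi * (exp (\<theta> * x) * \<bar>R \<sigma> x\<bar>) = cmod (CLINT t|lborel. G \<sigma> (Complex (-\<theta>) t) * iexp (t * x))" if \<sigma>: "\<sigma> > 0" for \<sigma> x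
  proof -
    have "of_real (2 * pi * R \<sigma> x) = (CLINT t|lborel. of_real (exp (- \<theta> * x)) * (G \<sigma> (Complex (-\<theta>) t) * iexp (t * x)))"
      unfolding inv[OF \<sigma>] shift[OF \<sigma>] iexp by (simp add: mult_ac)
    also have "\<dots> = of_real (exp (- \<theta> * x)) * (CLINT t|lborel. G \<sigma> (Complex (-\<theta>) t) * iexp (t * x))"
      by (rule integral_mult_right_zero)
    finally have "cmod (of_real (2 * pi * R \<sigma> x)) = cmod (of_real (exp (- \<theta> * x)) * (CLINT t|lborel. G \<sigma> (Complex (-\<theta>) t) * iexp (t * x)))"
      by (rule arg_cong)
    then have "\<bar>2 * pi * R \<sigma> x\<bar> = \<bar>exp (- \<theta> * x)\<bar> * cmod (CLINT t|lborel. G \<sigma> (Complex (-\<theta>) t) * iexp (t * x))"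
      by (simp only: norm_mult norm_of_real)
    then have "2 * pi * \<bar>R \<sigma> x\<bar> = exp (- \<theta> * x) * cmod (CLINT t|lborel. G \<sigma> (Complex (-\<theta>) t) * iexp (t * x))"
      by (simp add: abs_mult)
    then have "exp (\<theta> * x) * (2 * pi * \<bar>R \<sigma> x\<bar>) = cmod (CLINT t|lborel. G \<sigma> (Complex (-\<theta>) t) * iexp (t * x))"
      by (simp add: exp_minus field_simps)
    then show ?thesis by (simp add: mult_ac)
  qed
  \<comment> \<open>A bound for the square integral over Re s = -\<theta> that is free of \<sigma>:
    exp (\<theta>^2) is the square of exp (\<sigma>^2 \<theta>^2 / 2) at \<sigma> = 1.\<close>
  define B where "B = 2 * pi * (exp (\<theta>^2) * C^2 * (LINT t|lborel. 1 / (1 + \<bar>t\<bar>)^2))"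
  have L2: "(\<integral>\<^sup>+x. ennreal ((2 * pi * (exp (\<theta> * x) * \<bar>R \<sigma> x\<bar>))^2) \<partial>lborel) \<le> ennreal B"
    if \<sigma>: "\<sigma> > 0" "\<sigma> \<le> 1" for \<sigma>
  proof -
    let ?\<psi> = "\<lambda>t. G \<sigma> (Complex (-\<theta>) t)"
    have [measurable]: "(\<lambda>t. h (Complex (-\<theta>) t)) \<in> borel_measurable borel" using th by (intro hmeas) auto
    have m [measurable]: "?\<psi> \<in> borel_measurable borel" unfolding G_def by measurable
    have s1: "\<sigma>^2 \<le> 1" using \<sigma> by (simp add: power_le_one)
    have "exp (\<sigma>^2 * \<theta>^2 / 2) \<le> exp (\<theta>^2 / 2)" using s1 by (auto intro!: mult_left_le_one_le)
    then have nb: "cmod (?\<psi> t) \<le> exp (\<theta>^2 / 2) * exp (- (\<sigma>^2 * t^2 / 2)) * (C / (1 + \<bar>t\<bar>))" for t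
      unfolding G_def norm_mult normG using hbd[of "Complex (-\<theta>) t"] th by (intro mult_mono) auto
    have nb2: "(cmod (?\<psi> t))^2 \<le> exp (\<theta>^2) * C^2 * (1 / (1 + \<bar>t\<bar>)^2)" for t
    proof -
      have "cmod (?\<psi> t) \<le> exp (\<theta>^2 / 2) * 1 * (C / (1 + \<bar>t\<bar>))"
        using C by (intro order_trans[OF nb] mult_right_mono mult_left_mono) auto
      then have "(cmod (?\<psi> t))^2 \<le> (exp (\<theta>^2 / 2) * 1 * (C / (1 + \<bar>t\<bar>)))^2" by (intro power_mono) auto
      also have "\<dots> = exp (\<theta>^2) * C^2 * (1 / (1 + \<bar>t\<bar>)^2)"
        by (simp add: power_mult_distrib power_divide exp_double[symmetric])
      finally show ?thesis .
    qed
    have i1: "integrable lborel ?\<psi>"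
    proof (rule Bochner_Integration.integrable_bound)
      show "integrable lborel (\<lambda>t. exp (\<theta>^2 / 2) * C * exp (- (\<sigma>^2 * t^2 / 2)))"
        by (intro integrable_mult_right integrable_gauss \<sigma>)
      have "cmod (?\<psi> t) \<le> exp (\<theta>^2 / 2) * exp (- (\<sigma>^2 * t^2 / 2)) * C" for t
      proof -
        have "C / (1 + \<bar>t\<bar>) \<le> C / 1" using C by (intro divide_left_mono) auto
        then show ?thesis using nb[of t] mult_left_mono[of "C / (1 + \<bar>t\<bar>)" C "exp (\<theta>^2 / 2) * exp (- (\<sigma>^2 * t^2 / 2))"] by auto
      qed
      then show "AE t in lborel. norm (?\<psi> t) \<le> norm (exp (\<theta>^2 / 2) * C * exp (- (\<sigma>^2 * t^2 / 2)))"
        using C by (simp add: mult_ac abs_mult)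
    qed simp
    have i2: "integrable lborel (\<lambda>t. (cmod (?\<psi> t))^2)"
      using nb2 by (intro Bochner_Integration.integrable_bound[OF integrable_mult_right[OF integrable_inverse_abs_sq, of "exp (\<theta>^2) * C^2"]])
        (auto simp: abs_mult)
    have "(\<integral>\<^sup>+x. ennreal ((2 * pi * (exp (\<theta> * x) * \<bar>R \<sigma> x\<bar>))^2) \<partial>lborel) \<le> ennreal (2 * pi * (LINT t|lborel. (cmod (?\<psi> t))^2))"
      unfolding R_eq[OF \<sigma>(1)] by (rule bessel[OF i1 i2])
    also have "\<dots> \<le> ennreal B"
      unfolding B_def integral_mult_right_zero[symmetric]
      by (intro ennreal_leI mult_left_mono integral_mono i2 integrable_mult_right integrable_inverse_abs_sq nb2) auto
    finally show ?thesis .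
  qed
  \<comment> \<open>Fatou along this sequence: the averages R tend to q at every continuity point,
    hence almost everywhere.\<close>
  define \<sigma> :: "nat \<Rightarrow> real" where "\<sigma> n = inverse (real (Suc n))" for n
  have \<sigma>: "\<And>n. 0 < \<sigma> n" "\<And>n. \<sigma> n \<le> 1" "\<sigma> \<longlonglongrightarrow> 0"
    using LIMSEQ_inverse_real_of_nat by (auto simp: \<sigma>_def[abs_def] field_simps)
  have Rm [measurable]: "R s \<in> borel_measurable borel" for s unfolding R_def by measurable
  have "(\<integral>\<^sup>+x. ennreal ((2 * pi * (exp (\<theta> * x) * \<bar>q x\<bar>))^2) \<partial>lborel)
    = (\<integral>\<^sup>+x. liminf (\<lambda>n. ennreal ((2 * pi * (exp (\<theta> * x) * \<bar>R (\<sigma> n) x\<bar>))^2)) \<partial>lborel)"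
  proof (rule nn_integral_cong_AE)
    show "AE x in lborel. ennreal ((2 * pi * (exp (\<theta> * x) * \<bar>q x\<bar>))^2) = liminf (\<lambda>n. ennreal ((2 * pi * (exp (\<theta> * x) * \<bar>R (\<sigma> n) x\<bar>))^2))"
      using cont
    proof eventually_elim
      case (elim x)
      have "(\<lambda>n. R (\<sigma> n) x) \<longlonglongrightarrow> q x"
        unfolding R_def by (rule gauss_smooth_tendsto[OF _ qbd elim \<sigma>]) simp
      then have "(\<lambda>n. ennreal ((2 * pi * (exp (\<theta> * x) * \<bar>R (\<sigma> n) x\<bar>))^2)) \<longlonglongrightarrow> ennreal ((2 * pi * (exp (\<theta> * x) * \<bar>q x\<bar>))^2)"
        by (intro tendsto_intros)
      then show ?case by (rule lim_imp_Liminf[OF trivial_limit_sequentially, symmetric])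
    qed
  qed
  also have "\<dots> \<le> liminf (\<lambda>n. \<integral>\<^sup>+x. ennreal ((2 * pi * (exp (\<theta> * x) * \<bar>R (\<sigma> n) x\<bar>))^2) \<partial>lborel)"
    by (rule nn_integral_liminf) measurable
  also have "\<dots> \<le> liminf (\<lambda>n. ennreal B)"
    by (intro Liminf_mono always_eventually allI L2 \<sigma>)
  also have "\<dots> < \<infinity>" by (simp add: Liminf_const)
  finally have fin: "(\<integral>\<^sup>+x. ennreal ((2 * pi * (exp (\<theta> * x) * \<bar>q x\<bar>))^2) \<partial>lborel) < \<infinity>" .
  have "(\<integral>\<^sup>+x. ennreal ((exp (\<theta> * x) * q x)^2) \<partial>lborel) \<le> (\<integral>\<^sup>+x. ennreal ((2 * pi * (exp (\<theta> * x) * \<bar>q x\<bar>))^2) \<partial>lborel)"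
  proof (intro nn_integral_mono ennreal_leI)
    fix x
    have "1 \<le> (2 * pi)^2" using pi_ge_two by (intro one_le_power) auto
    then have "1 * (exp (\<theta> * x) * q x)^2 \<le> (2 * pi)^2 * (exp (\<theta> * x) * q x)^2" by (intro mult_right_mono) auto
    then show "(exp (\<theta> * x) * q x)^2 \<le> (2 * pi * (exp (\<theta> * x) * \<bar>q x\<bar>))^2" by (simp add: power_mult_distrib)
  qed
  then show ?thesis using fin by (rule le_less_trans)
qed

section \<open>The regularly varying tail\<close>

text \<open>The change of variables theorem speaks about the completed measure; the measurability
  hypothesis \<open>fm\<close> brings the value back to \<open>lborel\<close>.\<close>

lemma exp_substitution:
  fixes f :: "real \<Rightarrow> real"
  assumes S [measurable]: "S \<in> sets borel" and eS [measurable]: "exp ` S \<in> sets borel"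
    and fm: "(\<lambda>r. indicator (exp ` S) r * f r) \<in> borel_measurable borel"
    and int: "set_integrable lborel S (\<lambda>y. exp y * f (exp y))"
  shows "(LINT r:exp ` S|lborel. f r) = (LINT y:S|lborel. exp y * f (exp y))"
proof -
  have ai: "(\<lambda>y. \<bar>exp y\<bar> * f (exp y)) absolutely_integrable_on S"
    using int unfolding set_integrable_def by (simp add: integrable_completion)
  have "f absolutely_integrable_on exp ` S \<and> integral (exp ` S) f = integral S (\<lambda>y. \<bar>exp y\<bar> * f (exp y))"
    using ai by (subst has_absolute_integral_change_of_variables_1'[symmetric]) (auto intro!: derivative_eq_intros simp: inj_on_def)
  then have 1: "f absolutely_integrable_on exp ` S" "integral (exp ` S) f = integral S (\<lambda>y. exp y * f (exp y))" by auto
  have 2: "(LINT r:exp ` S|lborel. f r) = (LINT r:exp ` S|lebesgue. f r)"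
    unfolding set_lebesgue_integral_def using fm by (simp add: integral_completion)
  show ?thesis
    unfolding 2 set_lebesgue_integral_eq_integral(2)[OF 1(1)] 1(2)
    by (simp add: set_borel_integral_eq_integral(2)[OF int])
qed

lemma exp_tail_integral_real:
  assumes "(a::real) > 0"
  shows "set_integrable lborel {z<..} (\<lambda>u. exp (- a * u))"
    "(LINT u:{z<..}|lborel. exp (- a * u)) = exp (- a * z) / a"
proof -
  have d: "((\<lambda>u. - exp (- a * u) / a) has_real_derivative exp (- a * x)) (at x)" for x
    using assms by (auto intro!: derivative_eq_intros)
  have A: "(((\<lambda>u. - exp (- a * u) / a) \<circ> real_of_ereal) \<longlongrightarrow> - exp (- a * z) / a) (at_right (ereal z))"
    unfolding ereal_tendsto_simps using assms by (auto intro!: tendsto_eq_intros)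
  have "((\<lambda>u. - exp (- a * u) / a) \<longlongrightarrow> - 0 / a) at_top"
    using assms by (intro tendsto_intros filterlim_compose[OF exp_at_bot])
      (auto simp: filterlim_uminus_at_bot intro!: filterlim_tendsto_pos_mult_at_top[OF tendsto_const _ filterlim_ident])
  then have B: "(((\<lambda>u. - exp (- a * u) / a) \<circ> real_of_ereal) \<longlongrightarrow> 0) (at_left \<infinity>)"
    unfolding ereal_tendsto_simps by simp
  note * = interval_integral_FTC_nonneg[of "ereal z" \<infinity>, OF _ d _ _ A B]
  show "set_integrable lborel {z<..} (\<lambda>u. exp (- a * u))" using *(1) by simp
  show "(LINT u:{z<..}|lborel. exp (- a * u)) = exp (- a * z) / a"
    using *(2) by (simp add: interval_lebesgue_integral_def)
qed

lemma exp_left_tail: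
  assumes a: "(a::real) > 0"
  shows "set_integrable lborel {..<x} (\<lambda>y. exp (a * y))" "(LINT y:{..<x}|lborel. exp (a * y)) = exp (a * x) / a"
proof -
  have d: "((\<lambda>u. exp (a * u) / a) has_real_derivative exp (a * x)) (at x)" for x
    using assms by (auto intro!: derivative_eq_intros)
  have B: "(((\<lambda>u. exp (a * u) / a) \<circ> real_of_ereal) \<longlongrightarrow> exp (a * x) / a) (at_left (ereal x))"
    unfolding ereal_tendsto_simps using assms by (auto intro!: tendsto_eq_intros)
  have "((\<lambda>u. exp (a * u) / a) \<longlongrightarrow> 0) at_bot" using a by real_asymp
  then have A: "(((\<lambda>u. exp (a * u) / a) \<circ> real_of_ereal) \<longlongrightarrow> 0) (at_right (-\<infinity>))"
    unfolding ereal_tendsto_simps by simp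
  note * = interval_integral_FTC_nonneg[of "-\<infinity>" "ereal x", OF _ d _ _ A B]
  show "set_integrable lborel {..<x} (\<lambda>y. exp (a * y))" using *(1) by simp
  show "(LINT y:{..<x}|lborel. exp (a * y)) = exp (a * x) / a"
    using *(2) by (simp add: interval_lebesgue_integral_def)
qed

locale regvar_tail = prob_space M for M :: "'a measure" +
  fixes B :: "'a \<Rightarrow> real" and L :: "real \<Rightarrow> real" and \<alpha> :: real
  assumes \<alpha>: "0 < \<alpha>" and B_meas [measurable]: "B \<in> borel_measurable M" and sv: "slowly_varying L"
    and tail: "\<And>x. 0 < x \<Longrightarrow> measure M {\<omega> \<in> space M. x < B \<omega>} = x powr (- \<alpha>) * L x"
begin

text \<open>On the logarithmic scale y = ln x slow variation becomes a statement about translations.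
  \<open>l\<close> is L composed with exp (\<open>l_eq\<close>), but defined through the tail:
  monotonicity of \<open>P\<close> gives Borel measurability on the whole line and the growth bound
  \<open>l_step\<close>.\<close>

definition P :: "real \<Rightarrow> real" where "P y = prob {\<omega> \<in> space M. exp y < B \<omega>}"
definition l :: "real \<Rightarrow> real" where "l y = exp (\<alpha> * y) * P y"

lemma l_eq: "l y = L (exp y)"
  unfolding l_def P_def by (subst tail) (auto simp: powr_def exp_minus field_simps)

lemma l_pos: "0 < l y"
  using sv unfolding l_eq slowly_varying_def by simp

lemma P_antimono: "y \<le> z \<Longrightarrow> P z \<le> P y"
  unfolding P_def by (intro finite_measure_mono) (auto intro: le_less_trans)

lemma P_meas [measurable]: "P \<in> borel_measurable borel"
proof -
  have "(\<lambda>y. - P y) \<in> borel_measurable borel"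
    by (rule borel_measurable_mono) (auto simp: mono_def intro: P_antimono)
  then show ?thesis by simp
qed

lemma l_meas [measurable]: "l \<in> borel_measurable borel"
  unfolding l_def by measurable

lemma P_le_1: "P y \<le> 1" by (simp add: P_def)

lemma l_le: "l y \<le> exp (\<alpha> * y)"
  unfolding l_def using P_le_1[of y] by (simp add: mult_left_le)

text \<open>The tail is nonincreasing, so only the factor e^{\<alpha>y} can make \<open>l\<close>
  grow. This one-sided regularity lets limits along integer shifts suffice where one would otherwise
  invoke the uniform convergence theorem.\<close>

lemma l_step: assumes "0 \<le> u" shows "l (y + u) \<le> exp (\<alpha> * u) * l y"
  unfolding l_def using P_antimono[of y "y + u"] assms
  by (simp add: exp_add algebra_simps mult_left_mono)

lemma l_ratio: "((\<lambda>y. l (y + a) / l y) \<longlongrightarrow> 1) at_top"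
proof -
  have "((\<lambda>x. L (exp a * x) / L x) \<longlongrightarrow> 1) at_top" using sv by (simp add: slowly_varying_def)
  then have "((\<lambda>y. L (exp a * exp y) / L (exp y)) \<longlongrightarrow> 1) at_top"
    by (rule filterlim_compose) (rule exp_at_top)
  then show ?thesis by (simp add: l_eq exp_add mult.commute)
qed

text \<open>Far out, a unit step changes \<open>l\<close> by at most a factor e^{\<eta>} either way;
  iteration covers integer distances and \<open>l_step\<close> the fractional remainder. If x + z
  falls below y0 the step bound says nothing, but there \<open>l\<close> is at most e^{\<alpha> y0},
  while l x is still at least a constant times e^{-\<eta>|z|}.\<close>

lemma potter:
  assumes \<eta>: "\<eta> > 0"
  shows "\<exists>K y0. 0 < K \<and> (\<forall>x\<ge>y0. \<forall>z. l (x + z) \<le> K * l x * exp (\<eta> * \<bar>z\<bar>))"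
proof -
  have "eventually (\<lambda>y. l (y + 1) / l y < exp \<eta> \<and> exp (- \<eta>) < l (y + 1) / l y) at_top"
    using order_tendstoD[OF l_ratio[of 1]] \<eta> by (intro eventually_conj) auto
  then obtain y0 where y0: "\<And>y. y \<ge> y0 \<Longrightarrow> l (y + 1) / l y < exp \<eta> \<and> exp (- \<eta>) < l (y + 1) / l y"
    by (auto simp: eventually_at_top_linorder)
  have up: "l (y + 1) \<le> exp \<eta> * l y" if "y \<ge> y0" for y
    using y0[OF that] l_pos[of y] by (simp add: field_simps)
  have dn: "l y \<le> exp \<eta> * l (y + 1)" if "y \<ge> y0" for y
    using y0[OF that] l_pos[of y] by (simp add: field_simps exp_minus)
  have upn: "l (y + real n) \<le> exp (\<eta> * n) * l y" if "y \<ge> y0" for y n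
  proof (induction n)
    case (Suc n)
    have "l (y + real (Suc n)) \<le> exp \<eta> * l (y + real n)" using up[of "y + real n"] that by (simp add: add_ac)
    also have "\<dots> \<le> exp \<eta> * (exp (\<eta> * n) * l y)" using Suc by simp
    also have "\<dots> = exp (\<eta> * Suc n) * l y" by (simp add: exp_add algebra_simps)
    finally show ?case .
  qed simp
  have dnn: "l y \<le> exp (\<eta> * n) * l (y + real n)" if "y \<ge> y0" for y n
  proof (induction n)
    case (Suc n)
    note Suc
    also have "exp (\<eta> * n) * l (y + real n) \<le> exp (\<eta> * n) * (exp \<eta> * l (y + real (Suc n)))"
      using dn[of "y + real n"] that by (intro mult_left_mono) (auto simp: add_ac)
    also have "\<dots> = exp (\<eta> * Suc n) * l (y + real (Suc n))" by (simp add: exp_add algebra_simps)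
    finally show ?case .
  qed simp
  define K0 where "K0 = exp (\<eta> + \<alpha>)"
  have A: "l (x + z) \<le> K0 * l x * exp (\<eta> * \<bar>z\<bar>)" if x: "x \<ge> y0" and z: "z \<ge> 0" for x z
  proof -
    define n where "n = nat \<lfloor>z\<rfloor>"
    have n: "real n \<le> z" "z - real n \<le> 1" using z by (auto simp: n_def) linarith
    have "l (x + z) = l ((x + real n) + (z - real n))" by simp
    also have "\<dots> \<le> exp (\<alpha> * (z - real n)) * l (x + real n)" using n by (intro l_step) auto
    also have "\<dots> \<le> exp (\<alpha> * 1) * (exp (\<eta> * n) * l x)"
      using n \<alpha> upn[OF x, of n] l_pos[of "x + real n"] by (intro mult_mono) (auto intro: less_imp_le)
    also have "\<dots> \<le> exp (\<alpha> * 1) * (exp (\<eta> * z) * l x)"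
      using n \<eta> l_pos[of x] by (intro mult_left_mono mult_right_mono) (auto intro: less_imp_le)
    also have "\<dots> \<le> K0 * (exp (\<eta> * z) * l x)"
      using \<eta> l_pos[of x] by (intro mult_right_mono) (auto simp: K0_def intro: less_imp_le)
    finally show ?thesis using z by (simp add: mult_ac)
  qed
  have Bd: "l (x - z) \<le> K0 * l x * exp (\<eta> * z)" if x: "x - z \<ge> y0" and z: "z \<ge> 0" for x z
  proof -
    \<comment> \<open>Here n rounds up: \<open>l_step\<close> only bounds values to the right, so
      the walk starting at x - z must end at or beyond x.\<close>
    define n where "n = Suc (nat \<lfloor>z\<rfloor>)"
    have n: "z \<le> real n" "real n - z \<le> 1" using z by (auto simp: n_def) linarith
    have "l (x - z) \<le> exp (\<eta> * n) * l (x - z + real n)" by (rule dnn[OF x])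
    also have "\<dots> = exp (\<eta> * n) * l (x + (real n - z))" by (simp add: algebra_simps)
    also have "\<dots> \<le> exp (\<eta> * n) * (exp (\<alpha> * (real n - z)) * l x)"
      using n by (intro mult_left_mono l_step) auto
    also have "\<dots> \<le> exp (\<eta> * (1 + z)) * (exp (\<alpha> * 1) * l x)"
      using n \<eta> \<alpha> l_pos[of x] by (intro mult_mono mult_right_mono) (auto intro: less_imp_le)
    also have "\<dots> = K0 * l x * exp (\<eta> * z)" by (simp add: K0_def exp_add algebra_simps)
    finally show ?thesis .
  qed
  \<comment> \<open>The second entry covers x + z < y0: e^{\<alpha> y0} bounds l (x + z), and K0 / l
    y0 comes from comparing y0 with x.\<close>
  define K where "K = max K0 (exp (\<alpha> * y0) * K0 / l y0)"
  have K0: "K0 > 0" by (simp add: K0_def)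
  have K: "K > 0" "K0 \<le> K" "exp (\<alpha> * y0) * K0 / l y0 \<le> K" using K0 by (auto simp: K_def)
  have fromK0: "l (x + z) \<le> K * l x * exp (\<eta> * \<bar>z\<bar>)" if "l (x + z) \<le> K0 * l x * exp (\<eta> * \<bar>z\<bar>)" for x z
    by (rule order_trans[OF that]) (use K l_pos[of x] in \<open>auto intro!: mult_right_mono less_imp_le\<close>)
  have "l (x + z) \<le> K * l x * exp (\<eta> * \<bar>z\<bar>)" if x: "x \<ge> y0" for x z
  proof (cases "z \<ge> 0")
    case True then show ?thesis using A x fromK0 by blast
  next
    case False
    show ?thesis
    proof (cases "x + z \<ge> y0")
      case True then show ?thesis using Bd[of x "- z"] False by (intro fromK0) auto
    next
      case nge: False
      have "l y0 \<le> K0 * l x * exp (\<eta> * (x - y0))" using Bd[of x "x - y0"] x by simp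
      also have "\<dots> \<le> K0 * l x * exp (\<eta> * \<bar>z\<bar>)"
      proof -
        have "\<eta> * (x - y0) \<le> \<eta> * \<bar>z\<bar>" using nge x \<eta> by (intro mult_left_mono) auto
        then show ?thesis using K0 l_pos[of x] by (intro mult_left_mono) auto
      qed
      finally have 1: "1 \<le> K0 * l x * exp (\<eta> * \<bar>z\<bar>) / l y0" using l_pos[of y0] by (simp add: field_simps)
      have "l (x + z) \<le> exp (\<alpha> * (x + z))" by (rule l_le)
      also have "\<dots> \<le> exp (\<alpha> * y0)" using nge \<alpha> by (auto intro: mult_left_mono)
      also have "\<dots> \<le> exp (\<alpha> * y0) * (K0 * l x * exp (\<eta> * \<bar>z\<bar>) / l y0)"
        using 1 mult_left_mono[OF 1, of "exp (\<alpha> * y0)"] by simp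
      also have "\<dots> = (exp (\<alpha> * y0) * K0 / l y0) * (l x * exp (\<eta> * \<bar>z\<bar>))" by simp
      also have "\<dots> \<le> K * (l x * exp (\<eta> * \<bar>z\<bar>))" using K l_pos[of x] by (intro mult_right_mono) (auto intro: less_imp_le)
      finally show ?thesis by (simp add: mult_ac)
    qed
  qed
  then show ?thesis using K(1) by blast
qed

definition \<Lambda> :: "real \<Rightarrow> real" where "\<Lambda> x = (LINT y:{..<x}|lborel. l y)"

lemma l_integrable: "set_integrable lborel {..<x} l"
  unfolding set_integrable_def
  by (rule Bochner_Integration.integrable_bound[OF exp_left_tail(1)[OF \<alpha>, of x, unfolded set_integrable_def]])
     (use l_le l_pos in \<open>auto simp: indicator_def abs_of_pos\<close>)

text \<open>The substitution t = e^y turns L t / t dt into l y dy; the end point y = x is a null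
  set.\<close>

lemma \<Lambda>_eq: "L_tilde L (exp x) = \<Lambda> x"
proof -
  have e: "exp ` {..x} = {0<..exp x}"
  proof safe
    fix r assume r: "r \<in> {0<..exp x}"
    then have "ln r \<le> ln (exp x)" by (intro ln_mono) auto
    then show "r \<in> exp ` {..x}" using r by (intro image_eqI[of _ _ "ln r"]) auto
  qed auto
  have lm: "(\<lambda>r. l (ln r)) \<in> borel_measurable borel" by measurable
  have AE: "AE y in lborel. indicator {..x} y *\<^sub>R l y = indicator {..<x} y *\<^sub>R l y"
    using AE_lborel_singleton[of x] by eventually_elim (auto simp: indicator_def)
  have int: "set_integrable lborel {..x} l"
    using l_integrable[of x] unfolding set_integrable_def by (subst integrable_cong_AE[OF _ _ AE]) auto
  have "L_tilde L (exp x) = (LINT r:exp ` {..x}|lborel. L r / r)"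
    by (simp add: L_tilde_def e)
  also have "\<dots> = (LINT y:{..x}|lborel. exp y * (L (exp y) / exp y))"
  proof (rule exp_substitution)
    show "set_integrable lborel {..x} (\<lambda>y. exp y * (L (exp y) / exp y))" using int by (simp add: l_eq[symmetric])
    have "(\<lambda>r. indicator (exp ` {..x}) r * (L r / r)) = (\<lambda>r. indicator {0<..exp x} r * (l (ln r) / r))"
      unfolding e by (auto simp: indicator_def l_eq fun_eq_iff)
    also have "\<dots> \<in> borel_measurable borel" using lm by measurable
    finally show "(\<lambda>r. indicator (exp ` {..x}) r * (L r / r)) \<in> borel_measurable borel" .
  qed (auto simp: e)
  also have "\<dots> = (LINT y:{..x}|lborel. l y)"
    by (simp add: l_eq)
  also have "\<dots> = \<Lambda> x"
    unfolding \<Lambda>_def set_lebesgue_integral_def by (rule integral_cong_AE[OF _ _ AE]) measurable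
  finally show ?thesis .
qed

text \<open>On a window of length A to the left of x slow variation keeps \<open>l\<close> above a
  fixed fraction of l x, so \<Lambda> x is at least a constant times A l x, with A at will. Ratios
  are controlled only at finitely many integer shifts, and \<open>l_step\<close>
  interpolates.\<close>

lemma l_little_o:
  assumes \<epsilon>: "\<epsilon> > 0"
  shows "eventually (\<lambda>x. l x \<le> \<epsilon> * \<Lambda> x) at_top"
proof -
  \<comment> \<open>This makes A e^{-\<alpha>} / 2 \<ge> 1 / \<epsilon>, where 1/2 bounds the ratios
    at integer shifts and e^{-\<alpha>} is the loss within a unit interval.\<close>
  define A where "A = Suc (nat \<lceil>2 * exp \<alpha> / \<epsilon>\<rceil>)"
  have A: "real A > 0" "2 * exp \<alpha> / \<epsilon> \<le> real A" by (auto simp: A_def) linarith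
  have "eventually (\<lambda>x. 1/2 < l (x + a) / l x) at_top" for a
    by (rule order_tendstoD(1)[OF l_ratio]) simp
  then have "eventually (\<lambda>x. \<forall>j\<in>{..A}. 1/2 < l (x + (- real j)) / l x) at_top"
    by (intro eventually_ball_finite) blast+
  then show ?thesis
  proof eventually_elim
    case (elim x)
    have low: "exp (- \<alpha>) * l x / 2 \<le> l y" if y: "x - real A \<le> y" "y < x" for y
    proof -
      define j where "j = nat \<lfloor>x - y\<rfloor>"
      have j: "real j \<le> x - y" "x - y \<le> real j + 1" using y by (auto simp: j_def)
      have jA: "j \<le> A" using j y by linarith
      have "l x / 2 \<le> l (x - real j)" using bspec[OF elim, of j] jA l_pos[of x] by (simp add: field_simps)
      also have "\<dots> = l (y + (x - real j - y))" by simp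
      also have "\<dots> \<le> exp (\<alpha> * (x - real j - y)) * l y" using j by (intro l_step) auto
      also have "\<dots> \<le> exp (\<alpha> * 1) * l y" using j \<alpha> l_pos[of y] by (intro mult_right_mono) (auto intro: less_imp_le)
      finally show ?thesis by (simp add: exp_minus field_simps)
    qed
    have "real A * (exp (- \<alpha>) * l x / 2) = (LINT y:{x - real A..<x}|lborel. exp (- \<alpha>) * l x / 2)"
      by (simp add: set_lebesgue_integral_def)
    also have "\<dots> \<le> \<Lambda> x"
      unfolding \<Lambda>_def set_lebesgue_integral_def
    proof (rule integral_mono)
      show "integrable lborel (\<lambda>y. indicat_real {x - real A..<x} y *\<^sub>R (exp (- \<alpha>) * l x / 2))"
        by (intro integrable_scaleR_left integrable_real_indicator) auto
      show "integrable lborel (\<lambda>y. indicat_real {..<x} y *\<^sub>R l y)"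
        using l_integrable[of x] by (simp add: set_integrable_def)
    qed (use low l_pos in \<open>auto simp: indicator_def less_imp_le\<close>)
    finally have 1: "real A * (exp (- \<alpha>) * l x / 2) \<le> \<Lambda> x" .
    have "l x \<le> \<epsilon> * (real A * (exp (- \<alpha>) * l x / 2))"
    proof -
      have "2 * exp \<alpha> \<le> \<epsilon> * real A" using A(2) \<epsilon> by (simp add: field_simps)
      then have "l x * (2 * exp \<alpha>) \<le> l x * (\<epsilon> * real A)" using l_pos[of x] by (intro mult_left_mono) auto
      then show ?thesis by (simp add: exp_minus field_simps)
    qed
    also have "\<dots> \<le> \<epsilon> * \<Lambda> x" using 1 \<epsilon> by (intro mult_left_mono) auto
    finally show ?case .
  qed
qed

text \<open>With f = g and y = x - z this is the integrand of the renewal integral; with f =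
  \<kappa> it is the function K of the overview.\<close>

definition Gk :: "(real \<Rightarrow> real) \<Rightarrow> real \<Rightarrow> real" where
  "Gk f y = exp (\<alpha> * y) * expectation (\<lambda>\<omega>. f (exp (- y) * B \<omega>))"

text \<open>f (e^{-y} B) can be nonzero only on the event B > e^y, whose probability is
  \<open>P y\<close>.\<close>

lemma Gk_bound:
  assumes [measurable]: "f \<in> borel_measurable borel" and K: "\<And>r. \<bar>f r\<bar> \<le> K" and z: "\<And>r. r \<le> 1 \<Longrightarrow> f r = 0"
  shows "integrable M (\<lambda>\<omega>. f (exp (- y) * B \<omega>))"
    and "expectation (\<lambda>\<omega>. \<bar>f (exp (- y) * B \<omega>)\<bar>) \<le> K * P y"
    and "\<bar>Gk f y\<bar> \<le> K * l y"
proof -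
  show i: "integrable M (\<lambda>\<omega>. f (exp (- y) * B \<omega>))"
    by (rule integrable_const_bound[of _ K]) (use K in auto)
  have K0: "0 \<le> K" using K[of 0] by simp
  have "expectation (\<lambda>\<omega>. \<bar>f (exp (- y) * B \<omega>)\<bar>) \<le> expectation (\<lambda>\<omega>. K * indicator {\<omega> \<in> space M. exp y < B \<omega>} \<omega>)"
  proof (rule integral_mono)
    show "integrable M (\<lambda>\<omega>. K * indicat_real {\<omega> \<in> space M. exp y < B \<omega>} \<omega>)"
      by (intro integrable_mult_right integrable_real_indicator) (auto simp: less_top[symmetric])
    fix \<omega> assume w: "\<omega> \<in> space M"
    show "\<bar>f (exp (- y) * B \<omega>)\<bar> \<le> K * indicator {\<omega> \<in> space M. exp y < B \<omega>} \<omega>"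
    proof (cases "exp y < B \<omega>")
      case True then show ?thesis using K w by simp
    next
      case False
      then have "exp (- y) * B \<omega> \<le> exp (- y) * exp y" by (intro mult_left_mono) auto
      then show ?thesis using z[of "exp (- y) * B \<omega>"] K0 by (simp add: exp_minus)
    qed
  qed (use i in auto)
  also have "\<dots> = K * P y" by (simp add: P_def)
  finally show E: "expectation (\<lambda>\<omega>. \<bar>f (exp (- y) * B \<omega>)\<bar>) \<le> K * P y" .
  have "\<bar>expectation (\<lambda>\<omega>. f (exp (- y) * B \<omega>))\<bar> \<le> K * P y"
    by (rule order_trans[OF integral_abs_bound E])
  then have "exp (\<alpha> * y) * \<bar>expectation (\<lambda>\<omega>. f (exp (- y) * B \<omega>))\<bar> \<le> exp (\<alpha> * y) * (K * P y)"
    by (intro mult_left_mono) auto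
  then show "\<bar>Gk f y\<bar> \<le> K * l y" by (simp add: Gk_def l_def abs_mult mult_ac)
qed

lemma Gk_meas [measurable]:
  assumes [measurable]: "f \<in> borel_measurable borel"
  shows "Gk f \<in> borel_measurable borel"
  unfolding Gk_def by measurable

end

section \<open>The test function\<close>

definition \<kappa>_of :: "real \<Rightarrow> (real \<Rightarrow> real) \<Rightarrow> real \<Rightarrow> real" where
  "\<kappa>_of \<alpha> g r = (1 + \<alpha>) * g r - r * deriv g r"

locale admissible_fun =
  fixes \<alpha> c :: real and g :: "real \<Rightarrow> real"
  assumes \<alpha>: "0 < \<alpha>" and adm: "admissible \<alpha> c g"
begin

definition sg :: real where "sg = (SUP r. \<bar>g r\<bar>)"

lemma g_le: "\<bar>g r\<bar> \<le> sg"
proof -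
  have "bounded (range g)" using adm by (simp add: admissible_def)
  then obtain C where "\<And>r. \<bar>g r\<bar> \<le> C" by (auto simp: bounded_iff)
  then have "bdd_above (range (\<lambda>r. \<bar>g r\<bar>))" by (auto intro!: bdd_aboveI2)
  then show ?thesis unfolding sg_def by (rule cSUP_upper[OF UNIV_I])
qed

lemma sg_nonneg: "0 \<le> sg" using g_le[of 0] by linarith

lemma g_deriv: "(g has_real_derivative deriv g r) (at r)"
  and deriv_cont: "continuous_on UNIV (deriv g)"
proof -
  obtain D where D: "\<And>x. (g has_vector_derivative D x) (at x)" "continuous_on UNIV D"
    using adm by (auto simp: admissible_def C1_differentiable_on_def)
  have "(g has_real_derivative D x) (at x)" for x
    using D(1) by (simp add: has_real_derivative_iff_has_vector_derivative)
  moreover from this have "deriv g = D" by (intro ext DERIV_imp_deriv)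
  ultimately show "(g has_real_derivative deriv g r) (at r)" "continuous_on UNIV (deriv g)" using D by auto
qed

lemma g_cont: "continuous_on UNIV g"
  using g_deriv DERIV_continuous_on by blast

lemma g_meas [measurable]: "g \<in> borel_measurable borel" "deriv g \<in> borel_measurable borel"
  using g_cont deriv_cont by (auto intro: borel_measurable_continuous_onI)

lemma g_zero_less: "r < 1 \<Longrightarrow> g r = 0"
  using adm closure_subset[of "{r. g r \<noteq> 0}"] by (force simp: admissible_def)

text \<open>The support condition alone leaves r = 1 open; continuity closes it. The boundary value
  matters because the tail event is the strict inequality B > e^y.\<close>

lemma g_zero: "r \<le> 1 \<Longrightarrow> g r = 0" and deriv_zero: "r \<le> 1 \<Longrightarrow> deriv g r = 0"
proof -
  have ev: "eventually (\<lambda>r::real. r < 1) (at_left 1)" by (simp add: eventually_at_filter)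
  have cl: "f 1 = 0" if "continuous_on UNIV f" "\<And>r. r < 1 \<Longrightarrow> f r = 0" for f :: "real \<Rightarrow> real"
  proof -
    have "(f \<longlongrightarrow> f 1) (at_left 1)"
      using that(1) by (simp add: continuous_on_def filterlim_at_split)
    moreover have "(f \<longlongrightarrow> 0) (at_left 1)"
      using ev that(2) by (intro tendsto_eventually) (auto elim: eventually_mono)
    ultimately show ?thesis by (intro tendsto_unique) auto
  qed
  show "g r = 0" if "r \<le> 1" for r using that cl[OF g_cont g_zero_less] g_zero_less[of r] by (cases "r = 1") auto
  have d: "deriv g r = 0" if "r < 1" for r
  proof -
    have "(g has_real_derivative 0) (at r)"
      by (rule has_field_derivative_transform_within_open[of "\<lambda>_. 0" _ _ "{..<1}"])
         (use that g_zero_less in auto)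
    then show ?thesis by (rule DERIV_imp_deriv)
  qed
  show "deriv g r = 0" if "r \<le> 1" for r using that cl[OF deriv_cont d] d[of r] by (cases "r = 1") auto
qed

abbreviation \<kappa> where "\<kappa> \<equiv> \<kappa>_of \<alpha> g"

lemma \<kappa>_meas [measurable]: "\<kappa> \<in> borel_measurable borel"
  unfolding \<kappa>_of_def by measurable

lemma \<kappa>_zero: "r \<le> 1 \<Longrightarrow> \<kappa> r = 0"
  by (simp add: \<kappa>_of_def g_zero deriv_zero)

lemma D_exp: "((\<lambda>t. exp (a * t) * g (exp (- t) * b)) has_real_derivative
    a * exp (a * t) * g (exp (- t) * b) - exp (a * t) * (exp (- t) * b * deriv g (exp (- t) * b))) (at t)"
  by (auto intro!: derivative_eq_intros DERIV_chain2[OF g_deriv] simp: algebra_simps)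

lemma adm_deriv: "t > 0 \<Longrightarrow> \<bar>deriv (\<lambda>t. exp (- \<alpha> * t) * g (exp t)) t\<bar> \<le> c * exp (- \<alpha> * t)"
  using adm unfolding admissible_def by blast

lemma c_nonneg: "0 \<le> c"
proof -
  have "\<bar>deriv (\<lambda>t. exp (- \<alpha> * t) * g (exp t)) 1\<bar> \<le> c * exp (- \<alpha> * 1)"
    by (rule adm_deriv) simp
  then have "0 \<le> c * exp (- \<alpha> * 1)" by linarith
  then show ?thesis by (simp add: zero_le_mult_iff not_le)
qed

text \<open>With r = e^t the derivative in the hypothesis is e^{-\<alpha>t} (r g' r - \<alpha> g r),
  so |r g' r - \<alpha> g r| \<le> c for r > 1; and \<kappa> r is g r minus that quantity.\<close>

lemma \<kappa>_le: "\<bar>\<kappa> r\<bar> \<le> sg + c"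
proof (cases "r \<le> 1")
  case True then show ?thesis using sg_nonneg c_nonneg by (simp add: \<kappa>_zero)
next
  case False
  define t where "t = ln r"
  have t: "t > 0" "exp t = r" using False by (auto simp: t_def)
  have "((\<lambda>t. exp (- \<alpha> * t) * g (exp t)) has_real_derivative
     - \<alpha> * exp (- \<alpha> * t) * g (exp t) + exp (- \<alpha> * t) * (exp t * deriv g (exp t))) (at t)"
    by (auto intro!: derivative_eq_intros DERIV_chain2[OF g_deriv] simp: algebra_simps)
  then have "deriv (\<lambda>t. exp (- \<alpha> * t) * g (exp t)) t = - \<alpha> * exp (- \<alpha> * t) * g (exp t) + exp (- \<alpha> * t) * (exp t * deriv g (exp t))"
    by (rule DERIV_imp_deriv)
  also have "\<dots> = exp (- \<alpha> * t) * (r * deriv g r - \<alpha> * g r)" unfolding t(2) by (simp add: algebra_simps)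
  finally have "\<bar>exp (- \<alpha> * t) * (r * deriv g r - \<alpha> * g r)\<bar> \<le> c * exp (- \<alpha> * t)"
    using adm_deriv[OF t(1)] by simp
  then have "exp (- \<alpha> * t) * \<bar>r * deriv g r - \<alpha> * g r\<bar> \<le> exp (- \<alpha> * t) * c"
    by (simp add: abs_mult mult.commute)
  then have "\<bar>r * deriv g r - \<alpha> * g r\<bar> \<le> c" by simp
  then show ?thesis using g_le[of r] unfolding \<kappa>_of_def by (simp add: algebra_simps)
qed

lemma exp_bounded_integrable:
  assumes "f \<in> borel_measurable borel" "\<And>r. \<bar>f r\<bar> \<le> (K::real)" "a > 0"
  shows "set_integrable lborel {..<w} (\<lambda>y. exp (a * y) * f (exp (- y) * b))"
proof -
  have [measurable]: "f \<in> borel_measurable borel" by fact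
  have "set_integrable lborel {..<w} (\<lambda>y. exp (a * y) * K)"
    using exp_left_tail(1)[OF assms(3), of w] by (intro set_integrable_mult_left)
  then show ?thesis
    unfolding set_integrable_def
  proof (rule Bochner_Integration.integrable_bound)
    show "AE y in lborel. norm (indicator {..<w} y *\<^sub>R (exp (a * y) * f (exp (- y) * b))) \<le> norm (indicator {..<w} y *\<^sub>R (exp (a * y) * K))"
      using assms(2) order_trans[OF assms(2) abs_ge_self] by (auto simp: indicator_def abs_mult)
  qed measurable
qed

text \<open>The integrand is the y-derivative of e^{ay} g (e^{-y} b), and the boundary term at minus
  infinity vanishes because g is bounded. It is applied with a = 1 + \<alpha> for the convolution
  identity and with a = \<alpha> for the integral of K.\<close>

lemma FTC_exp:
  assumes a: "a > 0"
  shows "(LINT y:{..<w}|lborel. a * exp (a * y) * g (exp (- y) * b) - exp (a * y) * (exp (- y) * b * deriv g (exp (- y) * b)))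
     = exp (a * w) * g (exp (- w) * b)"
proof -
  let ?f = "\<lambda>y. a * exp (a * y) * g (exp (- y) * b) - exp (a * y) * (exp (- y) * b * deriv g (exp (- y) * b))"
  let ?F = "\<lambda>t. exp (a * t) * g (exp (- t) * b)"
  \<comment> \<open>r g' r is controlled through \<kappa>, so the integrand is rewritten as e^{ay}
    times a bounded function of e^{-y} b.\<close>
  have f_eq: "?f y = exp (a * y) * (\<lambda>r. (a - 1 - \<alpha>) * g r + \<kappa> r) (exp (- y) * b)" for y
    by (simp add: \<kappa>_of_def algebra_simps)
  have si: "set_integrable lborel {..<w} ?f"
    unfolding f_eq
  proof (rule exp_bounded_integrable[OF _ _ a])
    fix r
    have "\<bar>(a - 1 - \<alpha>) * g r + \<kappa> r\<bar> \<le> \<bar>a - 1 - \<alpha>\<bar> * \<bar>g r\<bar> + \<bar>\<kappa> r\<bar>" by (simp add: abs_mult[symmetric] abs_triangle_ineq)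
    also have "\<dots> \<le> \<bar>a - 1 - \<alpha>\<bar> * sg + (sg + c)" using g_le \<kappa>_le by (intro add_mono mult_left_mono) auto
    finally show "\<bar>(a - 1 - \<alpha>) * g r + \<kappa> r\<bar> \<le> \<bar>a - 1 - \<alpha>\<bar> * sg + (sg + c)" .
  qed measurable
  have "isCont (deriv g) x" "isCont g x" for x
    using deriv_cont g_cont by (simp_all add: continuous_on_eq_continuous_at)
  moreover have "isCont (\<lambda>y. exp (- y) * b) x" for x :: real by (intro continuous_intros)
  ultimately have dcont: "isCont (\<lambda>y. deriv g (exp (- y) * b)) x" "isCont (\<lambda>y. g (exp (- y) * b)) x" for x
    by (auto intro: isCont_o2)
  have "(LBINT y=-\<infinity>..ereal w. ?f y) = ?F w - 0"
  proof (rule interval_integral_FTC_integrable)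
    show "(?F has_vector_derivative ?f x) (at x)" for x
      using D_exp[of a b x] by (simp add: has_real_derivative_iff_has_vector_derivative)
    show "isCont ?f x" for x using dcont by (intro continuous_intros) auto
    show "set_integrable lborel (einterval (-\<infinity>) (ereal w)) ?f" using si by simp
    show "((?F \<circ> real_of_ereal) \<longlongrightarrow> 0) (at_right (-\<infinity>))"
      unfolding ereal_tendsto_simps
    proof (rule Lim_null_comparison)
      show "\<forall>\<^sub>F x in at_bot. norm (?F x) \<le> exp (a * x) * sg"
        using g_le by (auto simp: abs_mult intro!: always_eventually mult_left_mono)
      have "((\<lambda>x. exp (a * x)) \<longlongrightarrow> 0) at_bot" using a by real_asymp
      then show "((\<lambda>x. exp (a * x) * sg) \<longlongrightarrow> 0) at_bot" by (rule tendsto_mult_left_zero)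
    qed
    show "((?F \<circ> real_of_ereal) \<longlongrightarrow> ?F w) (at_left (ereal w))"
      unfolding ereal_tendsto_simps
    proof -
      have "isCont ?F w" using dcont by (intro continuous_intros) auto
      then show "(?F \<longlongrightarrow> ?F w) (at_left w)" by (simp add: isCont_def filterlim_at_split)
    qed
  qed simp
  then show ?thesis by (simp add: interval_lebesgue_integral_def)
qed

text \<open>The factor e^y makes the integrand a total derivative; for fixed b this is the inversion
  of 1 + d/dw.\<close>

lemma conv_pointwise:
  "(LINT y:{..<w}|lborel. exp (- (w - y)) * (exp (\<alpha> * y) * \<kappa> (exp (- y) * b))) = exp (\<alpha> * w) * g (exp (- w) * b)"
proof -
  have "(LINT y:{..<w}|lborel. exp (- (w - y)) * (exp (\<alpha> * y) * \<kappa> (exp (- y) * b)))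
    = (LINT y:{..<w}|lborel. exp (- w) * ((1 + \<alpha>) * exp ((1 + \<alpha>) * y) * g (exp (- y) * b) - exp ((1 + \<alpha>) * y) * (exp (- y) * b * deriv g (exp (- y) * b))))"
  proof (rule set_lebesgue_integral_cong)
    have e: "exp (- (w - y)) = exp (- w) * exp y" "exp ((1 + \<alpha>) * y) = exp y * exp (\<alpha> * y)" for y
      by (simp_all add: exp_add[symmetric] algebra_simps)
    show "\<forall>y. y \<in> {..<w} \<longrightarrow> exp (- (w - y)) * (exp (\<alpha> * y) * \<kappa> (exp (- y) * b))
      = exp (- w) * ((1 + \<alpha>) * exp ((1 + \<alpha>) * y) * g (exp (- y) * b) - exp ((1 + \<alpha>) * y) * (exp (- y) * b * deriv g (exp (- y) * b)))"
      unfolding e \<kappa>_of_def by (simp add: algebra_simps)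
  qed simp
  also have "\<dots> = exp (- w) * (exp ((1 + \<alpha>) * w) * g (exp (- w) * b))"
    using \<alpha> by (subst set_integral_mult_right) (subst FTC_exp, auto)
  finally show ?thesis by (simp add: exp_add exp_minus algebra_simps)
qed

definition \<gamma> :: real where "\<gamma> = (LINT r:{1..}|lborel. g r * r powr (- \<alpha> - 1))"

definition \<gamma>1 :: real where "\<gamma>1 = (LINT t|lborel. exp (- \<alpha> * t) * g (exp t))"

lemma tail_integrable: "integrable lborel (\<lambda>t. exp (- \<alpha> * t) * g (exp t))"
proof (rule Bochner_Integration.integrable_bound)
  show "integrable lborel (\<lambda>t. (indicator {0<..} t *\<^sub>R exp (- \<alpha> * t)) * sg)"
    using exp_tail_integral_real(1)[OF \<alpha>, of 0] unfolding set_integrable_def by (rule integrable_mult_left)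
  have "\<bar>exp (- \<alpha> * t) * g (exp t)\<bar> \<le> \<bar>(indicator {0<..} t *\<^sub>R exp (- \<alpha> * t)) * sg\<bar>" for t
    using g_le[of "exp t"] sg_nonneg g_zero[of "exp t"] by (cases "t > 0") (auto simp: abs_mult)
  then show "AE t in lborel. norm (exp (- \<alpha> * t) * g (exp t)) \<le> norm ((indicator {0<..} t *\<^sub>R exp (- \<alpha> * t)) * sg)"
    by (intro AE_I2) simp
qed measurable

lemma \<gamma>_eq: "\<gamma> = \<gamma>1"
proof -
  have e: "exp ` (UNIV :: real set) = {0<..}" by (auto simp: image_iff) (metis exp_ln)
  have eq: "exp y * (g (exp y) * (exp y) powr (- \<alpha> - 1)) = exp (- \<alpha> * y) * g (exp y)" for y :: real
    by (simp add: powr_def exp_add[symmetric] exp_diff algebra_simps)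
  have "\<gamma> = (LINT r:{0<..}|lborel. g r * r powr (- \<alpha> - 1))"
    unfolding \<gamma>_def set_lebesgue_integral_def using g_zero
    by (intro Bochner_Integration.integral_cong) (auto simp: indicator_def)
  also have "\<dots> = (LINT r:exp ` UNIV|lborel. g r * r powr (- \<alpha> - 1))" unfolding e ..
  also have "\<dots> = (LINT y:UNIV|lborel. exp y * (g (exp y) * (exp y) powr (- \<alpha> - 1)))"
  proof (rule exp_substitution)
    show "set_integrable lborel UNIV (\<lambda>y. exp y * (g (exp y) * (exp y) powr (- \<alpha> - 1)))"
      unfolding eq using tail_integrable by (simp add: set_integrable_def)
  qed (auto simp: e)
  also have "\<dots> = \<gamma>1" unfolding eq \<gamma>1_def by (simp add: set_lebesgue_integral_def)
  finally show ?thesis .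
qed

lemma g_exp_integrable: "set_integrable lborel {..<w} (\<lambda>y. exp (\<alpha> * y) * g (exp (- y) * b))"
  by (rule exp_bounded_integrable[OF _ g_le \<alpha>]) measurable

lemma \<kappa>_exp_integrable: "set_integrable lborel {..<w} (\<lambda>y. exp (\<alpha> * y) * \<kappa> (exp (- y) * b))"
  by (rule exp_bounded_integrable[OF _ \<kappa>_le \<alpha>]) measurable

lemma \<kappa>_integral:
  "(LINT y:{..<w}|lborel. exp (\<alpha> * y) * \<kappa> (exp (- y) * b))
   = (LINT y:{..<w}|lborel. exp (\<alpha> * y) * g (exp (- y) * b)) + exp (\<alpha> * w) * g (exp (- w) * b)"
proof -
  have "(LINT y:{..<w}|lborel. exp (\<alpha> * y) * \<kappa> (exp (- y) * b)) - (LINT y:{..<w}|lborel. exp (\<alpha> * y) * g (exp (- y) * b))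
    = (LINT y:{..<w}|lborel. exp (\<alpha> * y) * \<kappa> (exp (- y) * b) - exp (\<alpha> * y) * g (exp (- y) * b))"
    by (rule set_integral_diff(2)[symmetric]) (rule g_exp_integrable \<kappa>_exp_integrable)+
  also have "\<dots> = (LINT y:{..<w}|lborel. \<alpha> * exp (\<alpha> * y) * g (exp (- y) * b) - exp (\<alpha> * y) * (exp (- y) * b * deriv g (exp (- y) * b)))"
    by (simp add: \<kappa>_of_def algebra_simps)
  also have "\<dots> = exp (\<alpha> * w) * g (exp (- w) * b)" by (rule FTC_exp[OF \<alpha>])
  finally show ?thesis by simp
qed

text \<open>Pathwise version of the integral of \<open>Gk g\<close>: its expectation at b = B is
  what the integral of K leaves after the boundary term is split off.\<close>

definition U :: "real \<Rightarrow> real \<Rightarrow> real" where "U w b = (LINT y:{..<w}|lborel. exp (\<alpha> * y) * g (exp (- y) * b))"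

lemma U_nonpos: "b \<le> 0 \<Longrightarrow> U w b = 0"
proof -
  assume b: "b \<le> 0"
  have "g (exp (- y) * b) = 0" for y
  proof -
    have "exp (- y) * b \<le> 0" using b by (simp add: mult_nonneg_nonpos)
    then show ?thesis by (intro g_zero) simp
  qed
  then show ?thesis by (simp add: U_def)
qed

lemma U_le: "\<bar>U w b\<bar> \<le> sg / \<alpha> * exp (\<alpha> * w)"
proof -
  have "\<bar>U w b\<bar> \<le> (LINT y:{..<w}|lborel. exp (\<alpha> * y) * sg)"
    unfolding U_def set_lebesgue_integral_def
  proof (rule order_trans[OF integral_abs_bound integral_mono])
    show "integrable lborel (\<lambda>y. \<bar>indicat_real {..<w} y *\<^sub>R (exp (\<alpha> * y) * g (exp (- y) * b))\<bar>)"
      using g_exp_integrable[of w b] unfolding set_integrable_def by (rule integrable_abs)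
    show "integrable lborel (\<lambda>y. indicat_real {..<w} y *\<^sub>R (exp (\<alpha> * y) * sg))"
      using set_integrable_mult_left[OF exp_left_tail(1)[OF \<alpha>, of w], of sg] unfolding set_integrable_def .
    show "\<bar>indicat_real {..<w} y *\<^sub>R (exp (\<alpha> * y) * g (exp (- y) * b))\<bar> \<le> indicat_real {..<w} y *\<^sub>R (exp (\<alpha> * y) * sg)" for y
      using g_le by (auto simp: indicator_def abs_mult)
  qed
  also have "\<dots> = exp (\<alpha> * w) / \<alpha> * sg"
    by (subst set_integral_mult_left) (simp add: exp_left_tail(2)[OF \<alpha>])
  finally show ?thesis by (simp add: mult.commute)
qed

text \<open>For b \<le> e^w the cut at w is invisible, since g (e^{-y} b) vanishes for y \<ge> w;
  the substitution y = ln b - t then scales b out.\<close>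

lemma U_small: assumes b: "0 < b" "b \<le> exp w" shows "U w b = b powr \<alpha> * \<gamma>"
proof -
  have "U w b = (LINT y|lborel. exp (\<alpha> * y) * g (exp (- y) * b))"
    unfolding U_def set_lebesgue_integral_def
  proof (rule Bochner_Integration.integral_cong[OF refl])
    fix y :: real
    show "indicat_real {..<w} y *\<^sub>R (exp (\<alpha> * y) * g (exp (- y) * b)) = exp (\<alpha> * y) * g (exp (- y) * b)"
    proof (cases "y < w")
      case False
      then have "exp w \<le> exp y" by simp
      then have "b \<le> exp y" using b by linarith
      then have "exp (- y) * b \<le> exp (- y) * exp y" by (intro mult_left_mono) auto
      then have "g (exp (- y) * b) = 0" by (intro g_zero) (simp add: exp_minus)
      then show ?thesis by simp
    qed simp
  qed
  also have "\<dots> = (LINT t|lborel. exp (\<alpha> * (ln b + (-1) * t)) * g (exp (- (ln b + (-1) * t)) * b))"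
    using lborel_integral_real_affine[of "-1" "\<lambda>y. exp (\<alpha> * y) * g (exp (- y) * b)" "ln b"] by simp
  also have "\<dots> = (LINT t|lborel. b powr \<alpha> * (exp (- \<alpha> * t) * g (exp t)))"
  proof (rule Bochner_Integration.integral_cong[OF refl])
    fix t :: real
    have "exp (\<alpha> * (ln b + (-1) * t)) = b powr \<alpha> * exp (- \<alpha> * t)"
      using b by (simp add: powr_def exp_add[symmetric] algebra_simps)
    moreover have "exp (- (ln b + (-1) * t)) * b = exp t"
      using b by (simp add: exp_diff)
    ultimately show "exp (\<alpha> * (ln b + (-1) * t)) * g (exp (- (ln b + (-1) * t)) * b) = b powr \<alpha> * (exp (- \<alpha> * t) * g (exp t))"
      by (simp only: mult.assoc)
  qed
  also have "\<dots> = b powr \<alpha> * \<gamma>"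
    unfolding \<gamma>_eq \<gamma>1_def by (rule integral_mult_right_zero)
  finally show ?thesis .
qed

lemma \<gamma>_le: "\<bar>\<gamma>\<bar> \<le> sg / \<alpha>"
proof -
  have "U 0 1 = 1 powr \<alpha> * \<gamma>" by (rule U_small) auto
  then have "U 0 1 = \<gamma>" by simp
  then show ?thesis using U_le[of 0 1] by (simp only: mult_zero_right exp_zero mult_1_right)
qed

end

section \<open>The smoothed renewal measure\<close>

text \<open>Viewing the renewal measure as an image of counting measure times M makes the
  product-measure theorems available: sums over n become ordinary integrals.\<close>

lemma renewal_measure_eq_distr:
  fixes X :: "nat \<Rightarrow> 'a \<Rightarrow> real"
  assumes M: "sigma_finite_measure M" and X [measurable]: "\<And>i. X i \<in> borel_measurable M"
  shows "(\<lambda>(n, \<omega>). \<Sum>i<n. X i \<omega>) \<in> borel_measurable (count_space UNIV \<Otimes>\<^sub>M M)"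
    and "renewal_measure M X = distr (count_space UNIV \<Otimes>\<^sub>M M) borel (\<lambda>(n, \<omega>). \<Sum>i<n. X i \<omega>)"
proof -
  interpret sigma_finite_measure M by fact
  let ?C = "count_space (UNIV :: nat set)"
  let ?g = "\<lambda>(n, \<omega>). \<Sum>i<n. X i \<omega>"
  show g [measurable]: "?g \<in> borel_measurable (?C \<Otimes>\<^sub>M M)"
  proof -
    have "(\<lambda>p. (\<lambda>n \<omega>. \<Sum>i<n. X i \<omega>) (fst p) (snd p)) \<in> borel_measurable (?C \<Otimes>\<^sub>M M)"
      by (rule measurable_compose_countable') (auto simp: countableI_type)
    then show ?thesis by (simp add: case_prod_beta)
  qed
  show "renewal_measure M X = distr (?C \<Otimes>\<^sub>M M) borel ?g"
  proof (rule measure_eqI)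
    fix D assume "D \<in> sets (renewal_measure M X)"
    then have D[measurable]: "D \<in> sets borel" by simp
    have "emeasure (distr (?C \<Otimes>\<^sub>M M) borel ?g) D = (\<integral>\<^sup>+p. indicator D (?g p) \<partial>(?C \<Otimes>\<^sub>M M))"
      by (subst nn_integral_distr[OF g, of "indicator D", symmetric]) auto
    also have "\<dots> = (\<integral>\<^sup>+n. \<integral>\<^sup>+\<omega>. indicator D (?g (n, \<omega>)) \<partial>M \<partial>?C)"
      by (rule nn_integral_fst[symmetric]) measurable
    also have "\<dots> = (\<integral>\<^sup>+n. emeasure M {\<omega> \<in> space M. (\<Sum>i<n. X i \<omega>) \<in> D} \<partial>?C)"
    proof (intro nn_integral_cong)
      fix n
      have "(\<integral>\<^sup>+\<omega>. indicator D (?g (n, \<omega>)) \<partial>M) = (\<integral>\<^sup>+\<omega>. indicator {\<omega> \<in> space M. (\<Sum>i<n. X i \<omega>) \<in> D} \<omega> \<partial>M)"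
        by (intro nn_integral_cong) (auto simp: indicator_def)
      then show "(\<integral>\<^sup>+\<omega>. indicator D (?g (n, \<omega>)) \<partial>M) = emeasure M {\<omega> \<in> space M. (\<Sum>i<n. X i \<omega>) \<in> D}"
        by simp
    qed
    also have "\<dots> = emeasure (renewal_measure M X) D"
      by (simp add: emeasure_renewal_measure[OF X D] nn_integral_count_space_nat)
    finally show "emeasure (renewal_measure M X) D = emeasure (distr (?C \<Otimes>\<^sub>M M) borel ?g) D" ..
  qed simp
qed

lemma nn_integral_renewal_measure:
  fixes X :: "nat \<Rightarrow> 'a \<Rightarrow> real"
  assumes M: "sigma_finite_measure M" and X [measurable]: "\<And>i. X i \<in> borel_measurable M"
    and f [measurable]: "f \<in> borel_measurable borel"
  shows "(\<integral>\<^sup>+z. f z \<partial>renewal_measure M X) = (\<Sum>n. \<integral>\<^sup>+\<omega>. f (\<Sum>i<n. X i \<omega>) \<partial>M)"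
proof -
  interpret sigma_finite_measure M by fact
  note [measurable] = renewal_measure_eq_distr(1)[OF M X]
  have "(\<integral>\<^sup>+z. f z \<partial>renewal_measure M X)
     = (\<integral>\<^sup>+n. \<integral>\<^sup>+\<omega>. f ((\<lambda>(n, \<omega>). \<Sum>i<n. X i \<omega>) (n, \<omega>)) \<partial>M \<partial>count_space UNIV)"
    unfolding renewal_measure_eq_distr(2)[OF M X]
    by (subst nn_integral_distr) (auto simp: nn_integral_fst[symmetric])
  then show ?thesis by (simp add: nn_integral_count_space_nat)
qed

text \<open>Fubini on the same product space, for Banach-valued integrands; it is applied to complex
  exponentials and to Gaussian densities.\<close>

lemma sums_renewal_measure:
  fixes X :: "nat \<Rightarrow> 'a \<Rightarrow> real" and f :: "real \<Rightarrow> 'b::{banach, second_countable_topology}"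
  assumes M: "sigma_finite_measure M" and X [measurable]: "\<And>i. X i \<in> borel_measurable M"
    and f: "integrable (renewal_measure M X) f"
  shows "(\<lambda>n. LINT \<omega>|M. f (\<Sum>i<n. X i \<omega>)) sums (LINT z|renewal_measure M X. f z)"
proof -
  let ?C = "count_space (UNIV :: nat set)"
  interpret C: pair_sigma_finite ?C M
    using M by (simp add: pair_sigma_finite_def sigma_finite_measure_count_space)
  have [measurable]: "f \<in> borel_measurable borel" using f by auto
  note [measurable] = renewal_measure_eq_distr(1)[OF M X]
  let ?h = "\<lambda>(n, \<omega>). f (\<Sum>i<n. X i \<omega>)"
  have h: "integrable (?C \<Otimes>\<^sub>M M) ?h"
    using f unfolding renewal_measure_eq_distr(2)[OF M X]
    by (subst (asm) integrable_distr_eq) (auto simp: case_prod_beta')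
  have "(LINT z|renewal_measure M X. f z) = integral\<^sup>L (?C \<Otimes>\<^sub>M M) ?h"
    unfolding renewal_measure_eq_distr(2)[OF M X] by (subst integral_distr) (auto simp: case_prod_beta')
  also have "\<dots> = (LINT n|?C. LINT \<omega>|M. f (\<Sum>i<n. X i \<omega>))"
    using C.integral_fst'[OF h] by simp
  finally have eq: "(LINT z|renewal_measure M X. f z) = \<dots>" .
  have "integrable ?C (\<lambda>n. LINT \<omega>|M. f (\<Sum>i<n. X i \<omega>))"
    using C.integrable_fst'[OF h] by simp
  then show ?thesis unfolding eq by (rule sums_integral_count_space_nat)
qed

lemma exp_tail_integral:
  assumes "Re w > 0"
  shows "set_integrable lborel {z<..} (\<lambda>u. exp (- w * complex_of_real u))"
    "(CLINT u:{z<..}|lborel. exp (- w * complex_of_real u)) = exp (- w * of_real z) / w"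
proof -
  have w0: "w \<noteq> 0" using assms by auto
  show si: "set_integrable lborel {z<..} (\<lambda>u. exp (- w * complex_of_real u))"
    using exp_tail_integral_real(1)[OF assms, of z] unfolding set_integrable_def
    by (rule Bochner_Integration.integrable_bound) (auto simp: indicator_def)
  have d: "((\<lambda>u. - exp (- w * complex_of_real u) / w) has_vector_derivative exp (- w * of_real x)) (at x)" for x
  proof -
    have "((\<lambda>u. - exp (- w * u) / w) has_field_derivative exp (- w * of_real x)) (at (of_real x))"
      using w0 by (auto intro!: derivative_eq_intros)
    then show ?thesis by (rule has_vector_derivative_real_field)
  qed
  have A: "(((\<lambda>u. - exp (- w * complex_of_real u) / w) \<circ> real_of_ereal) \<longlongrightarrow> - exp (- w * of_real z) / w) (at_right (ereal z))"
    unfolding ereal_tendsto_simps using w0 by (auto intro!: tendsto_eq_intros)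
  have "((\<lambda>u. - exp (- w * complex_of_real u) / w) \<longlongrightarrow> 0) at_top"
  proof (rule Lim_null_comparison)
    show "\<forall>\<^sub>F u in at_top. norm (- exp (- w * complex_of_real u) / w) \<le> exp (- Re w * u) / cmod w"
      by (auto simp: norm_divide)
    have "((\<lambda>u. exp (- Re w * u) / cmod w) \<longlongrightarrow> 0 / cmod w) at_top"
      using assms w0 by (intro tendsto_intros filterlim_compose[OF exp_at_bot])
        (auto simp: filterlim_uminus_at_bot intro!: filterlim_tendsto_pos_mult_at_top[OF tendsto_const _ filterlim_ident])
    then show "((\<lambda>u. exp (- Re w * u) / cmod w) \<longlongrightarrow> 0) at_top" by simp
  qed
  then have B: "(((\<lambda>u. - exp (- w * complex_of_real u) / w) \<circ> real_of_ereal) \<longlongrightarrow> 0) (at_left \<infinity>)"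
    unfolding ereal_tendsto_simps by simp
  have "(LBINT u=ereal z..\<infinity>. exp (- w * complex_of_real u)) = 0 - (- exp (- w * of_real z) / w)"
    by (rule interval_integral_FTC_integrable[OF _ d _ _ A B]) (use si in auto)
  then show "(CLINT u:{z<..}|lborel. exp (- w * complex_of_real u)) = exp (- w * of_real z) / w"
    by (simp add: interval_lebesgue_integral_def)
qed

definition kexp :: "real \<Rightarrow> real" where "kexp u = (if 0 \<le> u then exp (- u) else 0)"

lemma kexp_meas [measurable]: "kexp \<in> borel_measurable borel"
  unfolding kexp_def by measurable

lemma kexp_nonneg: "0 \<le> kexp u" by (simp add: kexp_def)

locale positive_drift = real_distribution \<nu> for \<nu> :: "real measure" +
  fixes \<theta>0 :: real
  assumes mean_int: "integrable \<nu> (\<lambda>x. x)"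
    and mean_pos: "0 < (LINT x|\<nu>. x)"
    and \<theta>0: "0 < \<theta>0" and left_int: "integrable \<nu> (\<lambda>x. exp (- \<theta>0 * x))"
begin

definition m :: real where "m = (LINT x|\<nu>. x)"
text \<open>Sign convention: Re s > 0 weights the left tail of the law, the one with an exponential
  moment, so the transform is available for 0 \<le> Re s \<le> \<theta>0. On the imaginary axis it
  is the characteristic function at -t.\<close>

definition F :: "complex \<Rightarrow> complex" where "F s = (CLINT x|\<nu>. exp (- s * of_real x))"
definition Fr :: "real \<Rightarrow> real" where "Fr \<theta> = (LINT x|\<nu>. exp (- \<theta> * x))"

lemma m_pos: "0 < m" using mean_pos by (simp add: m_def)

lemma integrable_exp_between:
  assumes "integrable \<nu> (\<lambda>x. exp (- a * x))" "integrable \<nu> (\<lambda>x. exp (- b * x))" "a \<le> \<theta>" "\<theta> \<le> b"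
  shows "integrable \<nu> (\<lambda>x. exp (- \<theta> * x))"
proof (rule Bochner_Integration.integrable_bound)
  show "integrable \<nu> (\<lambda>x. exp (- a * x) + exp (- b * x))" using assms by auto
  have "exp (- \<theta> * x) \<le> exp (- a * x) + exp (- b * x)" for x
  proof (cases "x \<ge> 0")
    case True
    then have "exp (- \<theta> * x) \<le> exp (- a * x)" using assms by (auto intro: mult_right_mono)
    then show ?thesis using exp_ge_zero[of "- b * x"] by linarith
  next
    case False
    then have "exp (- \<theta> * x) \<le> exp (- b * x)" using assms by (auto intro: mult_right_mono_neg)
    then show ?thesis using exp_ge_zero[of "- a * x"] by linarith
  qed
  then show "AE x in \<nu>. norm (exp (- \<theta> * x)) \<le> norm (exp (- a * x) + exp (- b * x))"
    by (auto intro!: AE_I2 simp: abs_of_nonneg add_nonneg_nonneg)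
qed auto

lemma integrable_exp_right: "0 \<le> \<theta> \<Longrightarrow> \<theta> \<le> \<theta>0 \<Longrightarrow> integrable \<nu> (\<lambda>x. exp (- \<theta> * x))"
  using integrable_exp_between[of 0 \<theta>0 \<theta>] left_int by simp

lemma integrable_cexp:
  assumes "integrable \<nu> (\<lambda>x. exp (- Re s * x))"
  shows "integrable \<nu> (\<lambda>x. exp (- s * of_real x))"
  by (rule Bochner_Integration.integrable_bound[OF assms]) auto

lemma cmod_F_le: "cmod (F s) \<le> Fr (Re s)"
proof -
  have "cmod (F s) \<le> (LINT x|\<nu>. norm (exp (- s * of_real x)))"
    unfolding F_def by (rule integral_norm_bound)
  then show ?thesis by (simp add: Fr_def)
qed

lemma F_of_real: "F (of_real \<theta>) = of_real (Fr \<theta>)"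
proof -
  have "F (of_real \<theta>) = (CLINT x|\<nu>. complex_of_real (exp (- \<theta> * x)))"
    unfolding F_def by (intro Bochner_Integration.integral_cong) (simp_all add: exp_of_real[symmetric])
  then show ?thesis by (simp only: integral_complex_of_real Fr_def)
qed

lemma Fr_0: "Fr 0 = 1"
  by (simp del: space_eq_univ add: Fr_def prob_space)

lemma Fr_nonneg: "0 \<le> Fr \<theta>" by (simp add: Fr_def)

text \<open>At \<open>0\<close> the derivative of \<open>Fr\<close> is \<open>- m < 0\<close>; the left tail provides the dominating function.\<close>

lemma Fr_less_1: "\<exists>\<theta>1>0. \<theta>1 \<le> \<theta>0 \<and> (\<forall>\<theta>. 0 < \<theta> \<and> \<theta> \<le> \<theta>1 \<longrightarrow> Fr \<theta> < 1)"
proof -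
  have bd: "\<bar>(1 - exp (- \<theta> * x)) / \<theta>\<bar> \<le> \<bar>x\<bar> + 2 / \<theta>0 * exp (- \<theta>0 * x)" if th: "0 < \<theta>" "\<theta> \<le> \<theta>0 / 2" for \<theta> x
  proof (cases "x \<ge> 0")
    case True
    have "1 - exp (- \<theta> * x) \<le> \<theta> * x" using exp_ge_add_one_self[of "- \<theta> * x"] by simp
    moreover have "exp (- \<theta> * x) \<le> 1" using True th by simp
    ultimately have "\<bar>(1 - exp (- \<theta> * x)) / \<theta>\<bar> \<le> x" using th by (simp add: field_simps)
    then show ?thesis using True \<theta>0 by (simp add: add_increasing2)
  next
    case False
    define y where "y = - x" then have y: "y > 0" using False by simp
    have "exp (\<theta> * y) - 1 \<le> \<theta> * y * exp (\<theta> * y)"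
      using exp_ge_add_one_self[of "- (\<theta> * y)"] mult_right_mono[of "1 - \<theta> * y" "exp (- (\<theta> * y))" "exp (\<theta> * y)"]
      by (simp add: exp_minus algebra_simps)
    \<comment> \<open>One half of \<theta>0 absorbs the linear factor y, the other half bounds
      e^{\<theta>y}; hence the restriction \<theta> \<le> \<theta>0 / 2.\<close>
    also have "\<theta> * y * exp (\<theta> * y) \<le> \<theta> * (2 / \<theta>0 * exp (\<theta>0 / 2 * y)) * exp (\<theta>0 / 2 * y)"
    proof (rule mult_mono)
      show "\<theta> * y \<le> \<theta> * (2 / \<theta>0 * exp (\<theta>0 / 2 * y))"
        using exp_ge_add_one_self[of "\<theta>0 / 2 * y"] \<theta>0 y th by (intro mult_left_mono) (auto simp: field_simps)
    qed (use th y \<theta>0 in \<open>auto intro!: mult_right_mono\<close>)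
    also have "\<dots> = \<theta> * (2 / \<theta>0 * exp (\<theta>0 * y))" by (simp add: exp_add[symmetric] mult.assoc)
    finally have "(exp (\<theta> * y) - 1) / \<theta> \<le> 2 / \<theta>0 * exp (\<theta>0 * y)" using th by (simp add: field_simps)
    moreover have "\<bar>(1 - exp (- \<theta> * x)) / \<theta>\<bar> = (exp (\<theta> * y) - 1) / \<theta>" using th y mult_pos_neg[of \<theta> x] by (simp add: y_def abs_if field_simps)
    ultimately show ?thesis by (simp add: y_def)
  qed
  have lim: "((\<lambda>\<theta>. LINT x|\<nu>. (1 - exp (- \<theta> * x)) / \<theta>) \<longlongrightarrow> m) (at_right 0)"
    unfolding tendsto_at_iff_sequentially m_def
  proof safe
    fix \<theta> :: "nat \<Rightarrow> real" assume th: "\<forall>i. \<theta> i \<in> {0<..} - {0}" "\<theta> \<longlonglongrightarrow> 0"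
    have "eventually (\<lambda>i. \<theta> i < \<theta>0 / 2) sequentially" using order_tendstoD(2)[OF th(2), of "\<theta>0 / 2"] \<theta>0 by simp
    then obtain N where N: "\<And>i. i \<ge> N \<Longrightarrow> \<theta> i < \<theta>0 / 2" by (auto simp: eventually_sequentially)
    have pos: "\<theta> i > 0" for i using th(1) by auto
    have "(\<lambda>i. LINT x|\<nu>. (1 - exp (- \<theta> (i + N) * x)) / \<theta> (i + N)) \<longlonglongrightarrow> (LINT x|\<nu>. x)"
    proof (rule integral_dominated_convergence[where w = "\<lambda>x. \<bar>x\<bar> + 2 / \<theta>0 * exp (- \<theta>0 * x)"])
      show "integrable \<nu> (\<lambda>x. \<bar>x\<bar> + 2 / \<theta>0 * exp (- \<theta>0 * x))"
        using mean_int left_int by auto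
      have "((\<lambda>\<theta>. (1 - exp (- \<theta> * x)) / \<theta>) \<longlongrightarrow> x) (at 0)" for x :: real
      proof -
        have "((\<lambda>\<theta>. 1 - exp (- \<theta> * x)) has_real_derivative x) (at 0)"
          by (auto intro!: derivative_eq_intros)
        then show ?thesis by (simp add: has_field_derivative_iff)
      qed
      moreover have "filterlim (\<lambda>i. \<theta> (i + N)) (at 0) sequentially"
        using LIMSEQ_ignore_initial_segment[OF th(2), of N] th(1)
        by (auto simp: filterlim_at intro!: always_eventually) (metis less_irrefl)
      ultimately show "AE x in \<nu>. (\<lambda>i. (1 - exp (- \<theta> (i + N) * x)) / \<theta> (i + N)) \<longlonglongrightarrow> x"
        by (intro AE_I2) (rule filterlim_compose)
      show "\<And>i. AE x in \<nu>. norm ((1 - exp (- \<theta> (i + N) * x)) / \<theta> (i + N)) \<le> \<bar>x\<bar> + 2 / \<theta>0 * exp (- \<theta>0 * x)"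
        using bd[OF pos] N by (auto intro!: AE_I2 simp: less_imp_le)
    qed auto
    then show "((\<lambda>\<theta>. LINT x|\<nu>. (1 - exp (- \<theta> * x)) / \<theta>) \<circ> \<theta>) \<longlonglongrightarrow> (LINT x|\<nu>. x)"
      unfolding o_def by (rule LIMSEQ_offset)
  qed
  have "eventually (\<lambda>\<theta>. 0 < (LINT x|\<nu>. (1 - exp (- \<theta> * x)) / \<theta>)) (at_right 0)"
    using order_tendstoD(1)[OF lim m_pos] .
  then obtain b where b: "b > 0" "\<And>\<theta>. 0 < \<theta> \<Longrightarrow> \<theta> < b \<Longrightarrow> 0 < (LINT x|\<nu>. (1 - exp (- \<theta> * x)) / \<theta>)"
    by (auto simp: eventually_at_right_field)
  have *: "Fr \<theta> < 1" if "0 < \<theta>" "\<theta> < b" "\<theta> \<le> \<theta>0" for \<theta>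
  proof -
    have "(LINT x|\<nu>. (1 - exp (- \<theta> * x)) / \<theta>) = (1 - Fr \<theta>) / \<theta>"
      using integrable_exp_right[of \<theta>] that by (simp del: space_eq_univ add: Fr_def prob_space Bochner_Integration.integral_diff)
    then show ?thesis using b(2)[of \<theta>] that by (simp add: zero_less_divide_iff)
  qed
  show ?thesis
    using b(1) \<theta>0 by (intro exI[of _ "min (b/2) \<theta>0"]) (auto intro!: *)
qed

end

locale drift_walk = positive_drift \<nu> \<theta>0 + P: prob_space M for \<nu> \<theta>0 and M :: "'a measure" +
  fixes X :: "nat \<Rightarrow> 'a \<Rightarrow> real"
  assumes indep: "P.indep_vars (\<lambda>_. borel) X UNIV"
    and distr_X: "\<And>n. distr M borel (X n) = \<nu>"
begin

lemma X_meas [measurable]: "X n \<in> borel_measurable M"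
  using indep by (auto simp: P.indep_vars_def)

definition S :: "nat \<Rightarrow> 'a \<Rightarrow> real" where "S n \<omega> = (\<Sum>i<n. X i \<omega>)"

lemma S_meas [measurable]: "S n \<in> borel_measurable M"
  unfolding S_def by measurable

abbreviation H where "H \<equiv> renewal_measure M X"

lemma nn_integral_H:
  "f \<in> borel_measurable borel \<Longrightarrow> (\<integral>\<^sup>+z. f z \<partial>H) = (\<Sum>n. \<integral>\<^sup>+\<omega>. f (S n \<omega>) \<partial>M)"
  unfolding S_def by (rule nn_integral_renewal_measure) (auto intro: P.sigma_finite_measure_axioms)

lemma expectation_exp_S:
  assumes s: "integrable \<nu> (\<lambda>x. exp (- Re s * x))"
  shows "(CLINT \<omega>|M. exp (- s * of_real (S n \<omega>))) = F s ^ n"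
    and "integrable M (\<lambda>\<omega>. exp (- s * of_real (S n \<omega>)))"
proof -
  have ind: "P.indep_vars (\<lambda>_. borel) (\<lambda>i \<omega>. exp (- s * of_real (X i \<omega>))) {..<n}"
    using P.indep_vars_compose2[OF P.indep_vars_subset[OF indep], of "{..<n}" "\<lambda>_ x. exp (- s * complex_of_real x)" "\<lambda>_. borel"]
    by auto
  have int: "integrable M (\<lambda>\<omega>. exp (- s * of_real (X i \<omega>)))" for i
    using integrable_cexp[OF s] unfolding distr_X[of i, symmetric]
    by (subst (asm) integrable_distr_eq) auto
  have val: "(CLINT \<omega>|M. exp (- s * of_real (X i \<omega>))) = F s" for i
  proof -
    have "(CLINT x|distr M borel (X i). exp (- s * of_real x)) = (CLINT \<omega>|M. exp (- s * of_real (X i \<omega>)))"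
      by (subst integral_distr) auto
    then show ?thesis unfolding distr_X F_def by simp
  qed
  have prod: "exp (- s * of_real (S n \<omega>)) = (\<Prod>i<n. exp (- s * of_real (X i \<omega>)))" for \<omega>
    by (simp add: S_def exp_sum sum_negf[symmetric] sum_distrib_left)
  show "(CLINT \<omega>|M. exp (- s * of_real (S n \<omega>))) = F s ^ n"
    unfolding prod by (subst P.indep_vars_lebesgue_integral[OF _ ind int]) (auto simp: val[simplified])
  show "integrable M (\<lambda>\<omega>. exp (- s * of_real (S n \<omega>)))"
    unfolding prod by (rule P.indep_vars_integrable[OF _ ind int]) auto
qed

lemma expectation_exp_S_real:
  assumes s: "integrable \<nu> (\<lambda>x. exp (- \<theta> * x))"
  shows "(\<integral>\<^sup>+\<omega>. ennreal (exp (- \<theta> * S n \<omega>)) \<partial>M) = ennreal (Fr \<theta> ^ n)"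
proof -
  have "integrable M (\<lambda>\<omega>. exp (- \<theta> * S n \<omega>))"
    using integrable_norm[OF expectation_exp_S(2)[of "of_real \<theta>" n]] s by simp
  moreover have "complex_of_real (LINT \<omega>|M. exp (- \<theta> * S n \<omega>)) = of_real (Fr \<theta> ^ n)"
    using expectation_exp_S(1)[of "of_real \<theta>" n] s unfolding F_of_real
    by (subst integral_complex_of_real[symmetric]) (simp add: exp_of_real[symmetric])
  then have "(LINT \<omega>|M. exp (- \<theta> * S n \<omega>)) = Fr \<theta> ^ n" by (simp only: of_real_eq_iff)
  ultimately show ?thesis by (subst nn_integral_eq_integral) auto
qed

text \<open>By independence S_n contributes the n-th power of \<open>Fr \<theta>\<close>, and the
  geometric series sums. Since \<open>Fr_less_1\<close> provides \<theta> > 0 with Fr \<theta> < 1,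
  this is the source of the finiteness statements about the renewal measure.\<close>

lemma laplace_H:
  assumes "integrable \<nu> (\<lambda>x. exp (- \<theta> * x))" "Fr \<theta> < 1"
  shows "(\<integral>\<^sup>+z. ennreal (exp (- \<theta> * z)) \<partial>H) = ennreal (1 / (1 - Fr \<theta>))"
proof -
  have "(\<integral>\<^sup>+z. ennreal (exp (- \<theta> * z)) \<partial>H) = (\<Sum>n. ennreal (Fr \<theta> ^ n))"
    by (subst nn_integral_H) (auto simp: expectation_exp_S_real[OF assms(1), simplified])
  also have "\<dots> = ennreal (\<Sum>n. Fr \<theta> ^ n)"
    using assms(2) by (intro suminf_ennreal2) (auto simp: Fr_nonneg intro: summable_geometric)
  also have "(\<Sum>n. Fr \<theta> ^ n) = 1 / (1 - Fr \<theta>)"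
    using assms(2) Fr_nonneg[of \<theta>] by (intro suminf_geometric) auto
  finally show ?thesis .
qed

text \<open>Required for Fubini against the renewal measure. On [-n, n] the constant 1 is at most
  e^{\<theta>n} e^{-\<theta>z}, whose integral is finite by \<open>laplace_H\<close>.\<close>

lemma sigma_finite_H: "sigma_finite_measure H"
proof -
  obtain \<theta> where th: "0 < \<theta>" "integrable \<nu> (\<lambda>x. exp (- \<theta> * x))" "Fr \<theta> < 1"
    using Fr_less_1 integrable_exp_right by (metis less_imp_le order_refl)
  define A where "A n = {- real n..real n}" for n :: nat
  have "emeasure H (A n) \<noteq> \<infinity>" for n
  proof -
    have "emeasure H (A n) = (\<integral>\<^sup>+z. indicator (A n) z \<partial>H)" by (simp add: A_def)
    also have "\<dots> \<le> (\<integral>\<^sup>+z. ennreal (exp (\<theta> * n)) * ennreal (exp (- \<theta> * z)) \<partial>H)"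
    proof (intro nn_integral_mono)
      fix z :: real
      have "1 \<le> exp (\<theta> * n) * exp (- \<theta> * z)" if "z \<le> n"
        using that th(1) by (simp add: exp_add[symmetric])
      then have "indicator (A n) z \<le> ennreal (exp (\<theta> * n) * exp (- \<theta> * z))"
        by (auto simp: A_def indicator_def simp flip: ennreal_1 intro!: ennreal_leI)
      then show "indicator (A n) z \<le> ennreal (exp (\<theta> * n)) * ennreal (exp (- \<theta> * z))"
        by (simp add: ennreal_mult'')
    qed
    also have "\<dots> < \<infinity>"
      using laplace_H[OF th(2,3)] by (subst nn_integral_cmult) (auto simp: ennreal_mult_less_top)
    finally show ?thesis by simp
  qed
  moreover have "(\<Union>n. A n) = UNIV"
  proof safe
    fix x :: real
    obtain n :: nat where "\<bar>x\<bar> \<le> real n" using real_arch_simple by blast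
    then show "x \<in> (\<Union>n. A n)" by (auto simp: A_def intro!: exI[of _ n])
  qed simp
  ultimately show ?thesis
    by (intro sigma_finite_measure.intro exI[of _ "range A"]) (auto simp: A_def)
qed

text \<open>The integral is finite (\<open>ennreal_Q\<close>), so \<open>enn2real\<close> discards
  no infinite value here.\<close>

definition Q :: "real \<Rightarrow> real" where "Q x = enn2real (\<integral>\<^sup>+z. ennreal (kexp (x - z)) \<partial>H)"

lemma Q_nonneg: "0 \<le> Q x" by (simp add: Q_def)

lemma Q_bound':
  assumes th: "0 < \<theta>" "\<theta> \<le> 1" "integrable \<nu> (\<lambda>x. exp (- \<theta> * x))" "Fr \<theta> < 1"
  shows "(\<integral>\<^sup>+z. ennreal (kexp (x - z)) \<partial>H) \<le> ennreal (exp (\<theta> * x) * (1 / (1 - Fr \<theta>)))"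
proof -
  have "(\<integral>\<^sup>+z. ennreal (kexp (x - z)) \<partial>H) \<le> (\<integral>\<^sup>+z. ennreal (exp (\<theta> * x)) * ennreal (exp (- \<theta> * z)) \<partial>H)"
  proof (intro nn_integral_mono)
    fix z
    have "kexp (x - z) \<le> exp (\<theta> * x) * exp (- \<theta> * z)"
    proof (cases "z \<le> x")
      case True
      then have "- (x - z) \<le> \<theta> * (x - z)" using th(1)
        by (smt (verit) mult_nonneg_nonneg)
      then show ?thesis by (simp add: kexp_def exp_add[symmetric] algebra_simps)
    qed (simp add: kexp_def)
    then show "ennreal (kexp (x - z)) \<le> ennreal (exp (\<theta> * x)) * ennreal (exp (- \<theta> * z))"
      by (subst ennreal_mult''[symmetric]) (auto intro: ennreal_leI)
  qed
  also have "\<dots> = ennreal (exp (\<theta> * x)) * ennreal (1 / (1 - Fr \<theta>))"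
    by (subst nn_integral_cmult) (auto simp: laplace_H[OF th(3,4), simplified])
  also have "\<dots> = ennreal (exp (\<theta> * x) * (1 / (1 - Fr \<theta>)))"
    using th by (intro ennreal_mult''[symmetric]) auto
  finally show ?thesis .
qed

lemma obtain_\<theta>:
  obtains \<theta> where "0 < \<theta>" "\<theta> \<le> 1" "integrable \<nu> (\<lambda>x. exp (- \<theta> * x))" "Fr \<theta> < 1"
proof -
  obtain \<theta>1 where "0 < \<theta>1" "\<theta>1 \<le> \<theta>0" "\<And>\<theta>. 0 < \<theta> \<and> \<theta> \<le> \<theta>1 \<Longrightarrow> Fr \<theta> < 1" using Fr_less_1 by blast
  then show ?thesis using that[of "min \<theta>1 1"] integrable_exp_right[of "min \<theta>1 1"] by auto
qed

lemma ennreal_Q: "ennreal (Q x) = (\<integral>\<^sup>+z. ennreal (kexp (x - z)) \<partial>H)"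
proof -
  obtain \<theta> where th: "0 < \<theta>" "\<theta> \<le> 1" "integrable \<nu> (\<lambda>x. exp (- \<theta> * x))" "Fr \<theta> < 1" by (rule obtain_\<theta>)
  have "(\<integral>\<^sup>+z. ennreal (kexp (x - z)) \<partial>H) < \<infinity>"
    using Q_bound'[OF th, of x] by (simp add: le_less_trans)
  then show ?thesis unfolding Q_def by (simp add: less_top)
qed

lemma Q_bound:
  assumes th: "0 < \<theta>" "\<theta> \<le> 1" "integrable \<nu> (\<lambda>x. exp (- \<theta> * x))" "Fr \<theta> < 1"
  shows "Q x \<le> exp (\<theta> * x) * (1 / (1 - Fr \<theta>))"
  using Q_bound'[OF th, of x] th(4) unfolding ennreal_Q[symmetric] by (subst (asm) ennreal_le_iff) auto

lemma Q_meas [measurable]: "Q \<in> borel_measurable borel"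
proof -
  interpret H: sigma_finite_measure H by (rule sigma_finite_H)
  have "(\<lambda>x. \<integral>\<^sup>+z. ennreal (kexp (x - z)) \<partial>H) \<in> borel_measurable borel"
    by (rule H.borel_measurable_nn_integral) measurable
  then show ?thesis unfolding Q_def by measurable
qed

text \<open>e^x kexp (x - z) is e^z for z \<le> x and 0 beyond, so e^x Q x is the integral of e^z
  over z \<le> x against the renewal measure. The monotonicity serves twice: it makes Q continuous
  outside a countable set, and it is the Tauberian condition that carries the limit from Gaussian
  averages to Q itself.\<close>

lemma exp_Q_mono: assumes "x \<le> y" shows "exp x * Q x \<le> exp y * Q y"
proof -
  have e: "ennreal (exp x * Q x) = (\<integral>\<^sup>+z. ennreal (exp x * kexp (x - z)) \<partial>H)" for x
    by (simp add: ennreal_mult' ennreal_Q kexp_nonneg nn_integral_cmult)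
  have "(\<integral>\<^sup>+z. ennreal (exp x * kexp (x - z)) \<partial>H) \<le> (\<integral>\<^sup>+z. ennreal (exp y * kexp (y - z)) \<partial>H)"
    using assms by (intro nn_integral_mono ennreal_leI) (auto simp: kexp_def exp_add[symmetric])
  then show ?thesis unfolding e[symmetric] by (subst (asm) ennreal_le_iff) (auto simp: Q_nonneg)
qed

lemma integral_exp_k:
  assumes "Re s > 0"
  shows "integrable lborel (\<lambda>u. exp (- s * of_real u) * of_real (kexp (u - z)))"
    "(CLINT u|lborel. exp (- s * of_real u) * of_real (kexp (u - z))) = exp (- s * of_real z) / (1 + s)"
proof -
  let ?w = "1 + s"
  have w: "Re ?w > 0" using assms by simp
  have eq: "exp (- s * of_real u) * of_real (kexp (u - z)) = of_real (exp z) * (if z \<le> u then exp (- ?w * of_real u) else 0)" for u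
    by (auto simp: kexp_def exp_of_real[symmetric] exp_add[symmetric] algebra_simps)
  have AE: "AE u in lborel. (if z \<le> u then exp (- ?w * of_real u) else 0) = indicator {z<..} u *\<^sub>R exp (- ?w * complex_of_real u)"
    using AE_lborel_singleton[of z] by eventually_elim (auto simp: indicator_def)
  have int: "integrable lborel (\<lambda>u. if z \<le> u then exp (- ?w * complex_of_real u) else 0)"
    using exp_tail_integral(1)[OF w, of z] unfolding set_integrable_def
    by (subst integrable_cong_AE[OF _ _ AE]) auto
  then show "integrable lborel (\<lambda>u. exp (- s * of_real u) * of_real (kexp (u - z)))"
    unfolding eq by (rule integrable_mult_right)
  have "(CLINT u|lborel. (if z \<le> u then exp (- ?w * of_real u) else 0)) = exp (- ?w * of_real z) / ?w"
    using exp_tail_integral(2)[OF w, of z] unfolding set_lebesgue_integral_def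
    by (subst integral_cong_AE[OF _ _ AE]) auto
  then show "(CLINT u|lborel. exp (- s * of_real u) * of_real (kexp (u - z))) = exp (- s * of_real z) / (1 + s)"
    unfolding eq by (subst integral_mult_right_zero) (simp add: exp_of_real[symmetric] exp_add[symmetric] algebra_simps)
qed

text \<open>Convolution becomes a product: 1 / (1 + s) from the kernel, and 1 / (1 - F s), the sum
  of the powers of F s, from the renewal measure. Everything converges absolutely because |F s|
  \<le> Fr (Re s) < 1.\<close>

lemma laplace_Q:
  assumes s: "Re s > 0" "integrable \<nu> (\<lambda>x. exp (- Re s * x))" "Fr (Re s) < 1"
  shows "integrable lborel (\<lambda>u. exp (- s * of_real u) * of_real (Q u))"
    and "(CLINT u|lborel. exp (- s * of_real u) * of_real (Q u)) = 1 / ((1 + s) * (1 - F s))"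
proof -
  interpret H: sigma_finite_measure H by (rule sigma_finite_H)
  interpret HL: pair_sigma_finite H lborel by (simp add: pair_sigma_finite_def sigma_finite_H sigma_finite_lborel)
  let ?f = "\<lambda>(z, u). exp (- s * of_real u) * complex_of_real (kexp (u - z))"
  have H0: "integrable H (\<lambda>z. exp (- s * of_real z))"
  proof (rule integrableI_bounded)
    show "(\<integral>\<^sup>+z. ennreal (norm (exp (- s * of_real z))) \<partial>H) < \<infinity>"
      using laplace_H[OF s(2,3)] by simp
  qed measurable
  have f: "integrable (H \<Otimes>\<^sub>M lborel) ?f"
  proof (rule HL.Fubini_integrable)
    have "(LINT u|lborel. norm (?f (z, u))) = exp (- Re s * z) / (1 + Re s)" for z
    proof -
      have "complex_of_real (LINT u|lborel. norm (?f (z, u))) = (CLINT u|lborel. exp (- of_real (Re s) * of_real u) * of_real (kexp (u - z)))"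
        by (subst integral_complex_of_real[symmetric], intro Bochner_Integration.integral_cong)
           (auto simp: norm_mult kexp_nonneg exp_of_real[symmetric])
      also have "\<dots> = complex_of_real (exp (- Re s * z) / (1 + Re s))"
        using s(1) by (subst integral_exp_k) (auto simp: exp_of_real[symmetric])
      finally show ?thesis by (simp only: of_real_eq_iff)
    qed
    then show "integrable H (\<lambda>z. LINT u|lborel. norm (?f (z, u)))"
      using integrable_norm[OF H0] by simp
    show "AE z in H. integrable lborel (\<lambda>u. ?f (z, u))"
      using integral_exp_k(1)[OF s(1)] by simp
  qed measurable
  have inner: "(CLINT z|H. ?f (z, u)) = exp (- s * of_real u) * of_real (Q u)" for u
  proof -
    have "(LINT z|H. kexp (u - z)) = Q u"
      unfolding Q_def by (rule integral_eq_nn_integral) (auto simp: kexp_nonneg)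
    then have "(CLINT z|H. complex_of_real (kexp (u - z))) = of_real (Q u)"
      by (simp only: integral_complex_of_real)
    then show ?thesis by simp
  qed
  show "integrable lborel (\<lambda>u. exp (- s * of_real u) * of_real (Q u))"
    using HL.integrable_snd[OF f] by (simp only: inner[unfolded prod.case])
  have "(CLINT u|lborel. exp (- s * of_real u) * of_real (Q u)) = (CLINT z|H. CLINT u|lborel. ?f (z, u))"
    using HL.Fubini_integral[OF f] by (simp only: inner[unfolded prod.case] prod.case)
  also have "\<dots> = (CLINT z|H. exp (- s * of_real z)) / (1 + s)"
    using integral_exp_k(2)[OF s(1)] by simp
  also have "(CLINT z|H. exp (- s * of_real z)) = 1 / (1 - F s)"
  proof -
    have "(\<lambda>n. F s ^ n) sums (CLINT z|H. exp (- s * of_real z))"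
      using sums_renewal_measure[OF P.sigma_finite_measure_axioms X_meas H0]
      by (simp add: S_def[symmetric] expectation_exp_S(1)[OF s(2), simplified])
    moreover have "(\<lambda>n. F s ^ n) sums (1 / (1 - F s))"
      using cmod_F_le[of s] s(3) by (intro geometric_sums) simp
    ultimately show ?thesis by (rule sums_unique2)
  qed
  finally show "(CLINT u|lborel. exp (- s * of_real u) * of_real (Q u)) = 1 / ((1 + s) * (1 - F s))" by simp
qed

end

section \<open>Expectations over B and the truncated moment\<close>

context regvar_tail begin

lemma fubini_B:
  fixes \<Psi> :: "real \<Rightarrow> real \<Rightarrow> real"
  assumes \<Psi> [measurable]: "(\<lambda>(y, b). \<Psi> y b) \<in> borel_measurable (borel \<Otimes>\<^sub>M borel)" and K: "\<And>y b. y < w \<Longrightarrow> \<bar>\<Psi> y b\<bar> \<le> K"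
  shows "(LINT y:{..<w}|lborel. exp (\<alpha> * y) * expectation (\<lambda>\<omega>. \<Psi> y (B \<omega>)))
      = expectation (\<lambda>\<omega>. LINT y:{..<w}|lborel. exp (\<alpha> * y) * \<Psi> y (B \<omega>))"
    and "integrable M (\<lambda>\<omega>. LINT y:{..<w}|lborel. exp (\<alpha> * y) * \<Psi> y (B \<omega>))"
proof -
  interpret LM: pair_sigma_finite lborel M
    by (simp add: pair_sigma_finite_def sigma_finite_lborel sigma_finite_measure_axioms)
  let ?f = "\<lambda>(y, \<omega>). indicat_real {..<w} y *\<^sub>R (exp (\<alpha> * y) * \<Psi> y (B \<omega>))"
  have \<Psi>B [measurable]: "(\<lambda>p. \<Psi> (fst p) (B (snd p))) \<in> borel_measurable (lborel \<Otimes>\<^sub>M M)"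
  proof -
    have "(\<lambda>p. (fst p, B (snd p))) \<in> lborel \<Otimes>\<^sub>M M \<rightarrow>\<^sub>M borel \<Otimes>\<^sub>M borel" by measurable
    from measurable_compose[OF this \<Psi>] show ?thesis by (simp add: case_prod_beta)
  qed
  have K0: "0 \<le> K" using K[of "w - 1" 0] by simp
  have fm: "?f \<in> borel_measurable (lborel \<Otimes>\<^sub>M M)"
    unfolding case_prod_beta by measurable
  have i0: "integrable lborel (\<lambda>y. indicat_real {..<w} y *\<^sub>R (exp (\<alpha> * y) * K))"
    using set_integrable_mult_left[OF exp_left_tail(1)[OF \<alpha>, of w], of K] unfolding set_integrable_def .
  have bd: "\<bar>?f (y, \<omega>)\<bar> \<le> indicat_real {..<w} y *\<^sub>R (exp (\<alpha> * y) * K)" for y \<omega>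
    using K[of y "B \<omega>"] by (auto simp: indicator_def abs_mult)
  have f\<omega>: "integrable M (\<lambda>\<omega>. ?f (y, \<omega>))" for y
    by (rule integrable_const_bound[OF AE_I2[of _ "\<lambda>\<omega>. norm (?f (y, \<omega>)) \<le> indicat_real {..<w} y *\<^sub>R (exp (\<alpha> * y) * K)"]])
       (use bd[of y] in \<open>auto intro!: measurable_Pair2[OF fm, of y, unfolded prod.case]\<close>)
  have fi: "integrable (lborel \<Otimes>\<^sub>M M) ?f"
  proof (rule LM.Fubini_integrable[OF fm])
    show "integrable lborel (\<lambda>y. LINT \<omega>|M. norm (?f (y, \<omega>)))"
    proof (rule Bochner_Integration.integrable_bound[OF i0])
      show "(\<lambda>y. LINT \<omega>|M. norm (?f (y, \<omega>))) \<in> borel_measurable lborel"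
        using fm by measurable
      have "(LINT \<omega>|M. norm (?f (y, \<omega>))) \<le> (LINT \<omega>|M. indicat_real {..<w} y *\<^sub>R (exp (\<alpha> * y) * K))" for y
        using bd[of y] integrable_norm[OF f\<omega>[of y]] by (intro integral_mono) auto
      moreover have "0 \<le> (LINT \<omega>|M. norm (?f (y, \<omega>)))" for y by (rule integral_nonneg_AE) simp
      ultimately show "AE y in lborel. norm (LINT \<omega>|M. norm (?f (y, \<omega>))) \<le> norm (indicat_real {..<w} y *\<^sub>R (exp (\<alpha> * y) * K))"
        using K0 by (intro AE_I2) (simp add: prob_space abs_of_nonneg)
    qed
    show "AE y in lborel. integrable M (\<lambda>\<omega>. ?f (y, \<omega>))" using f\<omega> by (intro AE_I2)
  qed
  show "integrable M (\<lambda>\<omega>. LINT y:{..<w}|lborel. exp (\<alpha> * y) * \<Psi> y (B \<omega>))"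
    unfolding set_lebesgue_integral_def using LM.integrable_snd[OF fi] .
  have "(LINT y:{..<w}|lborel. exp (\<alpha> * y) * expectation (\<lambda>\<omega>. \<Psi> y (B \<omega>))) = (LINT y|lborel. LINT \<omega>|M. ?f (y, \<omega>))"
    unfolding set_lebesgue_integral_def by simp
  also have "\<dots> = (LINT \<omega>|M. LINT y|lborel. ?f (y, \<omega>))"
    using LM.Fubini_integral[OF fi] by simp
  finally show "(LINT y:{..<w}|lborel. exp (\<alpha> * y) * expectation (\<lambda>\<omega>. \<Psi> y (B \<omega>)))
      = expectation (\<lambda>\<omega>. LINT y:{..<w}|lborel. exp (\<alpha> * y) * \<Psi> y (B \<omega>))"
    unfolding set_lebesgue_integral_def by simp
qed

text \<open>b^\<alpha> is the integral of \<alpha> e^{\<alpha>y} over y < ln b. Fubini turns the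
  expectation into the integral of \<alpha> e^{\<alpha>y} (P y - P x) over y < x, and the P x part
  integrates to l x.\<close>

lemma truncated_moment:
  shows "integrable M (\<lambda>\<omega>. if 0 < B \<omega> \<and> B \<omega> \<le> exp x then B \<omega> powr \<alpha> else 0)"
    and "expectation (\<lambda>\<omega>. if 0 < B \<omega> \<and> B \<omega> \<le> exp x then B \<omega> powr \<alpha> else 0) = \<alpha> * \<Lambda> x - l x"
proof -
  let ?\<Psi> = "\<lambda>y b. (if exp y < b \<and> b \<le> exp x then \<alpha> else 0) :: real"
  have m: "(\<lambda>(y, b). ?\<Psi> y b) \<in> borel_measurable (borel \<Otimes>\<^sub>M borel)" by measurable
  note fub = fubini_B[OF m, of x \<alpha>]
  have inner: "(LINT y:{..<x}|lborel. exp (\<alpha> * y) * ?\<Psi> y b) = (if 0 < b \<and> b \<le> exp x then b powr \<alpha> else 0)" for b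
  proof (cases "0 < b \<and> b \<le> exp x")
    case True
    then have lx: "ln b \<le> x" using ln_le_cancel_iff[of b "exp x"] by simp
    have "exp y < b \<longleftrightarrow> y < ln b" for y using True by (metis exp_less_cancel_iff exp_ln)
    then have "(LINT y:{..<x}|lborel. exp (\<alpha> * y) * ?\<Psi> y b) = (LINT y:{..<ln b}|lborel. exp (\<alpha> * y) * \<alpha>)"
      unfolding set_lebesgue_integral_def using True lx
      by (intro Bochner_Integration.integral_cong) (auto simp: indicator_def)
    also have "\<dots> = b powr \<alpha>"
      using True \<alpha> by (subst set_integral_mult_left) (simp add: exp_left_tail(2)[OF \<alpha>] powr_def)
    finally show ?thesis using True by simp
  next
    case False
    have "?\<Psi> y b = 0" for y using False less_trans[OF exp_gt_zero[of y], of b] by auto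
    then show ?thesis using False by simp
  qed
  show "integrable M (\<lambda>\<omega>. if 0 < B \<omega> \<and> B \<omega> \<le> exp x then B \<omega> powr \<alpha> else 0)"
    using fub(2) \<alpha> by (simp add: inner)
  have ex: "expectation (\<lambda>\<omega>. ?\<Psi> y (B \<omega>)) = \<alpha> * (P y - P x)" if "y < x" for y
  proof -
    have "expectation (\<lambda>\<omega>. ?\<Psi> y (B \<omega>)) = expectation (\<lambda>\<omega>. \<alpha> * (indicator {\<omega> \<in> space M. exp y < B \<omega>} \<omega> - indicator {\<omega> \<in> space M. exp x < B \<omega>} \<omega>))"
    proof (intro Bochner_Integration.integral_cong refl)
      fix \<omega> assume "\<omega> \<in> space M"
      moreover have "exp y < B \<omega>" if "exp x < B \<omega>" 
        using less_trans[of "exp y" "exp x" "B \<omega>"] \<open>y < x\<close> that by simp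
      ultimately show "?\<Psi> y (B \<omega>) = \<alpha> * (indicator {\<omega> \<in> space M. exp y < B \<omega>} \<omega> - indicator {\<omega> \<in> space M. exp x < B \<omega>} \<omega>)"
        by (auto simp: indicator_def)
    qed
    also have "\<dots> = \<alpha> * (P y - P x)"
      unfolding P_def by (subst integral_mult_right_zero, subst Bochner_Integration.integral_diff)
        (auto simp: less_top[symmetric] intro!: integrable_real_indicator)
    finally show ?thesis .
  qed
  have li: "set_integrable lborel {..<x} (\<lambda>y. \<alpha> * l y)" using l_integrable[of x] by (intro set_integrable_mult_right)
  have ei: "set_integrable lborel {..<x} (\<lambda>y. exp (\<alpha> * y) * (\<alpha> * P x))"
    using exp_left_tail(1)[OF \<alpha>, of x] by (intro set_integrable_mult_left)
  have "(LINT y:{..<x}|lborel. exp (\<alpha> * y) * expectation (\<lambda>\<omega>. ?\<Psi> y (B \<omega>))) = (LINT y:{..<x}|lborel. \<alpha> * l y - exp (\<alpha> * y) * (\<alpha> * P x))"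
    by (intro set_lebesgue_integral_cong) (auto simp: ex l_def algebra_simps)
  also have "\<dots> = (LINT y:{..<x}|lborel. \<alpha> * l y) - (LINT y:{..<x}|lborel. exp (\<alpha> * y) * (\<alpha> * P x))"
    by (rule set_integral_diff(2)[OF li ei])
  also have "\<dots> = \<alpha> * \<Lambda> x - exp (\<alpha> * x) / \<alpha> * (\<alpha> * P x)"
    by (subst set_integral_mult_right, subst set_integral_mult_left) (simp add: \<Lambda>_def exp_left_tail(2)[OF \<alpha>])
  also have "\<dots> = \<alpha> * \<Lambda> x - l x" using \<alpha> by (simp add: l_def)
  finally show "expectation (\<lambda>\<omega>. if 0 < B \<omega> \<and> B \<omega> \<le> exp x then B \<omega> powr \<alpha> else 0) = \<alpha> * \<Lambda> x - l x"
    using fub(1) \<alpha> by (simp add: inner)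
qed

end

locale regvar_admissible = regvar_tail M B L \<alpha> + A: admissible_fun \<alpha> c g
  for M :: "'a measure" and B L \<alpha> c g
begin

lemma Gk_\<kappa>_bound: "\<bar>Gk A.\<kappa> y\<bar> \<le> (A.sg + c) * l y"
  by (rule Gk_bound(3)) (auto intro: A.\<kappa>_le A.\<kappa>_zero)

lemma Gk_g_bound: "\<bar>Gk g y\<bar> \<le> A.sg * l y"
  by (rule Gk_bound(3)) (auto intro: A.g_le A.g_zero)

lemma Gk_\<kappa>_meas [measurable]: "Gk A.\<kappa> \<in> borel_measurable borel"
  by (rule Gk_meas) simp

lemma Gk_conv: "Gk g w = (LINT y|lborel. kexp (w - y) * Gk A.\<kappa> y)"
proof -
  have m: "(\<lambda>(y, b). exp (- (w - y)) * A.\<kappa> (exp (- y) * b)) \<in> borel_measurable (borel \<Otimes>\<^sub>M borel)" by measurable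
  have bd: "\<bar>exp (- (w - y)) * A.\<kappa> (exp (- y) * b)\<bar> \<le> A.sg + c" if "y < w" for y b
  proof -
    have "exp (- (w - y)) * \<bar>A.\<kappa> (exp (- y) * b)\<bar> \<le> 1 * (A.sg + c)"
      using that A.\<kappa>_le by (intro mult_mono) auto
    then show ?thesis by (simp add: abs_mult)
  qed
  \<comment> \<open>\<open>kexp\<close> is closed at 0 while the set y < w is open; the two differ
    at the null point y = w.\<close>
  have AE: "AE y in lborel. kexp (w - y) * Gk A.\<kappa> y = indicator {..<w} y *\<^sub>R (exp (\<alpha> * y) * expectation (\<lambda>\<omega>. exp (- (w - y)) * A.\<kappa> (exp (- y) * B \<omega>)))"
    using AE_lborel_singleton[of w] by eventually_elim (auto simp: indicator_def kexp_def Gk_def)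
  have "(LINT y|lborel. kexp (w - y) * Gk A.\<kappa> y) = (LINT y:{..<w}|lborel. exp (\<alpha> * y) * expectation (\<lambda>\<omega>. exp (- (w - y)) * A.\<kappa> (exp (- y) * B \<omega>)))"
    unfolding set_lebesgue_integral_def by (rule integral_cong_AE[OF _ _ AE]) measurable
  also have "\<dots> = expectation (\<lambda>\<omega>. LINT y:{..<w}|lborel. exp (\<alpha> * y) * (exp (- (w - y)) * A.\<kappa> (exp (- y) * B \<omega>)))"
    by (rule fubini_B(1)[OF m bd])
  also have "\<dots> = expectation (\<lambda>\<omega>. exp (\<alpha> * w) * g (exp (- w) * B \<omega>))"
    unfolding A.conv_pointwise[symmetric] by (simp add: mult.left_commute)
  also have "\<dots> = Gk g w" unfolding Gk_def by (rule integral_mult_right_zero)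
  finally show ?thesis ..
qed

text \<open>Integrating K for fixed b leaves U plus a boundary term. On 0 < B \<le> e^x, U is
  \<gamma> B^\<alpha>, with expectation given by \<open>truncated_moment\<close>; on B > e^x it is
  at most sg / \<alpha> times e^{\<alpha>x}. The constant adds sg / \<alpha> for that event, sg /
  \<alpha> for \<gamma> l x and sg for the boundary term.\<close>

lemma Gk_integral: "\<bar>(LINT y:{..<x}|lborel. Gk A.\<kappa> y) - \<alpha> * A.\<gamma> * \<Lambda> x\<bar> \<le> A.sg * (1 + 2 / \<alpha>) * l x"
proof -
  have m: "(\<lambda>(y, b). A.\<kappa> (exp (- y) * b)) \<in> borel_measurable (borel \<Otimes>\<^sub>M borel)" by measurable
  note fub = fubini_B[OF m A.\<kappa>_le, of x]
  have gi: "integrable M (\<lambda>\<omega>. exp (\<alpha> * x) * g (exp (- x) * B \<omega>))"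
    by (intro integrable_mult_right Gk_bound(1)) (auto intro: A.g_le A.g_zero)
  have k: "(LINT y:{..<x}|lborel. exp (\<alpha> * y) * A.\<kappa> (exp (- y) * b)) = A.U x b + exp (\<alpha> * x) * g (exp (- x) * b)" for b
    unfolding A.\<kappa>_integral A.U_def ..
  have Ui: "integrable M (\<lambda>\<omega>. A.U x (B \<omega>))"
    using Bochner_Integration.integrable_diff[OF fub(2) gi] unfolding k by simp
  have 1: "(LINT y:{..<x}|lborel. Gk A.\<kappa> y) = expectation (\<lambda>\<omega>. A.U x (B \<omega>)) + Gk g x"
    unfolding Gk_def fub(1) k by (subst Bochner_Integration.integral_add[OF Ui gi]) simp
  let ?T = "\<lambda>\<omega>. if 0 < B \<omega> \<and> B \<omega> \<le> exp x then B \<omega> powr \<alpha> else 0"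
  have "\<bar>expectation (\<lambda>\<omega>. A.U x (B \<omega>)) - expectation (\<lambda>\<omega>. A.\<gamma> * ?T \<omega>)\<bar> = \<bar>expectation (\<lambda>\<omega>. A.U x (B \<omega>) - A.\<gamma> * ?T \<omega>)\<bar>"
    by (subst Bochner_Integration.integral_diff[OF Ui integrable_mult_right[OF truncated_moment(1)]]) simp
  also have "\<dots> \<le> expectation (\<lambda>\<omega>. (A.sg / \<alpha> * exp (\<alpha> * x)) * indicator {\<omega> \<in> space M. exp x < B \<omega>} \<omega>)"
  proof (rule order_trans[OF integral_abs_bound integral_mono])
    show "integrable M (\<lambda>\<omega>. \<bar>A.U x (B \<omega>) - A.\<gamma> * ?T \<omega>\<bar>)"
      by (intro integrable_abs Bochner_Integration.integrable_diff Ui integrable_mult_right truncated_moment(1))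
    show "integrable M (\<lambda>\<omega>. (A.sg / \<alpha> * exp (\<alpha> * x)) * indicat_real {\<omega> \<in> space M. exp x < B \<omega>} \<omega>)"
      by (intro integrable_mult_right integrable_real_indicator) (auto simp: less_top[symmetric])
    fix \<omega> assume w: "\<omega> \<in> space M"
    show "\<bar>A.U x (B \<omega>) - A.\<gamma> * ?T \<omega>\<bar> \<le> (A.sg / \<alpha> * exp (\<alpha> * x)) * indicat_real {\<omega> \<in> space M. exp x < B \<omega>} \<omega>"
    proof (cases "exp x < B \<omega>")
      case True
      then show ?thesis using A.U_le[of x "B \<omega>"] w by simp
    next
      case False
      then show ?thesis using A.U_nonpos[of "B \<omega>" x] A.U_small[of "B \<omega>" x] by (cases "0 < B \<omega>") auto
    qed
  qed
  also have "\<dots> = A.sg / \<alpha> * l x" by (simp add: l_def P_def)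
  finally have 2: "\<bar>expectation (\<lambda>\<omega>. A.U x (B \<omega>)) - A.\<gamma> * (\<alpha> * \<Lambda> x - l x)\<bar> \<le> A.sg / \<alpha> * l x"
    by (simp only: integral_mult_right_zero truncated_moment(2))
  have 3: "\<bar>A.\<gamma> * l x\<bar> \<le> A.sg / \<alpha> * l x"
    using mult_right_mono[OF A.\<gamma>_le, of "l x"] l_pos[of x] by (simp add: abs_mult)
  have "(LINT y:{..<x}|lborel. Gk A.\<kappa> y) - \<alpha> * A.\<gamma> * \<Lambda> x =
     (expectation (\<lambda>\<omega>. A.U x (B \<omega>)) - A.\<gamma> * (\<alpha> * \<Lambda> x - l x)) - A.\<gamma> * l x + Gk g x"
    unfolding 1 by (simp add: algebra_simps)
  also have "\<bar>\<dots>\<bar> \<le> A.sg / \<alpha> * l x + A.sg / \<alpha> * l x + A.sg * l x"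
  proof -
    have tri: "\<bar>a - b + d\<bar> \<le> \<bar>a\<bar> + \<bar>b\<bar> + \<bar>d\<bar>" for a b d :: real by arith
    show ?thesis by (rule order_trans[OF tri]) (intro add_mono 2 3 Gk_g_bound)
  qed
  also have "\<dots> = A.sg * (1 + 2 / \<alpha>) * l x" using \<alpha> by (simp add: field_simps)
  finally show ?thesis .
qed

end

section \<open>The renewal integral as a convolution with q\<close>

locale renewal_setting = W: drift_walk \<nu> \<theta>0 M X + R: regvar_tail M B L \<alpha>
  for \<nu> \<theta>0 M X B L \<alpha>
begin

definition q :: "real \<Rightarrow> real" where "q u = W.Q u - (if 0 < u then 1 / W.m else 0)"

lemma q_meas [measurable]: "q \<in> borel_measurable borel"
  unfolding q_def by measurable

lemma q_abs_le: "\<bar>q u\<bar> \<le> W.Q u + (if 0 < u then 1 / W.m else 0)"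
  unfolding q_def by (rule order_trans[OF abs_triangle_ineq4]) (use W.Q_nonneg[of u] W.m_pos in auto)

text \<open>Potter's bound asks for a base point beyond y0 but allows every displacement, so basing
  it at y0 itself yields a global bound.\<close>

lemma l_global: "\<eta> > 0 \<Longrightarrow> \<exists>C. \<forall>y. R.l y \<le> C * exp (\<eta> * \<bar>y\<bar>)"
proof -
  assume \<eta>: "\<eta> > 0"
  obtain K y0 where K: "0 < K" "\<And>x z. x \<ge> y0 \<Longrightarrow> R.l (x + z) \<le> K * R.l x * exp (\<eta> * \<bar>z\<bar>)"
    using R.potter[OF \<eta>] by blast
  have "R.l y \<le> (K * R.l y0 * exp (\<eta> * \<bar>y0\<bar>)) * exp (\<eta> * \<bar>y\<bar>)" for y
  proof -
    have "R.l y \<le> K * R.l y0 * exp (\<eta> * \<bar>y - y0\<bar>)" using K(2)[of y0 "y - y0"] by simp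
    also have "\<dots> \<le> K * R.l y0 * exp (\<eta> * \<bar>y0\<bar> + \<eta> * \<bar>y\<bar>)"
    proof -
      have "\<eta> * \<bar>y - y0\<bar> \<le> \<eta> * (\<bar>y0\<bar> + \<bar>y\<bar>)" using \<eta> by (intro mult_left_mono) auto
      then show ?thesis using K(1) R.l_pos[of y0] by (intro mult_left_mono) (auto simp: algebra_simps)
    qed
    finally show ?thesis by (simp add: exp_add mult_ac)
  qed
  then show ?thesis by blast
qed

text \<open>At plus infinity Q (x - y) is at most a multiple of e^{-\<theta>y} while
  \<open>l\<close> grows at most like e^{\<theta>y/2}; at minus infinity l y \<le> e^{\<alpha>y}
  beats e^{-\<theta>y}, which is why \<theta> is taken below \<alpha>.\<close>

lemma integrable_l_Q: "integrable lborel (\<lambda>y. R.l y * W.Q (x - y))"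
proof -
  obtain \<theta>1 where t1: "0 < \<theta>1" "\<theta>1 \<le> \<theta>0" "\<And>\<theta>. 0 < \<theta> \<and> \<theta> \<le> \<theta>1 \<Longrightarrow> W.Fr \<theta> < 1" using W.Fr_less_1 by blast
  define \<theta> where "\<theta> = min (min \<theta>1 1) (\<alpha> / 2)"
  have th: "0 < \<theta>" "\<theta> \<le> 1" "\<theta> \<le> \<theta>1" "\<theta> < \<alpha>" using t1(1) R.\<alpha> by (auto simp: \<theta>_def)
  have Qb: "W.Q u \<le> exp (\<theta> * u) * (1 / (1 - W.Fr \<theta>))" for u
    using th t1 by (intro W.Q_bound W.integrable_exp_right) auto
  define D where "D = 1 / (1 - W.Fr \<theta>)"
  have D: "D > 0" using t1(3)[of \<theta>] th by (simp add: D_def)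
  obtain C where C: "\<And>y. R.l y \<le> C * exp (\<theta> / 2 * \<bar>y\<bar>)" using l_global[of "\<theta> / 2"] th by auto
  have C0: "C > 0" using less_le_trans[OF R.l_pos C, of 0] by simp
  \<comment> \<open>The half-line starts at -1 so that the open set contains y = 0.\<close>
  have Ip: "integrable lborel (\<lambda>y. indicat_real {-1<..} y *\<^sub>R exp (- (\<theta> / 2) * y))"
    using exp_tail_integral_real(1)[of "\<theta> / 2" "-1"] th unfolding set_integrable_def by simp
  have In: "integrable lborel (\<lambda>y. indicat_real {..<0} y *\<^sub>R exp ((\<alpha> - \<theta>) * y))"
    using exp_left_tail(1)[of "\<alpha> - \<theta>" 0] th unfolding set_integrable_def by simp
  show ?thesis
  proof (rule Bochner_Integration.integrable_bound)
    show "integrable lborel (\<lambda>y. (exp (\<theta> * x) * D) * (C * (indicat_real {-1<..} y *\<^sub>R exp (- (\<theta> / 2) * y)) + indicat_real {..<0} y *\<^sub>R exp ((\<alpha> - \<theta>) * y)))"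
      by (intro integrable_mult_right Bochner_Integration.integrable_add Ip In)
    show "AE y in lborel. norm (R.l y * W.Q (x - y)) \<le> norm ((exp (\<theta> * x) * D) * (C * (indicat_real {-1<..} y *\<^sub>R exp (- (\<theta> / 2) * y)) + indicat_real {..<0} y *\<^sub>R exp ((\<alpha> - \<theta>) * y)))"
    proof (intro AE_I2)
      fix y :: real
      let ?b = "C * (indicat_real {-1<..} y *\<^sub>R exp (- (\<theta> / 2) * y)) + indicat_real {..<0} y *\<^sub>R exp ((\<alpha> - \<theta>) * y)"
      have b0: "0 \<le> ?b" using C0 by (auto simp: indicator_def)
      have "R.l y * exp (- \<theta> * y) \<le> ?b"
      proof (cases "y \<ge> 0")
        case True
        have "R.l y * exp (- \<theta> * y) \<le> C * exp (\<theta> / 2 * \<bar>y\<bar>) * exp (- \<theta> * y)" using C by (intro mult_right_mono) auto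
        also have "\<dots> = C * exp (- (\<theta> / 2) * y)" using True by (simp add: mult.assoc exp_add[symmetric])
        finally show ?thesis using True by simp
      next
        case False
        have "R.l y * exp (- \<theta> * y) \<le> exp (\<alpha> * y) * exp (- \<theta> * y)" using R.l_le by (intro mult_right_mono) auto
        also have "\<dots> = exp ((\<alpha> - \<theta>) * y)" by (simp add: exp_add[symmetric] algebra_simps)
        also have "\<dots> \<le> ?b" using False C0 by (auto simp: indicator_def)
        finally show ?thesis .
      qed
      then have "(exp (\<theta> * x) * D) * (R.l y * exp (- \<theta> * y)) \<le> (exp (\<theta> * x) * D) * ?b"
        using D by (intro mult_left_mono) auto
      moreover have "R.l y * W.Q (x - y) \<le> R.l y * (exp (\<theta> * (x - y)) * D)"
        using Qb[of "x - y"] R.l_pos[of y] unfolding D_def by (intro mult_left_mono) auto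
      moreover have "R.l y * (exp (\<theta> * (x - y)) * D) = (exp (\<theta> * x) * D) * (R.l y * exp (- \<theta> * y))"
        by (simp add: exp_diff exp_minus field_simps)
      ultimately have "R.l y * W.Q (x - y) \<le> (exp (\<theta> * x) * D) * ?b" by linarith
      moreover have "0 \<le> R.l y * W.Q (x - y)" using R.l_pos[of y] W.Q_nonneg by (simp add: less_imp_le)
      ultimately show "norm (R.l y * W.Q (x - y)) \<le> norm ((exp (\<theta> * x) * D) * ?b)" by simp
    qed
  qed measurable
qed

lemma integrable_l_q: "integrable lborel (\<lambda>y. R.l y * \<bar>q (x - y)\<bar>)"
proof (rule Bochner_Integration.integrable_bound)
  show "integrable lborel (\<lambda>y. R.l y * W.Q (x - y) + (1 / W.m) * (indicat_real {..<x} y *\<^sub>R R.l y))"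
    using integrable_l_Q R.l_integrable[of x] unfolding set_integrable_def by auto
  have "R.l y * \<bar>q (x - y)\<bar> \<le> R.l y * W.Q (x - y) + (1 / W.m) * (indicat_real {..<x} y *\<^sub>R R.l y)" for y
  proof -
    have "\<bar>q (x - y)\<bar> \<le> W.Q (x - y) + (1 / W.m) * indicat_real {..<x} y"
      using q_abs_le[of "x - y"] by (auto simp: indicator_def)
    then have "R.l y * \<bar>q (x - y)\<bar> \<le> R.l y * (W.Q (x - y) + (1 / W.m) * indicat_real {..<x} y)"
      using R.l_pos[of y] by (intro mult_left_mono) auto
    then show ?thesis by (simp add: algebra_simps)
  qed
  from order_trans[OF this abs_ge_self] R.l_pos
  have "norm (R.l y * \<bar>q (x - y)\<bar>) \<le> norm (R.l y * W.Q (x - y) + (1 / W.m) * (indicat_real {..<x} y *\<^sub>R R.l y))" for y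
    unfolding real_norm_def by (subst abs_of_nonneg) (auto simp: less_imp_le)
  then show "AE y in lborel. norm (R.l y * \<bar>q (x - y)\<bar>) \<le> norm (R.l y * W.Q (x - y) + (1 / W.m) * (indicat_real {..<x} y *\<^sub>R R.l y))"
    by (intro AE_I2)
qed measurable

text \<open>The error is measured by a quantity in which g does not occur; the uniformity over all
  admissible g in the second claim comes from this.\<close>

definition err :: "real \<Rightarrow> real" where "err x = (LINT y|lborel. R.l y * \<bar>q (x - y)\<bar>)"

lemma err_eq: "err x = (LINT u|lborel. R.l (x - u) * \<bar>q u\<bar>)"
  and integrable_err: "integrable lborel (\<lambda>u. R.l (x - u) * \<bar>q u\<bar>)"
proof -
  show "err x = (LINT u|lborel. R.l (x - u) * \<bar>q u\<bar>)"
    unfolding err_def using lborel_integral_real_affine[of "-1" "\<lambda>y. R.l y * \<bar>q (x - y)\<bar>" x] by simp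
  show "integrable lborel (\<lambda>u. R.l (x - u) * \<bar>q u\<bar>)"
    using lborel_integrable_real_affine[OF integrable_l_q, of "-1" x x] by simp
qed

text \<open>Fubini moves the exponential kernel from K onto the renewal measure, leaving the
  integral of K y Q (x - y). The step part of Q produces the integral of K up to x, handled by
  \<open>Gk_integral\<close>, and q contributes at most (sg + c) times \<open>err x\<close>.\<close>

lemma main_estimate:
  assumes adm: "admissible \<alpha> c g"
  shows "integrable W.H (renewal_integrand M B \<alpha> g x)"
    and "\<bar>(LINT z|W.H. renewal_integrand M B \<alpha> g x z) - \<alpha> / W.m * R.\<Lambda> x * (LINT r:{1..}|lborel. g r * r powr (- \<alpha> - 1))\<bar>
      \<le> ((SUP r. \<bar>g r\<bar>) + c) * err x + (SUP r. \<bar>g r\<bar>) * (1 + 2 / \<alpha>) / W.m * R.l x"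
proof -
  interpret A: regvar_admissible M B L \<alpha> c g
    by unfold_locales (rule R.\<alpha> adm)+
  have I: "renewal_integrand M B \<alpha> g x = (\<lambda>z. R.Gk g (x - z))"
    by (auto simp: renewal_integrand_def R.Gk_def fun_eq_iff)
  interpret HL: pair_sigma_finite W.H lborel
    by (simp add: pair_sigma_finite_def W.sigma_finite_H sigma_finite_lborel)
  interpret LH: pair_sigma_finite lborel W.H
    by (simp add: pair_sigma_finite_def W.sigma_finite_H sigma_finite_lborel)
  let ?J = "R.Gk A.A.\<kappa>"
  let ?f = "\<lambda>(z, y). kexp (x - z - y) * ?J y"
  have fm: "?f \<in> borel_measurable (W.H \<Otimes>\<^sub>M lborel)" by measurable
  have kQ: "(LINT z|W.H. kexp (x - z - y)) = W.Q (x - y)" for y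
    unfolding W.Q_def by (subst integral_eq_nn_integral) (auto simp: kexp_nonneg algebra_simps)
  have ki: "integrable W.H (\<lambda>z. kexp (x - z - y))" for y
  proof (rule integrableI_nonneg)
    have "(\<integral>\<^sup>+z. ennreal (kexp (x - z - y)) \<partial>W.H) = ennreal (W.Q (x - y))"
      unfolding W.ennreal_Q by (simp add: algebra_simps)
    then show "(\<integral>\<^sup>+z. ennreal (kexp (x - z - y)) \<partial>W.H) < \<infinity>" by simp
  qed (auto simp: kexp_nonneg)
  have c0: "0 \<le> A.A.sg + c" using A.A.sg_nonneg A.A.c_nonneg by simp
  have JQ: "integrable lborel (\<lambda>y. \<bar>?J y\<bar> * W.Q (x - y))"
  proof (rule Bochner_Integration.integrable_bound)
    show "integrable lborel (\<lambda>y. (A.A.sg + c) * (R.l y * W.Q (x - y)))"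
      using integrable_l_Q by (rule integrable_mult_right)
    have "\<bar>?J y\<bar> * W.Q (x - y) \<le> (A.A.sg + c) * R.l y * W.Q (x - y)" for y
      using A.Gk_\<kappa>_bound W.Q_nonneg by (intro mult_right_mono) auto
    then show "AE y in lborel. norm (\<bar>?J y\<bar> * W.Q (x - y)) \<le> norm ((A.A.sg + c) * (R.l y * W.Q (x - y)))"
      using W.Q_nonneg c0 R.l_pos by (intro AE_I2) (simp add: abs_mult mult_ac less_imp_le)
  qed measurable
  have fi: "integrable (W.H \<Otimes>\<^sub>M lborel) ?f"
  proof -
    \<comment> \<open>Absolute integrability is checked with the renewal measure inside, where the
      inner integral is exactly |K y| Q (x - y).\<close>
    have sw: "integrable (lborel \<Otimes>\<^sub>M W.H) (\<lambda>(y, z). ?f (z, y))"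
    proof (rule LH.Fubini_integrable)
      show "(\<lambda>(y, z). ?f (z, y)) \<in> borel_measurable (lborel \<Otimes>\<^sub>M W.H)" by measurable
      have "(LINT z|W.H. norm (?f (z, y))) = \<bar>?J y\<bar> * W.Q (x - y)" for y
        by (simp add: abs_mult kexp_nonneg kQ)
      then show "integrable lborel (\<lambda>y. LINT z|W.H. norm (case (y, z) of (y, z) \<Rightarrow> ?f (z, y)))"
        using JQ by simp
      show "AE y in lborel. integrable W.H (\<lambda>z. case (y, z) of (y, z) \<Rightarrow> ?f (z, y))"
        using ki by simp
    qed
    then show ?thesis using HL.integrable_product_swap_iff[of ?f] by simp
  qed
  have inner1: "(LINT y|lborel. ?f (z, y)) = R.Gk g (x - z)" for z
    unfolding A.Gk_conv by simp
  have inner2: "(LINT z|W.H. ?f (z, y)) = ?J y * W.Q (x - y)" for y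
    by (simp add: kQ)
  show "integrable W.H (renewal_integrand M B \<alpha> g x)"
    unfolding I using HL.integrable_fst'[OF fi] unfolding inner1 .
  have eq: "(LINT z|W.H. renewal_integrand M B \<alpha> g x z) = (LINT y|lborel. ?J y * W.Q (x - y))"
    unfolding I inner1[symmetric] inner2[symmetric] using HL.Fubini_integral[OF fi] by simp
  have Ji: "integrable lborel (\<lambda>y. ?J y * W.Q (x - y))"
    using HL.integrable_snd[OF fi] unfolding inner2[unfolded prod.case] .
  have J1: "integrable lborel (\<lambda>y. indicat_real {..<x} y *\<^sub>R ?J y)"
  proof (rule Bochner_Integration.integrable_bound)
    show "integrable lborel (\<lambda>y. (A.A.sg + c) * (indicat_real {..<x} y *\<^sub>R R.l y))"
      using R.l_integrable[of x] unfolding set_integrable_def by (rule integrable_mult_right)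
    show "AE y in lborel. norm (indicat_real {..<x} y *\<^sub>R ?J y) \<le> norm ((A.A.sg + c) * (indicat_real {..<x} y *\<^sub>R R.l y))"
      using order_trans[OF A.Gk_\<kappa>_bound abs_ge_self] by (intro AE_I2) (auto simp: indicator_def)
  qed measurable
  have dec: "?J y * q (x - y) = ?J y * W.Q (x - y) - (1 / W.m) * (indicat_real {..<x} y *\<^sub>R ?J y)" for y
    by (auto simp: q_def indicator_def algebra_simps)
  have d1: "(LINT y|lborel. ?J y * q (x - y)) = (LINT y|lborel. ?J y * W.Q (x - y)) - (1 / W.m) * (LINT y:{..<x}|lborel. ?J y)"
    unfolding dec set_lebesgue_integral_def
    by (subst Bochner_Integration.integral_diff[OF Ji integrable_mult_right[OF J1]]) simp
  have "\<bar>LINT y|lborel. ?J y * q (x - y)\<bar> \<le> (LINT y|lborel. (A.A.sg + c) * (R.l y * \<bar>q (x - y)\<bar>))"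
  proof (rule order_trans[OF integral_abs_bound integral_mono])
    show "integrable lborel (\<lambda>y. \<bar>?J y * q (x - y)\<bar>)"
      unfolding dec by (intro integrable_abs Bochner_Integration.integrable_diff Ji integrable_mult_right J1)
    show "integrable lborel (\<lambda>y. (A.A.sg + c) * (R.l y * \<bar>q (x - y)\<bar>))"
      using integrable_l_q by (rule integrable_mult_right)
    show "\<bar>?J y * q (x - y)\<bar> \<le> (A.A.sg + c) * (R.l y * \<bar>q (x - y)\<bar>)" for y
      using mult_right_mono[OF A.Gk_\<kappa>_bound[of y], of "\<bar>q (x - y)\<bar>"] by (simp add: abs_mult mult_ac)
  qed
  also have "\<dots> = (A.A.sg + c) * err x" unfolding err_def by (rule integral_mult_right_zero)
  finally have e1: "\<bar>LINT y|lborel. ?J y * q (x - y)\<bar> \<le> (A.A.sg + c) * err x" .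
  have "\<bar>(1 / W.m) * ((LINT y:{..<x}|lborel. ?J y) - \<alpha> * A.A.\<gamma> * R.\<Lambda> x)\<bar> \<le> (1 / W.m) * (A.A.sg * (1 + 2 / \<alpha>) * R.l x)"
    using mult_left_mono[OF A.Gk_integral[of x], of "1 / W.m"] W.m_pos by (simp add: abs_mult)
  then have e2: "\<bar>(1 / W.m) * (LINT y:{..<x}|lborel. ?J y) - \<alpha> / W.m * R.\<Lambda> x * A.A.\<gamma>\<bar> \<le> A.A.sg * (1 + 2 / \<alpha>) / W.m * R.l x"
    by (simp add: algebra_simps add_divide_distrib)
  show "\<bar>(LINT z|W.H. renewal_integrand M B \<alpha> g x z) - \<alpha> / W.m * R.\<Lambda> x * (LINT r:{1..}|lborel. g r * r powr (- \<alpha> - 1))\<bar>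
      \<le> ((SUP r. \<bar>g r\<bar>) + c) * err x + (SUP r. \<bar>g r\<bar>) * (1 + 2 / \<alpha>) / W.m * R.l x"
    unfolding A.A.sg_def[symmetric] A.A.\<gamma>_def[symmetric] eq using d1 e1 e2 by linarith
qed

text \<open>Potter's bound pulls l x out of the convolution at the price of e^{\<eta>|u|}, which the
  weighted integrability of q pays.\<close>

lemma err_fast:
  assumes \<eta>: "\<eta> > 0" and int: "integrable lborel (\<lambda>u. exp (\<eta> * \<bar>u\<bar>) * \<bar>q u\<bar>)"
  shows "\<exists>K. eventually (\<lambda>x. err x \<le> K * R.l x) at_top"
proof -
  obtain K y0 where K: "0 < K" "\<And>x z. x \<ge> y0 \<Longrightarrow> R.l (x + z) \<le> K * R.l x * exp (\<eta> * \<bar>z\<bar>)"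
    using R.potter[OF \<eta>] by blast
  have b: "err x \<le> (K * (LINT u|lborel. exp (\<eta> * \<bar>u\<bar>) * \<bar>q u\<bar>)) * R.l x" if x: "x \<ge> y0" for x
  proof -
    have "err x \<le> (LINT u|lborel. (K * R.l x) * (exp (\<eta> * \<bar>u\<bar>) * \<bar>q u\<bar>))"
      unfolding err_eq
    proof (rule integral_mono[OF integrable_err integrable_mult_right[OF int]])
      fix u
      show "R.l (x - u) * \<bar>q u\<bar> \<le> (K * R.l x) * (exp (\<eta> * \<bar>u\<bar>) * \<bar>q u\<bar>)"
        using mult_right_mono[OF K(2)[OF x, of "- u"], of "\<bar>q u\<bar>"] by (simp add: mult_ac)
    qed
    also have "\<dots> = (K * R.l x) * (LINT u|lborel. exp (\<eta> * \<bar>u\<bar>) * \<bar>q u\<bar>)" by (rule integral_mult_right_zero)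
    finally show ?thesis by (simp add: mult_ac)
  qed
  have "eventually (\<lambda>x. err x \<le> (K * (LINT u|lborel. exp (\<eta> * \<bar>u\<bar>) * \<bar>q u\<bar>)) * R.l x) at_top"
    using eventually_ge_at_top[of y0] by eventually_elim (rule b)
  then show ?thesis by blast
qed

text \<open>For u \<ge> A the factor |q u| is at most \<epsilon>/2, and the remaining integral of l
  (x - u) is at most \<Lambda> x. For u < A Potter's bound gives a constant times l x, which is
  negligible against \<Lambda> x by \<open>l_little_o\<close>.\<close>

lemma err_slow:
  assumes Q: "(W.Q \<longlongrightarrow> 1 / W.m) at_top" and \<epsilon>: "\<epsilon> > 0"
  shows "eventually (\<lambda>x. err x \<le> \<epsilon> * R.\<Lambda> x) at_top"
proof -
  obtain \<theta> where th: "0 < \<theta>" "\<theta> \<le> 1" "integrable \<nu> (\<lambda>x. exp (- \<theta> * x))" "W.Fr \<theta> < 1" by (rule W.obtain_\<theta>)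
  define D where "D = 1 / (1 - W.Fr \<theta>)"
  have D: "D > 0" using th by (simp add: D_def)
  have "eventually (\<lambda>u. \<bar>W.Q u - 1 / W.m\<bar> < \<epsilon> / 2) at_top"
    using tendstoD[OF Q, of "\<epsilon> / 2"] \<epsilon> by (simp add: dist_real_def)
  then obtain A0 where A0: "\<And>u. u \<ge> A0 \<Longrightarrow> \<bar>W.Q u - 1 / W.m\<bar> < \<epsilon> / 2" by (auto simp: eventually_at_top_linorder)
  \<comment> \<open>A \<ge> 1 keeps u positive, so that q u is Q u - 1/m and x - u lies to the left
    of x.\<close>
  define A where "A = max A0 1"
  have A: "A \<ge> 1" "\<And>u. u \<ge> A \<Longrightarrow> \<bar>q u\<bar> \<le> \<epsilon> / 2"
  proof -
    show "A \<ge> 1" by (simp add: A_def)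
    fix u assume "u \<ge> A"
    then have "u \<ge> A0" "u > 0" by (auto simp: A_def)
    then show "\<bar>q u\<bar> \<le> \<epsilon> / 2" using A0[of u] by (simp add: q_def)
  qed
  define C where "C = D + 1 / W.m"
  have C: "C > 0" using D W.m_pos by (simp add: C_def add_pos_pos)
  have qb: "\<bar>q u\<bar> \<le> C * exp (\<theta> * u)" for u
  proof -
    have "W.Q u \<le> exp (\<theta> * u) * D" using W.Q_bound[OF th, of u] by (simp add: D_def)
    moreover have "(if 0 < u then 1 / W.m else 0) \<le> (1 / W.m) * exp (\<theta> * u)"
      using W.m_pos th(1) by (auto simp: divide_right_mono)
    ultimately show ?thesis using q_abs_le[of u] by (simp add: C_def algebra_simps)
  qed
  \<comment> \<open>The Potter exponent \<theta>/2 is half the rate at which q decays at minus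
    infinity, so the product still decays there like e^{\<theta>u/2}.\<close>
  obtain K y0 where K: "0 < K" "\<And>x z. x \<ge> y0 \<Longrightarrow> R.l (x + z) \<le> K * R.l x * exp (\<theta> / 2 * \<bar>z\<bar>)"
    using R.potter[of "\<theta> / 2"] th by auto
  define E where "E = (LINT u:{..<A}|lborel. exp (\<theta> / 2 * u))"
  have Ei: "set_integrable lborel {..<A} (\<lambda>u. exp (\<theta> / 2 * u))" using th by (intro exp_left_tail(1)) auto
  have E: "E = exp (\<theta> / 2 * A) / (\<theta> / 2)" unfolding E_def using th by (intro exp_left_tail(2)) auto
  have E0: "E > 0" unfolding E using th by simp
  define G where "G = K * C * exp (\<theta> * A) * E"
  have G0: "G > 0" using K C E0 by (simp add: G_def)
  have bnd: "err x \<le> \<epsilon> / 2 * R.\<Lambda> x + G * R.l x" if x: "x \<ge> y0" for x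
  proof -
    have li: "integrable lborel (\<lambda>u. indicat_real {..<x} (x - u) *\<^sub>R R.l (x - u))"
      using lborel_integrable_real_affine[OF R.l_integrable[of x, unfolded set_integrable_def], of "-1" x] by simp
    have lv: "(LINT u|lborel. indicat_real {..<x} (x - u) *\<^sub>R R.l (x - u)) = R.\<Lambda> x"
      unfolding R.\<Lambda>_def set_lebesgue_integral_def
      using lborel_integral_real_affine[of "-1" "\<lambda>y. indicat_real {..<x} y *\<^sub>R R.l y" x] by simp
    have ei: "integrable lborel (\<lambda>u. indicat_real {..<A} u *\<^sub>R exp (\<theta> / 2 * u))" using Ei unfolding set_integrable_def .
    have "err x \<le> (LINT u|lborel. \<epsilon> / 2 * (indicat_real {..<x} (x - u) *\<^sub>R R.l (x - u))
        + (K * C * exp (\<theta> * A) * R.l x) * (indicat_real {..<A} u *\<^sub>R exp (\<theta> / 2 * u)))"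
      unfolding err_eq
    proof (rule integral_mono[OF integrable_err])
      show "integrable lborel (\<lambda>u. \<epsilon> / 2 * (indicat_real {..<x} (x - u) *\<^sub>R R.l (x - u))
        + (K * C * exp (\<theta> * A) * R.l x) * (indicat_real {..<A} u *\<^sub>R exp (\<theta> / 2 * u)))"
        by (intro Bochner_Integration.integrable_add integrable_mult_right li ei)
      fix u
      show "R.l (x - u) * \<bar>q u\<bar> \<le> \<epsilon> / 2 * (indicat_real {..<x} (x - u) *\<^sub>R R.l (x - u))
        + (K * C * exp (\<theta> * A) * R.l x) * (indicat_real {..<A} u *\<^sub>R exp (\<theta> / 2 * u))"
      proof (cases "u \<ge> A")
        case True
        then have "R.l (x - u) * \<bar>q u\<bar> \<le> R.l (x - u) * (\<epsilon> / 2)" using A(2) R.l_pos[of "x - u"] by (intro mult_left_mono) auto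
        then show ?thesis using True A(1) by (simp add: mult_ac)
      next
        case False
        have ex: "\<theta> / 2 * \<bar>u\<bar> + \<theta> * u \<le> \<theta> * A + \<theta> / 2 * u"
        proof (cases "u \<ge> 0")
          case True
          have "\<theta> * u \<le> \<theta> * A" using False th by (intro mult_left_mono) auto
          then show ?thesis using True by simp
        next
          case neg: False
          have "0 \<le> \<theta> * A" using th A(1) by simp
          then show ?thesis using neg by simp
        qed
        have "R.l (x - u) * \<bar>q u\<bar> \<le> (K * R.l x * exp (\<theta> / 2 * \<bar>u\<bar>)) * (C * exp (\<theta> * u))"
          using K(2)[OF x, of "- u"] qb[of u] R.l_pos[of "x - u"] K(1) R.l_pos[of x] by (intro mult_mono) auto
        also have "\<dots> = (K * C * R.l x) * exp (\<theta> / 2 * \<bar>u\<bar> + \<theta> * u)" by (simp add: exp_add mult_ac)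
        also have "\<dots> \<le> (K * C * R.l x) * exp (\<theta> * A + \<theta> / 2 * u)"
          using ex K(1) C R.l_pos[of x] by (intro mult_left_mono) auto
        also have "\<dots> = (K * C * exp (\<theta> * A) * R.l x) * (indicat_real {..<A} u *\<^sub>R exp (\<theta> / 2 * u))"
          using False by (simp add: exp_add mult_ac)
        finally have 1: "R.l (x - u) * \<bar>q u\<bar> \<le> (K * C * exp (\<theta> * A) * R.l x) * (indicat_real {..<A} u *\<^sub>R exp (\<theta> / 2 * u))" .
        have "0 \<le> \<epsilon> / 2 * (indicat_real {..<x} (x - u) *\<^sub>R R.l (x - u))"
          using \<epsilon> R.l_pos[of "x - u"] by (simp add: indicator_def)
        from add_mono[OF this 1] show ?thesis by simp
      qed
    qed
    also have "\<dots> = \<epsilon> / 2 * R.\<Lambda> x + (K * C * exp (\<theta> * A) * R.l x) * E"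
      unfolding E_def set_lebesgue_integral_def lv[symmetric] integral_mult_right_zero[symmetric]
      by (rule Bochner_Integration.integral_add) (intro integrable_mult_right li ei)+
    finally show ?thesis by (simp add: G_def mult_ac)
  qed
  have "eventually (\<lambda>x. R.l x \<le> \<epsilon> / (2 * G) * R.\<Lambda> x) at_top"
    using R.l_little_o[of "\<epsilon> / (2 * G)"] \<epsilon> G0 by simp
  then show ?thesis using eventually_ge_at_top[of y0]
  proof eventually_elim
    case (elim x)
    have "G * R.l x \<le> G * (\<epsilon> / (2 * G) * R.\<Lambda> x)" using elim(1) G0 by (intro mult_left_mono) auto
    also have "\<dots> = \<epsilon> / 2 * R.\<Lambda> x" using G0 by simp
    finally show ?case using bnd[OF elim(2)] by linarith
  qed
qed

end

section \<open>Exponential decay under the strong non-lattice condition\<close>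

lemma cmod_exp_minus_one: "cmod (exp z - 1) \<le> cmod z * exp (cmod z)"
  using Taylor_exp_field[of z 0] by (simp add: mult.commute)

context positive_drift begin

text \<open>If the transform were 1 at t, then 1 - cos (t x) would be nonnegative with integral 0,
  so t x would lie in 2 pi Z almost surely and the law would sit on multiples of 2 pi / |t|.\<close>

lemma F_nonarith:
  assumes na: "\<not> arithmetic_law \<nu>" and t: "t \<noteq> 0"
  shows "F (Complex 0 t) \<noteq> 1"
proof
  assume 1: "F (Complex 0 t) = 1"
  have int: "integrable \<nu> (\<lambda>x. exp (- Complex 0 t * of_real x))"
    by (rule integrable_cexp) simp
  have Re: "Re (exp (- Complex 0 t * of_real x)) = cos (t * x)" for x
    by (simp add: Re_exp)
  have "Re (F (Complex 0 t)) = (LINT x|\<nu>. cos (t * x))"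
    unfolding F_def by (subst integral_Re[OF int, symmetric]) (simp only: Re)
  then have c1: "(LINT x|\<nu>. cos (t * x)) = 1" using 1 by simp
  have ci: "integrable \<nu> (\<lambda>x. cos (t * x))"
    by (rule integrable_const_bound[of _ 1]) auto
  have "(LINT x|\<nu>. 1 - cos (t * x)) = 0"
    using ci c1 by (simp del: space_eq_univ add: prob_space)
  moreover have "integrable \<nu> (\<lambda>x. 1 - cos (t * x))" using ci by simp
  ultimately have "AE x in \<nu>. 1 - cos (t * x) = 0"
    by (subst (asm) integral_nonneg_eq_0_iff_AE) auto
  then have "AE x in \<nu>. \<exists>k::int. x = (2 * pi / \<bar>t\<bar>) * of_int k"
  proof eventually_elim
    case (elim x)
    then obtain k :: int where k: "t * x = 2 * pi * of_int k"
      using cos_one_2pi_int[of "t * x"] by (auto simp: mult_ac)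
    show ?case
    proof (cases "t > 0")
      case True
      then have "x = (2 * pi / \<bar>t\<bar>) * of_int k" using k by (simp add: field_simps)
      then show ?thesis ..
    next
      case False
      then have "x = (2 * pi / \<bar>t\<bar>) * of_int (- k)" using k t by (simp add: field_simps)
      then show ?thesis ..
    qed
  qed
  then have "arithmetic_law \<nu>"
    unfolding arithmetic_law_def using t by (intro exI[of _ "2 * pi / \<bar>t\<bar>"]) auto
  then show False using na by simp
qed

lemma F_axis_char: "F (Complex 0 t) = char \<nu> (- t)"
  unfolding F_def char_def by (intro Bochner_Integration.integral_cong refl arg_cong[where f = exp]) (simp add: Complex_eq)

end

locale exponential_drift = positive_drift \<nu> \<theta>0 for \<nu> \<theta>0 +
  fixes \<delta>1 :: real
  assumes \<delta>1: "0 < \<delta>1" and right_int: "integrable \<nu> (\<lambda>x. exp (\<delta>1 * x))"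
    and nonarith: "\<not> arithmetic_law \<nu>" and nonlattice: "strongly_nonlattice_law \<nu>"
begin

lemma integrable_exp_strip: "- \<delta>1 \<le> \<theta> \<Longrightarrow> \<theta> \<le> \<theta>0 \<Longrightarrow> integrable \<nu> (\<lambda>x. exp (- \<theta> * x))"
  using integrable_exp_between[of "- \<delta>1" \<theta>0 \<theta>] right_int left_int by simp

text \<open>A majorant of the difference quotient that is uniform in |w| \<le> r. One factor
  e^{r|x|} comes from the exponential remainder, a second one absorbs |x|; bounding e^{2r|x|} by
  e^{2rx} + e^{-2rx} costs a margin 2r on each side of Re s.\<close>

lemma exp_diff_bound:
  fixes s w :: complex and x r :: real
  assumes r: "0 < r" and w: "cmod w \<le> r"
  shows "cmod (exp (- (s + w) * of_real x) - exp (- s * of_real x)) \<le>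
     cmod w * ((1 / r) * (exp (- (Re s - 2 * r) * x) + exp (- (Re s + 2 * r) * x)))"
proof -
  have "exp (- (s + w) * of_real x) - exp (- s * of_real x) = exp (- s * of_real x) * (exp (- (w * of_real x)) - 1)"
    by (simp add: exp_add[symmetric] algebra_simps)
  then have "cmod (exp (- (s + w) * of_real x) - exp (- s * of_real x)) = exp (- Re s * x) * cmod (exp (- (w * of_real x)) - 1)"
    by (simp add: norm_mult)
  also have "\<dots> \<le> exp (- Re s * x) * ((cmod w * \<bar>x\<bar>) * exp (r * \<bar>x\<bar>))"
  proof (intro mult_left_mono)
    have "cmod (exp (- (w * of_real x)) - 1) \<le> cmod (- (w * of_real x)) * exp (cmod (- (w * of_real x)))"
      by (rule cmod_exp_minus_one)
    also have "\<dots> = (cmod w * \<bar>x\<bar>) * exp (cmod w * \<bar>x\<bar>)" by (simp add: norm_mult)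
    also have "\<dots> \<le> (cmod w * \<bar>x\<bar>) * exp (r * \<bar>x\<bar>)" using w by (intro mult_left_mono) (auto intro: mult_right_mono)
    finally show "cmod (exp (- (w * of_real x)) - 1) \<le> (cmod w * \<bar>x\<bar>) * exp (r * \<bar>x\<bar>)" .
  qed simp
  also have "\<dots> \<le> exp (- Re s * x) * ((cmod w * (1 / r * exp (r * \<bar>x\<bar>))) * exp (r * \<bar>x\<bar>))"
  proof -
    have "r * \<bar>x\<bar> \<le> exp (r * \<bar>x\<bar>)" using exp_ge_add_one_self[of "r * \<bar>x\<bar>"] by linarith
    then have "\<bar>x\<bar> \<le> 1 / r * exp (r * \<bar>x\<bar>)" using r by (simp add: field_simps)
    then show ?thesis by (intro mult_left_mono mult_right_mono) auto
  qed
  also have "\<dots> = cmod w * ((1 / r) * exp (- Re s * x + 2 * r * \<bar>x\<bar>))"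
  proof -
    have "exp (- Re s * x + 2 * r * \<bar>x\<bar>) = exp (- Re s * x) * (exp (r * \<bar>x\<bar>) * exp (r * \<bar>x\<bar>))"
      unfolding exp_add[symmetric] by (simp add: algebra_simps)
    then show ?thesis by simp
  qed
  also have "exp (- Re s * x + 2 * r * \<bar>x\<bar>) \<le> exp (- (Re s - 2 * r) * x) + exp (- (Re s + 2 * r) * x)"
    by (cases "x \<ge> 0") (auto simp: algebra_simps add_increasing add_increasing2)
  finally show ?thesis using r by (simp add: mult_left_mono divide_right_mono)
qed

lemma F_deriv:
  assumes s: "- \<delta>1 < Re s" "Re s < \<theta>0"
  shows "(F has_field_derivative (CLINT x|\<nu>. - of_real x * exp (- s * of_real x))) (at s)"
  unfolding has_field_derivative_iff tendsto_at_iff_sequentially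
proof safe
  fix X :: "nat \<Rightarrow> complex" assume X: "\<forall>i. X i \<in> UNIV - {s}" "X \<longlonglongrightarrow> s"
  \<comment> \<open>Half the distance to the boundary, so that Re s - 2r and Re s + 2r stay in the
    closed strip of integrability.\<close>
  define r where "r = min (Re s + \<delta>1) (\<theta>0 - Re s) / 2"
  have r: "0 < r" "- \<delta>1 \<le> Re s - 2 * r" "Re s + 2 * r \<le> \<theta>0" using s by (auto simp: r_def)
  define w where "w i = X i - s" for i
  have w0: "w i \<noteq> 0" for i using X(1) by (auto simp: w_def)
  have wl: "w \<longlonglongrightarrow> 0" unfolding w_def[abs_def] using tendsto_diff[OF X(2) tendsto_const[of s]] by simp
  have "eventually (\<lambda>i. cmod (w i) < r) sequentially" using tendstoD[OF wl r(1)] by simp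
  then obtain N where N: "\<And>i. i \<ge> N \<Longrightarrow> cmod (w i) < r" by (auto simp: eventually_sequentially)
  have "(\<lambda>i. CLINT x|\<nu>. (exp (- (s + w (i + N)) * of_real x) - exp (- s * of_real x)) / w (i + N)) \<longlonglongrightarrow> (CLINT x|\<nu>. - of_real x * exp (- s * of_real x))"
  proof (rule integral_dominated_convergence[where w = "\<lambda>x. (1 / r) * (exp (- (Re s - 2 * r) * x) + exp (- (Re s + 2 * r) * x))"])
    show "integrable \<nu> (\<lambda>x. (1 / r) * (exp (- (Re s - 2 * r) * x) + exp (- (Re s + 2 * r) * x)))"
      using r by (intro integrable_mult_right Bochner_Integration.integrable_add integrable_exp_strip) auto
    show "AE x in \<nu>. norm ((exp (- (s + w (i + N)) * of_real x) - exp (- s * of_real x)) / w (i + N)) \<le> (1 / r) * (exp (- (Re s - 2 * r) * x) + exp (- (Re s + 2 * r) * x))" for i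
    proof (intro AE_I2)
      fix x
      have "cmod (exp (- (s + w (i + N)) * of_real x) - exp (- s * of_real x)) \<le>
        cmod (w (i + N)) * ((1 / r) * (exp (- (Re s - 2 * r) * x) + exp (- (Re s + 2 * r) * x)))"
        using exp_diff_bound[OF r(1), of "w (i + N)" s x] N[of "i + N"] by simp
      then show "norm ((exp (- (s + w (i + N)) * of_real x) - exp (- s * of_real x)) / w (i + N)) \<le> (1 / r) * (exp (- (Re s - 2 * r) * x) + exp (- (Re s + 2 * r) * x))"
        using w0[of "i + N"] unfolding norm_divide by (subst pos_divide_le_eq) (auto simp: mult.commute)
    qed
    have "(\<lambda>i. (exp (- (s + w (i + N)) * of_real x) - exp (- s * of_real x)) / w (i + N)) \<longlonglongrightarrow> - of_real x * exp (- s * of_real x)" for x :: real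
    proof -
      have "((\<lambda>y. exp (- y * of_real x)) has_field_derivative (- of_real x * exp (- s * of_real x))) (at s)"
        by (auto intro!: derivative_eq_intros)
      then have "((\<lambda>y. (exp (- y * of_real x) - exp (- s * of_real x)) / (y - s)) \<longlongrightarrow> - of_real x * exp (- s * of_real x)) (at s)"
        by (simp add: has_field_derivative_iff)
      moreover have "filterlim (\<lambda>i. X (i + N)) (at s) sequentially"
        using LIMSEQ_ignore_initial_segment[OF X(2), of N] X(1) by (auto simp: filterlim_at intro!: always_eventually)
      ultimately have "(\<lambda>i. (exp (- X (i + N) * of_real x) - exp (- s * of_real x)) / (X (i + N) - s)) \<longlonglongrightarrow> - of_real x * exp (- s * of_real x)"
        by (rule filterlim_compose)
      then show ?thesis by (simp add: w_def)
    qed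
    then show "AE x in \<nu>. (\<lambda>i. (exp (- (s + w (i + N)) * of_real x) - exp (- s * of_real x)) / w (i + N)) \<longlonglongrightarrow> - of_real x * exp (- s * of_real x)"
      by (intro AE_I2)
  qed auto
  moreover have "(CLINT x|\<nu>. (exp (- (s + w (i + N)) * of_real x) - exp (- s * of_real x)) / w (i + N)) = (F (X (i + N)) - F s) / (X (i + N) - s)" for i
  proof -
    have "\<bar>Re (w (i + N))\<bar> < r" using N[of "i + N"] abs_Re_le_cmod[of "w (i + N)"] by simp
    then have "integrable \<nu> (\<lambda>x. exp (- (s + w (i + N)) * of_real x))" "integrable \<nu> (\<lambda>x. exp (- s * of_real x))"
      using r by (rule_tac [!] integrable_cexp, rule_tac [!] integrable_exp_strip) (auto simp: abs_less_iff)
    then have "(CLINT x|\<nu>. (exp (- (s + w (i + N)) * of_real x) - exp (- s * of_real x)) / w (i + N)) = (F (s + w (i + N)) - F s) / w (i + N)"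
      unfolding F_def by (simp add: Bochner_Integration.integral_diff)
    then show ?thesis by (simp add: w_def)
  qed
  ultimately have "(\<lambda>i. (F (X (i + N)) - F s) / (X (i + N) - s)) \<longlonglongrightarrow> (CLINT x|\<nu>. - of_real x * exp (- s * of_real x))" by simp
  then show "((\<lambda>y. (F y - F s) / (y - s)) \<circ> X) \<longlonglongrightarrow> (CLINT x|\<nu>. - of_real x * exp (- s * of_real x))"
    unfolding o_def by (rule LIMSEQ_offset)
qed

text \<open>The majorant of \<open>exp_diff_bound\<close> depends on s only through Re s, so the
  Lipschitz constant is uniform in t. This carries the non-lattice bound from the imaginary axis
  into a strip. The witness is K + 1, to have a positive constant.\<close>

lemma F_near_axis: "\<exists>K r. 0 < r \<and> 0 < K \<and> (\<forall>\<sigma> t. \<bar>\<sigma>\<bar> \<le> r \<longrightarrow> cmod (F (Complex \<sigma> t) - F (Complex 0 t)) \<le> K * \<bar>\<sigma>\<bar>)"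
proof -
  define r where "r = min \<delta>1 \<theta>0 / 2"
  have r: "0 < r" "2 * r \<le> \<delta>1" "2 * r \<le> \<theta>0" using \<delta>1 \<theta>0 by (auto simp: r_def)
  define K where "K = (LINT x|\<nu>. (1 / r) * (exp (2 * r * x) + exp (- (2 * r) * x)))"
  have Ki: "integrable \<nu> (\<lambda>x. (1 / r) * (exp (2 * r * x) + exp (- (2 * r) * x)))"
    using r integrable_exp_strip[of "- (2 * r)"] integrable_exp_strip[of "2 * r"]
    by (intro integrable_mult_right Bochner_Integration.integrable_add) auto
  have K0: "0 \<le> K" unfolding K_def using r by (intro integral_nonneg_AE) (auto simp: add_nonneg_nonneg)
  have "cmod (F (Complex \<sigma> t) - F (Complex 0 t)) \<le> (K + 1) * \<bar>\<sigma>\<bar>" if \<sigma>: "\<bar>\<sigma>\<bar> \<le> r" for \<sigma> t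
  proof -
    have e: "Complex \<sigma> t = Complex 0 t + of_real \<sigma>" by (simp add: complex_eq_iff)
    have i1: "integrable \<nu> (\<lambda>x. exp (- (Complex 0 t + of_real \<sigma>) * of_real x))"
      using \<sigma> r by (intro integrable_cexp integrable_exp_strip) auto
    have i2: "integrable \<nu> (\<lambda>x. exp (- Complex 0 t * of_real x))"
      by (intro integrable_cexp) simp
    have "cmod (F (Complex \<sigma> t) - F (Complex 0 t)) = cmod (CLINT x|\<nu>. exp (- (Complex 0 t + of_real \<sigma>) * of_real x) - exp (- Complex 0 t * of_real x))"
      unfolding e F_def by (subst Bochner_Integration.integral_diff[OF i1 i2]) simp
    also have "\<dots> \<le> (LINT x|\<nu>. cmod (exp (- (Complex 0 t + of_real \<sigma>) * of_real x) - exp (- Complex 0 t * of_real x)))"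
      by (rule integral_norm_bound)
    also have "\<dots> \<le> (LINT x|\<nu>. \<bar>\<sigma>\<bar> * ((1 / r) * (exp (2 * r * x) + exp (- (2 * r) * x))))"
    proof (rule integral_mono)
      show "integrable \<nu> (\<lambda>x. cmod (exp (- (Complex 0 t + of_real \<sigma>) * of_real x) - exp (- Complex 0 t * of_real x)))"
        by (intro integrable_norm Bochner_Integration.integrable_diff i1 i2)
      show "integrable \<nu> (\<lambda>x. \<bar>\<sigma>\<bar> * ((1 / r) * (exp (2 * r * x) + exp (- (2 * r) * x))))"
        using Ki by (rule integrable_mult_right)
      show "cmod (exp (- (Complex 0 t + of_real \<sigma>) * of_real x) - exp (- Complex 0 t * of_real x)) \<le> \<bar>\<sigma>\<bar> * ((1 / r) * (exp (2 * r * x) + exp (- (2 * r) * x)))" for x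
        using exp_diff_bound[OF r(1), of "of_real \<sigma>" "Complex 0 t" x] \<sigma> by simp
    qed
    also have "\<dots> = \<bar>\<sigma>\<bar> * K" unfolding K_def by (rule integral_mult_right_zero)
    also have "\<dots> \<le> (K + 1) * \<bar>\<sigma>\<bar>" by (simp add: algebra_simps)
    finally show ?thesis .
  qed
  then show ?thesis using r(1) K0 by (intro exI[of _ "K + 1"] exI[of _ r]) auto
qed

text \<open>A limsup below 1 leaves room for a uniform \<rho> < 1 outside a bounded set. T \<ge> 1
  is imposed for the later comparison of 1/|t| with 1/(1 + |t|).\<close>

lemma F_axis_away: "\<exists>T \<rho>. 1 \<le> T \<and> \<rho> < 1 \<and> (\<forall>t. T \<le> \<bar>t\<bar> \<longrightarrow> cmod (F (Complex 0 t)) \<le> \<rho>)"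
proof -
  have "Limsup at_infinity (\<lambda>t. ereal (cmod (char \<nu> t))) < 1" using nonlattice by (simp add: strongly_nonlattice_law_def)
  then obtain \<rho> where \<rho>: "Limsup at_infinity (\<lambda>t. ereal (cmod (char \<nu> t))) < ereal \<rho>" "ereal \<rho> < 1"
    using ereal_dense2 by blast
  from Limsup_lessD[OF \<rho>(1)] obtain b where b: "\<And>t. b \<le> norm t \<Longrightarrow> cmod (char \<nu> t) < \<rho>"
    by (auto simp: eventually_at_infinity)
  have "cmod (F (Complex 0 t)) \<le> \<rho>" if "max b 1 \<le> \<bar>t\<bar>" for t
    unfolding F_axis_char using b[of "- t"] that by simp
  then show ?thesis using \<rho>(2) by (intro exI[of _ "max b 1"] exI[of _ \<rho>]) (auto simp: one_ereal_def)
qed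

text \<open>Two removable singularities at 0: v = (1 - F s)/s extends by the value m, and then (w s
  - w 0)/s with w = 1/((1 + s) v) absorbs the pole 1/(m s). Zeros of v have to be avoided: for |Im
  s| \<ge> T the non-lattice bound excludes them, and in the remaining rectangle they form a compact
  set that misses the imaginary axis, hence stays at positive distance from it.\<close>

lemma strip_extension:
  "\<exists>\<delta> h C. 0 < \<delta> \<and> \<delta> < 1 \<and> \<delta> \<le> \<theta>0 \<and> h holomorphic_on {s. -\<delta> < Re s \<and> Re s < \<delta>} \<and>
    (\<forall>s. \<bar>Re s\<bar> < \<delta> \<longrightarrow> cmod (h s) \<le> C / (1 + \<bar>Im s\<bar>)) \<and>
    (\<forall>\<theta>. 0 < \<theta> \<and> \<theta> < \<delta> \<longrightarrow> Fr \<theta> < 1) \<and>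
    (\<forall>s. 0 < Re s \<and> Re s < \<delta> \<longrightarrow> h s = 1 / ((1 + s) * (1 - F s)) - 1 / (of_real m * s))"
proof -
  obtain K r where K: "0 < r" "0 < K" "\<And>\<sigma> t. \<bar>\<sigma>\<bar> \<le> r \<Longrightarrow> cmod (F (Complex \<sigma> t) - F (Complex 0 t)) \<le> K * \<bar>\<sigma>\<bar>"
    using F_near_axis by blast
  obtain T \<rho> where T: "1 \<le> T" "\<rho> < 1" "\<And>t. T \<le> \<bar>t\<bar> \<Longrightarrow> cmod (F (Complex 0 t)) \<le> \<rho>"
    using F_axis_away by blast
  obtain \<theta>1 where \<theta>1: "0 < \<theta>1" "\<theta>1 \<le> \<theta>0" "\<And>\<theta>. 0 < \<theta> \<and> \<theta> \<le> \<theta>1 \<Longrightarrow> Fr \<theta> < 1" using Fr_less_1 by blast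
  \<comment> \<open>\<delta>2 \<le> 1/2 keeps 1 + s away from 0, and K \<delta>2 \<le> (1 -
    \<rho>)/2 lets |F| grow from \<rho> to at most (1 + \<rho>)/2 within the strip.\<close>
  define \<delta>2 where "\<delta>2 = min (min \<delta>1 \<theta>1) (min (min r (1/2)) ((1 - \<rho>) / (2 * K)))"
  have \<delta>2: "0 < \<delta>2" "\<delta>2 \<le> \<delta>1" "\<delta>2 \<le> \<theta>1" "\<delta>2 \<le> r" "\<delta>2 \<le> 1/2" "\<delta>2 \<le> (1 - \<rho>) / (2 * K)"
    using \<delta>1 \<theta>1 K T by (auto simp: \<delta>2_def)
  define S where "S = (\<lambda>d. {s. -d < Re s \<and> Re s < d})"
  have S: "open (S d)" for d
    unfolding S_def by (auto simp: Collect_conj_eq intro!: open_Int open_halfspace_Re_lt open_halfspace_Re_gt)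
  have Fhol: "F holomorphic_on S \<delta>2"
    unfolding holomorphic_on_open[OF S]
  proof
    fix s assume "s \<in> S \<delta>2"
    then have "- \<delta>1 < Re s" "Re s < \<theta>0" using \<delta>2 \<theta>1 by (auto simp: S_def)
    from F_deriv[OF this] show "\<exists>f'. (F has_field_derivative f') (at s)" by blast
  qed
  have far: "cmod (1 - F s) \<ge> (1 - \<rho>) / 2" if "s \<in> S \<delta>2" "T \<le> \<bar>Im s\<bar>" for s
  proof -
    have ab: "\<bar>Re s\<bar> < \<delta>2" using that by (auto simp: S_def)
    have "cmod (F s - F (Complex 0 (Im s))) \<le> K * \<bar>Re s\<bar>" using K(3)[of "Re s" "Im s"] ab \<delta>2 by simp
    also have "\<dots> \<le> K * ((1 - \<rho>) / (2 * K))" using ab \<delta>2 K by (intro mult_left_mono) auto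
    also have "\<dots> = (1 - \<rho>) / 2" using K by simp
    finally have "cmod (F s - F (Complex 0 (Im s))) \<le> (1 - \<rho>) / 2" .
    moreover have "cmod (F s) \<le> cmod (F s - F (Complex 0 (Im s))) + cmod (F (Complex 0 (Im s)))"
      using norm_triangle_sub[of "F s" "F (Complex 0 (Im s))"] by (simp add: add.commute)
    moreover have "1 - cmod (F s) \<le> cmod (1 - F s)" using norm_triangle_ineq2[of 1 "F s"] by simp
    ultimately show ?thesis using T(3)[OF that(2)] by (simp add: field_simps)
  qed
  have F0: "F 0 = 1" using F_of_real[of 0] Fr_0 by simp
  have D0: "deriv F 0 = - of_real m"
  proof -
    have "(F has_field_derivative (CLINT x|\<nu>. - of_real x * exp (- 0 * of_real x))) (at 0)"
      using F_deriv[of 0] \<delta>1 \<theta>0 by simp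
    then have "deriv F 0 = (CLINT x|\<nu>. - complex_of_real x)" by (subst DERIV_imp_deriv) auto
    also have "\<dots> = - of_real m" by (simp add: m_def integral_complex_of_real)
    finally show ?thesis .
  qed
  have z0: "0 \<in> S \<delta>2" using \<delta>2 by (simp add: S_def)
  define v where "v = (\<lambda>s. if s = 0 then - deriv F 0 else (1 - F s) / s)"
  have vhol: "v holomorphic_on S \<delta>2"
  proof -
    have "(\<lambda>z. if z = 0 then deriv F 0 else (F z - F 0) / (z - 0)) holomorphic_on S \<delta>2"
      by (rule pole_lemma_open[OF Fhol S])
    then have "(\<lambda>z. - (if z = 0 then deriv F 0 else (F z - F 0) / (z - 0))) holomorphic_on S \<delta>2"
      by (rule holomorphic_on_minus)
    then show ?thesis by (rule holomorphic_transform) (auto simp: v_def F0 minus_divide_left)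
  qed
  have v0: "v 0 = of_real m" by (simp add: v_def D0)
  have vaxis: "v s \<noteq> 0" if "Re s = 0" for s
  proof (cases "s = 0")
    case True then show ?thesis using v0 m_pos by simp
  next
    case False
    then have "s = Complex 0 (Im s)" "Im s \<noteq> 0" using that by (auto simp: complex_eq_iff)
    then have "F s \<noteq> 1" using F_nonarith[OF nonarith, of "Im s"] by simp
    then show ?thesis using False by (simp add: v_def)
  qed
  define R where "R = cbox (Complex (- \<delta>2 / 2) (- T)) (Complex (\<delta>2 / 2) T)"
  have Rin: "s \<in> R \<longleftrightarrow> \<bar>Re s\<bar> \<le> \<delta>2 / 2 \<and> \<bar>Im s\<bar> \<le> T" for s
    by (auto simp: R_def in_cbox_complex_iff abs_le_iff)
  have RS: "R \<subseteq> S \<delta>2" using \<delta>2 by (auto simp: Rin S_def)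
  have vcont: "continuous_on R v" using holomorphic_on_imp_continuous_on[OF vhol] RS continuous_on_subset by blast
  define Zs where "Zs = {s \<in> R. v s = 0}"
  have "compact Zs"
  proof -
    have cR: "compact R" by (simp add: R_def)
    have cl: "closed (R \<inter> v -` {0})"
      by (rule continuous_closed_preimage[OF vcont]) (auto simp: R_def closed_cbox)
    have "Zs = R \<inter> (R \<inter> v -` {0})" by (auto simp: Zs_def)
    then show ?thesis using compact_Int_closed[OF cR cl] by (simp only:)
  qed
  obtain \<delta>3 where \<delta>3: "0 < \<delta>3" "\<And>s. s \<in> Zs \<Longrightarrow> \<delta>3 \<le> \<bar>Re s\<bar>"
  proof (cases "Zs = {}")
    case True then show ?thesis using that[of 1] by simp
  next
    case False
    have "continuous_on Zs (\<lambda>s. \<bar>Re s\<bar>)" by (intro continuous_intros)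
    then obtain s0 where s0: "s0 \<in> Zs" "\<And>s. s \<in> Zs \<Longrightarrow> \<bar>Re s0\<bar> \<le> \<bar>Re s\<bar>"
      using continuous_attains_inf[OF \<open>compact Zs\<close> False] by blast
    have "Re s0 \<noteq> 0" using s0(1) vaxis by (auto simp: Zs_def)
    then show ?thesis using that[of "\<bar>Re s0\<bar>"] s0 by simp
  qed
  \<comment> \<open>The extra halving leaves room for the closed rectangle \<open>R2\<close> inside
    the strip where h is holomorphic, so that compactness bounds h there.\<close>
  define \<delta> where "\<delta> = min (\<delta>2 / 2) \<delta>3 / 2"
  have \<delta>: "0 < \<delta>" "\<delta> < \<delta>2 / 2" "\<delta> < \<delta>3" using \<delta>2 \<delta>3 by (auto simp: \<delta>_def)
  let ?\<delta>' = "min (\<delta>2 / 2) \<delta>3"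
  have vnz: "v s \<noteq> 0" if "s \<in> S ?\<delta>'" for s
  proof (cases "T \<le> \<bar>Im s\<bar>")
    case True
    have "s \<in> S \<delta>2" using that \<delta>2(1) unfolding S_def mem_Collect_eq by linarith
    have "0 < (1 - \<rho>) / 2" using T(2) by simp
    then have "0 < cmod (1 - F s)" using far[OF \<open>s \<in> S \<delta>2\<close> True] by (rule less_le_trans)
    moreover have "s \<noteq> 0" using True T(1) by auto
    ultimately show ?thesis by (auto simp: v_def)
  next
    case False
    then have "s \<in> R" using that unfolding Rin S_def mem_Collect_eq by linarith
    then show ?thesis using \<delta>3(2)[of s] that by (auto simp: Zs_def S_def)
  qed
  have S2: "S ?\<delta>' \<subseteq> S \<delta>2" using \<delta>2(1) unfolding S_def by (intro Collect_mono impI) linarith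
  have s1: "1 + s \<noteq> 0" if "s \<in> S ?\<delta>'" for s
  proof
    assume "1 + s = 0"
    then have "Re (1 + s) = 0" by simp
    then have "Re s = - 1" by simp
    then show False using that \<delta>2(1,5) unfolding S_def mem_Collect_eq by linarith
  qed
  define w where "w = (\<lambda>s. 1 / ((1 + s) * v s))"
  have whol: "w holomorphic_on S ?\<delta>'"
    unfolding w_def using vnz s1 by (intro holomorphic_intros holomorphic_on_subset[OF vhol S2]) auto
  have w0: "w 0 = 1 / of_real m" by (simp add: w_def v0)
  define h where "h = (\<lambda>s. if s = 0 then deriv w 0 else (w s - w 0) / (s - 0))"
  have hhol: "h holomorphic_on S ?\<delta>'"
    unfolding h_def by (rule pole_lemma_open[OF whol S])
  have heq: "h s = 1 / ((1 + s) * (1 - F s)) - 1 / (of_real m * s)" if "s \<noteq> 0" for s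
  proof -
    have "w s = s / ((1 + s) * (1 - F s))" using that by (simp add: w_def v_def)
    then have "h s = (s / ((1 + s) * (1 - F s)) - 1 / of_real m) / s" using that by (simp add: h_def w0)
    also have "\<dots> = s / ((1 + s) * (1 - F s)) / s - 1 / of_real m / s" by (rule diff_divide_distrib)
    finally show ?thesis using that by simp
  qed
  have SS: "S \<delta> \<subseteq> S ?\<delta>'" using \<delta>(2,3) unfolding S_def by (intro Collect_mono impI) linarith
  define R2 where "R2 = cbox (Complex (- \<delta>) (- T)) (Complex \<delta> T)"
  have R2in: "s \<in> R2 \<longleftrightarrow> \<bar>Re s\<bar> \<le> \<delta> \<and> \<bar>Im s\<bar> \<le> T" for s
    by (auto simp: R2_def in_cbox_complex_iff abs_le_iff)
  have "R2 \<subseteq> S ?\<delta>'"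
  proof
    fix s assume "s \<in> R2"
    then show "s \<in> S ?\<delta>'" using \<delta>(2,3) unfolding R2in S_def mem_Collect_eq by linarith
  qed
  then have "continuous_on R2 h" using holomorphic_on_imp_continuous_on[OF hhol] continuous_on_subset by blast
  then have "compact (h ` R2)" by (rule compact_continuous_image) (simp add: R2_def)
  then have "bounded (h ` R2)" by (rule compact_imp_bounded)
  then obtain M where M: "\<And>s. s \<in> R2 \<Longrightarrow> cmod (h s) \<le> M" unfolding bounded_iff by blast
  have M0: "0 \<le> M" using M[of 0] \<delta> T by (intro order_trans[OF norm_ge_zero M[of 0]]) (auto simp: R2in)
  \<comment> \<open>M (1 + T) serves |Im s| \<le> T; beyond T \<ge> 1 the factor 2 comes from 1/|Im
    s| \<le> 2/(1 + |Im s|).\<close>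
  define C where "C = max (M * (1 + T)) (2 * (2 / (1 - \<rho>) + 1 / m))"
  have bd: "cmod (h s) \<le> C / (1 + \<bar>Im s\<bar>)" if s: "\<bar>Re s\<bar> < \<delta>" for s
  proof (cases "\<bar>Im s\<bar> \<le> T")
    case True
    have "cmod (h s) * (1 + \<bar>Im s\<bar>) \<le> M * (1 + T)" using M[of s] s True M0 by (intro mult_mono) (auto simp: R2in)
    also have "\<dots> \<le> C" by (simp add: C_def)
    finally show ?thesis by (simp add: field_simps)
  next
    case False
    then have I: "T \<le> \<bar>Im s\<bar>" "1 \<le> \<bar>Im s\<bar>" "s \<noteq> 0" using T(1) by auto
    have sS: "s \<in> S \<delta>2" using s \<delta> \<delta>2(1) by (auto simp: S_def)
    have f1: "(1 - \<rho>) / 2 \<le> cmod (1 - F s)" by (rule far[OF sS I(1)])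
    have f2: "\<bar>Im s\<bar> \<le> cmod (1 + s)" using abs_Im_le_cmod[of "1 + s"] by simp
    have f3: "\<bar>Im s\<bar> \<le> cmod s" by (rule abs_Im_le_cmod)
    have "cmod (h s) \<le> cmod (1 / ((1 + s) * (1 - F s))) + cmod (1 / (of_real m * s))"
      unfolding heq[OF I(3)] by (rule norm_triangle_ineq4)
    also have "cmod (1 / ((1 + s) * (1 - F s))) \<le> 1 / (\<bar>Im s\<bar> * ((1 - \<rho>) / 2))"
      unfolding norm_divide norm_mult norm_one
    proof (intro divide_left_mono mult_mono f1 f2 mult_pos_pos)
      show i: "0 < \<bar>Im s\<bar>" using I(2) by linarith
      show "0 < cmod (1 + s)" using i f2 by (rule less_le_trans)
      show r: "0 < (1 - \<rho>) / 2" using T(2) by simp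
      then show "0 \<le> (1 - \<rho>) / 2" by simp
      show "0 < cmod (1 - F s)" using r f1 by (rule less_le_trans)
    qed auto
    also have "cmod (1 / (of_real m * s)) \<le> 1 / (m * \<bar>Im s\<bar>)"
      unfolding norm_divide norm_mult norm_one using f3 I m_pos
      by (intro divide_left_mono mult_mono mult_pos_pos) auto
    also have "1 / (\<bar>Im s\<bar> * ((1 - \<rho>) / 2)) + 1 / (m * \<bar>Im s\<bar>) = (2 / (1 - \<rho>) + 1 / m) / \<bar>Im s\<bar>"
      by (simp add: add_divide_distrib mult.commute)
    also have "\<dots> \<le> (2 / (1 - \<rho>) + 1 / m) * (2 / (1 + \<bar>Im s\<bar>))"
    proof -
      have "1 / \<bar>Im s\<bar> \<le> 2 / (1 + \<bar>Im s\<bar>)" using I by (simp add: field_simps)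
      then have "(2 / (1 - \<rho>) + 1 / m) * (1 / \<bar>Im s\<bar>) \<le> (2 / (1 - \<rho>) + 1 / m) * (2 / (1 + \<bar>Im s\<bar>))"
        using T(2) m_pos by (intro mult_left_mono) (auto simp: add_nonneg_nonneg)
      then show ?thesis by simp
    qed
    also have "\<dots> = (2 * (2 / (1 - \<rho>) + 1 / m)) / (1 + \<bar>Im s\<bar>)" by simp
    also have "\<dots> \<le> C / (1 + \<bar>Im s\<bar>)" by (intro divide_right_mono) (auto simp: C_def)
    finally show ?thesis by simp
  qed
  show ?thesis
  proof (rule exI[of _ \<delta>], rule exI[of _ h], rule exI[of _ C], intro conjI allI impI)
    show "0 < \<delta>" "\<delta> < 1" "\<delta> \<le> \<theta>0" using \<delta> \<delta>2 \<theta>1 by auto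
    show "h holomorphic_on {s. - \<delta> < Re s \<and> Re s < \<delta>}" using holomorphic_on_subset[OF hhol SS] by (simp add: S_def)
    show "cmod (h s) \<le> C / (1 + \<bar>Im s\<bar>)" if "\<bar>Re s\<bar> < \<delta>" for s using bd[OF that] .
    show "Fr \<theta> < 1" if "0 < \<theta> \<and> \<theta> < \<delta>" for \<theta> using \<theta>1(3)[of \<theta>] that \<delta> \<delta>2 by auto
    show "h s = 1 / ((1 + s) * (1 - F s)) - 1 / (of_real m * s)" if "0 < Re s \<and> Re s < \<delta>" for s
      using that by (intro heq) auto
  qed
qed

end

text \<open>Square integrability of e^{\<theta>u} q is traded for integrability with half the
  exponent: on u \<ge> 0 write e^{\<theta>u/2} |q| as the product of e^{\<theta>u} |q| and
  e^{-\<theta>u/2}, each square integrable there. On u < 0 the bound |q u| \<le> A e^{\<theta>u}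
  suffices.\<close>

lemma (in renewal_setting) exponential_weight:
  assumes \<delta>1: "0 < \<delta>1" "integrable \<nu> (\<lambda>x. exp (\<delta>1 * x))"
    and na: "\<not> arithmetic_law \<nu>" and nl: "strongly_nonlattice_law \<nu>"
  shows "\<exists>\<eta>>0. integrable lborel (\<lambda>u. exp (\<eta> * \<bar>u\<bar>) * \<bar>q u\<bar>)"
proof -
  interpret E: exponential_drift \<nu> \<theta>0 \<delta>1
    by unfold_locales (rule \<delta>1 na nl)+
  obtain \<delta> h C where \<delta>: "0 < \<delta>" "\<delta> < 1" "\<delta> \<le> \<theta>0" and hol: "h holomorphic_on {s. -\<delta> < Re s \<and> Re s < \<delta>}"
    and hbd: "\<And>s. \<bar>Re s\<bar> < \<delta> \<Longrightarrow> cmod (h s) \<le> C / (1 + \<bar>Im s\<bar>)"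
    and Fr: "\<And>\<theta>. 0 < \<theta> \<Longrightarrow> \<theta> < \<delta> \<Longrightarrow> W.Fr \<theta> < 1"
    and heq: "\<And>s. 0 < Re s \<Longrightarrow> Re s < \<delta> \<Longrightarrow> h s = 1 / ((1 + s) * (1 - W.F s)) - 1 / (of_real W.m * s)"
    using E.strip_extension by blast
  have Ei: "integrable \<nu> (\<lambda>x. exp (- \<theta> * x))" if "0 < \<theta>" "\<theta> < \<delta>" for \<theta>
    using that \<delta> by (intro W.integrable_exp_right) auto
  have Qb: "W.Q u \<le> exp (\<theta> * u) * (1 / (1 - W.Fr \<theta>))" if "0 < \<theta>" "\<theta> < \<delta>" for \<theta> u
    using that \<delta> Ei Fr by (intro W.Q_bound) auto
  define \<theta> where "\<theta> = \<delta> / 2"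
  have th: "0 < \<theta>" "\<theta> < \<delta>" "\<theta> < 1" using \<delta> by (auto simp: \<theta>_def)
  define A where "A = 1 / (1 - W.Fr \<theta>) + 1 / W.m"
  have A0: "0 < A" using Fr[OF th(1,2)] W.m_pos by (simp add: A_def add_pos_pos)
  have qb: "\<bar>q u\<bar> \<le> A * exp (\<theta> * u)" for u
  proof -
    have "(if 0 < u then 1 / W.m else 0) \<le> (1 / W.m) * exp (\<theta> * u)"
      using W.m_pos th(1) by (auto simp: divide_right_mono)
    then show ?thesis using q_abs_le[of u] Qb[OF th(1,2), of u] by (simp add: A_def algebra_simps)
  qed
  \<comment> \<open>1/(m s) is the transform of the step part 1/m on u > 0, so subtracting it from
    the transform of Q gives h.\<close>
  have lapq: "integrable lborel (\<lambda>u. exp (- s * of_real u) * of_real (q u))"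
      "(CLINT u|lborel. exp (- s * of_real u) * of_real (q u)) = h s" if s: "0 < Re s" "Re s < \<delta>" for s
  proof -
    note lQ = W.laplace_Q[OF s(1) Ei[OF s] Fr[OF s]]
    have e: "exp (- s * of_real u) * of_real (q u) = exp (- s * of_real u) * of_real (W.Q u) - (1 / of_real W.m) * (indicator {0<..} u *\<^sub>R exp (- s * complex_of_real u))" for u
      by (auto simp: q_def indicator_def algebra_simps)
    note t = exp_tail_integral[OF s(1), of 0]
    have ti: "integrable lborel (\<lambda>u. (1 / of_real W.m) * (indicator {0<..} u *\<^sub>R exp (- s * complex_of_real u)))"
      using t(1) unfolding set_integrable_def by (rule integrable_mult_right)
    show "integrable lborel (\<lambda>u. exp (- s * of_real u) * of_real (q u))"
      unfolding e by (rule Bochner_Integration.integrable_diff[OF lQ(1) ti])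
    have "(CLINT u|lborel. exp (- s * of_real u) * of_real (q u)) = 1 / ((1 + s) * (1 - W.F s)) - (1 / of_real W.m) * (exp (- s * of_real 0) / s)"
      unfolding e by (subst Bochner_Integration.integral_diff[OF lQ(1) ti])
        (simp only: integral_mult_right_zero lQ(2) t(2)[unfolded set_lebesgue_integral_def])
    also have "\<dots> = h s" using s by (simp add: heq)
    finally show "(CLINT u|lborel. exp (- s * of_real u) * of_real (q u)) = h s" .
  qed
  \<comment> \<open>e^u Q u is monotone and so has at most countably many discontinuities; the step
    part adds only u = 0.\<close>
  have cont: "AE x in lborel. isCont q x"
  proof -
    define f where "f u = exp u * W.Q u" for u
    have "mono f" unfolding f_def mono_def using W.exp_Q_mono by blast
    then have ct: "countable {x. \<not> isCont f x}" by (rule mono_ctble_discont)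
    have "isCont q x" if "x \<noteq> 0" "isCont f x" for x
    proof -
      have "W.Q = (\<lambda>u. exp (- u) * f u)" by (simp add: f_def fun_eq_iff exp_minus)
      then have QC: "isCont W.Q x" using that(2) by (auto intro!: continuous_intros)
      have "isCont (\<lambda>u. if 0 < u then 1 / W.m else 0) x"
      proof (cases "x > 0")
        case True
        then have "eventually (\<lambda>u. 0 < u) (nhds x)" by (intro eventually_nhds_in_open[of "{0<..}", simplified]) auto
        then have "eventually (\<lambda>u. (if 0 < u then 1 / W.m else 0) = 1 / W.m) (nhds x)" by (rule eventually_mono) simp
        then show ?thesis by (simp add: isCont_cong)
      next
        case False
        then have "eventually (\<lambda>u. u < 0) (nhds x)" using that(1) by (intro eventually_nhds_in_open[of "{..<0}", simplified]) auto
        then have "eventually (\<lambda>u. (if 0 < u then 1 / W.m else 0) = 0) (nhds x)" by (rule eventually_mono) simp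
        then show ?thesis by (simp add: isCont_cong)
      qed
      then show ?thesis unfolding q_def[abs_def] using QC by (intro continuous_intros)
    qed
    then have "{x. \<not> isCont q x} \<subseteq> insert 0 {x. \<not> isCont f x}" by auto
    then have "countable {x. \<not> isCont q x}" by (rule countable_subset) (use ct in simp)
    then have "AE x in lborel. x \<notin> {x. \<not> isCont q x}"
      by (intro AE_not_in countable_imp_null_set_lborel)
    then show ?thesis by simp
  qed
  have L2: "(\<integral>\<^sup>+x. ennreal ((exp (\<theta> * x) * q x)^2) \<partial>lborel) < \<infinity>"
  proof (rule paley_wiener_weight[OF hol hbd _ _ lapq cont th(1,2)])
    show "\<bar>q u\<bar> \<le> A * exp \<bar>u\<bar>" for u
    proof -
      have "\<theta> * u \<le> \<theta> * \<bar>u\<bar>" using th by (intro mult_left_mono) auto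
      also have "\<dots> \<le> 1 * \<bar>u\<bar>" using th by (intro mult_right_mono) auto
      finally have "A * exp (\<theta> * u) \<le> A * exp \<bar>u\<bar>" using A0 by (intro mult_left_mono) auto
      then show ?thesis using qb[of u] by linarith
    qed
  qed auto
  have sqi: "integrable lborel (\<lambda>x. (exp (\<theta> * x) * q x)^2)"
    using L2 by (intro integrableI_nonneg) auto
  define \<eta> where "\<eta> = \<theta> / 2"
  have \<eta>: "0 < \<eta>" "\<eta> < \<theta>" using th by (auto simp: \<eta>_def)
  have ep: "integrable lborel (\<lambda>u. indicat_real {-1<..} u *\<^sub>R exp (- \<theta> * u))"
    using exp_tail_integral_real(1)[OF th(1), of "-1"] unfolding set_integrable_def .
  have en: "integrable lborel (\<lambda>u. indicat_real {..<0} u *\<^sub>R exp (\<eta> * u))"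
    using exp_left_tail(1)[OF \<eta>(1), of 0] unfolding set_integrable_def .
  have "integrable lborel (\<lambda>u. exp (\<eta> * \<bar>u\<bar>) * \<bar>q u\<bar>)"
  proof (rule Bochner_Integration.integrable_bound)
    show "integrable lborel (\<lambda>u. (exp (\<theta> * u) * q u)^2 + indicat_real {-1<..} u *\<^sub>R exp (- \<theta> * u) + A * (indicat_real {..<0} u *\<^sub>R exp (\<eta> * u)))"
      by (intro Bochner_Integration.integrable_add integrable_mult_right sqi ep en)
    show "AE u in lborel. norm (exp (\<eta> * \<bar>u\<bar>) * \<bar>q u\<bar>) \<le> norm ((exp (\<theta> * u) * q u)^2 + indicat_real {-1<..} u *\<^sub>R exp (- \<theta> * u) + A * (indicat_real {..<0} u *\<^sub>R exp (\<eta> * u)))"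
    proof (intro AE_I2)
      fix u :: real
      let ?b = "(exp (\<theta> * u) * q u)^2 + indicat_real {-1<..} u *\<^sub>R exp (- \<theta> * u) + A * (indicat_real {..<0} u *\<^sub>R exp (\<eta> * u))"
      have "exp (\<eta> * \<bar>u\<bar>) * \<bar>q u\<bar> \<le> ?b"
      proof (cases "u \<ge> 0")
        case True
        have sq: "(exp (- \<eta> * u))^2 = exp (- \<theta> * u)" by (simp add: exp_double[symmetric] \<eta>_def)
        have "exp (\<eta> * \<bar>u\<bar>) * \<bar>q u\<bar> = (exp (\<theta> * u) * \<bar>q u\<bar>) * exp (- \<eta> * u)"
          using True by (simp add: exp_add[symmetric] \<eta>_def mult.commute mult.left_commute)
        also have "\<dots> \<le> (exp (\<theta> * u) * \<bar>q u\<bar>)^2 + (exp (- \<eta> * u))^2"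
        proof -
          have "2 * (exp (\<theta> * u) * \<bar>q u\<bar>) * exp (- \<eta> * u) \<le> (exp (\<theta> * u) * \<bar>q u\<bar>)^2 + (exp (- \<eta> * u))^2"
            by (rule sum_squares_bound)
          moreover have "0 \<le> (exp (\<theta> * u) * \<bar>q u\<bar>) * exp (- \<eta> * u)" by simp
          ultimately show ?thesis by linarith
        qed
        also have "\<dots> = (exp (\<theta> * u) * q u)^2 + exp (- \<theta> * u)" unfolding sq by (simp add: power_mult_distrib)
        also have "\<dots> = ?b" using True by simp
        finally show ?thesis .
      next
        case False
        have "exp (\<eta> * \<bar>u\<bar>) * \<bar>q u\<bar> \<le> exp (\<eta> * \<bar>u\<bar>) * (A * exp (\<theta> * u))" using qb by (intro mult_left_mono) auto
        also have "\<dots> = A * exp (\<eta> * \<bar>u\<bar> + \<theta> * u)" by (simp add: exp_add mult_ac)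
        also have "\<eta> * \<bar>u\<bar> + \<theta> * u = \<eta> * u" using False by (simp add: \<eta>_def)
        also have "A * exp (\<eta> * u) = A * (indicat_real {..<0} u *\<^sub>R exp (\<eta> * u))" using False by simp
        also have "\<dots> \<le> ?b" by (simp add: indicator_def)
        finally show ?thesis .
      qed
      then show "norm (exp (\<eta> * \<bar>u\<bar>) * \<bar>q u\<bar>) \<le> norm ?b" by (simp add: abs_mult)
    qed
  qed measurable
  then show ?thesis using \<eta>(1) by blast
qed

section \<open>The renewal theorem\<close>

text \<open>Shifting t by half a period pi / X reverses the sign of the cosine, so twice the
  integral is the integral of cos (t X) (w t - w (t + pi / X)). The L1 norm of that difference tends
  to 0 by Scheffe's argument: a.e. continuity handles its positive part, which is at most w t, and
  equality of the total masses handles the rest.\<close>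

lemma riemann_lebesgue_cos:
  fixes w :: "real \<Rightarrow> real"
  assumes int: "integrable lborel w" and nn: "\<And>t. 0 \<le> w t" and cont: "AE t in lborel. isCont w t"
  shows "((\<lambda>x. LINT t|lborel. cos (t * x) * w t) \<longlongrightarrow> 0) at_top"
proof (rule tendsto_at_topI_sequentially)
  fix X :: "nat \<Rightarrow> real" assume X: "filterlim X at_top sequentially"
  have [measurable]: "w \<in> borel_measurable borel" using int by auto
  define h where "h n = pi / X n" for n
  have h: "h \<longlonglongrightarrow> 0" unfolding h_def[abs_def]
    by (rule tendsto_divide_0[OF tendsto_const]) (rule filterlim_at_top_imp_at_infinity[OF X])
  have wi: "integrable lborel (\<lambda>t. w (h n + 1 * t))" for n
    by (rule lborel_integrable_real_affine[OF int]) simp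
  have ci: "integrable lborel (\<lambda>t. cos (t * x) * v t)" if "integrable lborel v" for x and v :: "real \<Rightarrow> real"
  proof (rule Bochner_Integration.integrable_bound[OF that])
    show "AE t in lborel. norm (cos (t * x) * v t) \<le> norm (v t)"
      by (intro AE_I2) (simp add: abs_mult mult_left_le_one_le)
  qed (use that in measurable)
  define D where "D n = (LINT t|lborel. max 0 (w t - w (h n + 1 * t)))" for n
  have "(\<lambda>n. D n) \<longlonglongrightarrow> (LINT t|(lborel :: real measure). 0 :: real)"
    unfolding D_def
  proof (rule integral_dominated_convergence[OF _ _ int])
    show "AE t in lborel. (\<lambda>n. max 0 (w t - w (h n + 1 * t))) \<longlonglongrightarrow> 0"
      using cont
    proof eventually_elim
      case (elim t)
      have "(\<lambda>n. h n + 1 * t) \<longlonglongrightarrow> 0 + 1 * t" by (intro tendsto_intros h)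
      then have "(\<lambda>n. w (h n + 1 * t)) \<longlonglongrightarrow> w t" by (intro isCont_tendsto_compose[OF elim]) simp
      then have "(\<lambda>n. max 0 (w t - w (h n + 1 * t))) \<longlonglongrightarrow> max 0 (w t - w t)" by (intro tendsto_intros)
      then show ?case by simp
    qed
    show "AE t in lborel. norm (max 0 (w t - w (h n + 1 * t))) \<le> w t" for n
      using nn by (intro AE_I2) (auto simp: max_def)
  qed auto
  then have D: "D \<longlonglongrightarrow> 0" by simp
  have Di: "integrable lborel (\<lambda>t. max 0 (w t - w (h n + 1 * t)))" for n
    using nn by (intro Bochner_Integration.integrable_bound[OF int]) (auto simp: max_def)
  have abs_D: "(LINT t|lborel. \<bar>w t - w (h n + 1 * t)\<bar>) = 2 * D n" for n
  proof -
    have z: "(LINT t|lborel. w (h n + 1 * t)) = (LINT t|lborel. w t)"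
      using lborel_integral_real_affine[of 1 w "h n"] by simp
    have "\<bar>w t - w (h n + 1 * t)\<bar> = 2 * max 0 (w t - w (h n + 1 * t)) - (w t - w (h n + 1 * t))" for t
      by (simp add: max_def)
    then have "(LINT t|lborel. \<bar>w t - w (h n + 1 * t)\<bar>) = (LINT t|lborel. 2 * max 0 (w t - w (h n + 1 * t)) - (w t - w (h n + 1 * t)))"
      by simp
    also have "\<dots> = 2 * D n - ((LINT t|lborel. w t) - (LINT t|lborel. w (h n + 1 * t)))"
      unfolding D_def
      by (subst Bochner_Integration.integral_diff[OF integrable_mult_right[OF Di] Bochner_Integration.integrable_diff[OF int wi]],
          subst Bochner_Integration.integral_diff[OF int wi], subst integral_mult_right_zero) (rule refl)
    finally show ?thesis using z by simp
  qed
  have "eventually (\<lambda>n. X n > 0) sequentially" using X by (simp add: filterlim_at_top_dense)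
  then have "eventually (\<lambda>n. norm (LINT t|lborel. cos (t * X n) * w t) \<le> D n) sequentially"
  proof eventually_elim
    case (elim n)
    have c: "cos ((h n + 1 * t) * X n) = - cos (t * X n)" for t
    proof -
      have "(h n + 1 * t) * X n = t * X n + pi" using elim by (simp add: h_def field_simps)
      then show ?thesis by simp
    qed
    have "(LINT t|lborel. cos (t * X n) * w t) = (LINT t|lborel. cos ((h n + 1 * t) * X n) * w (h n + 1 * t))"
      using lborel_integral_real_affine[of 1 "\<lambda>t. cos (t * X n) * w t" "h n"] by simp
    also have "\<dots> = - (LINT t|lborel. cos (t * X n) * w (h n + 1 * t))" unfolding c by simp
    finally have "2 * (LINT t|lborel. cos (t * X n) * w t) = (LINT t|lborel. cos (t * X n) * w t) - (LINT t|lborel. cos (t * X n) * w (h n + 1 * t))"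
      by simp
    also have "\<dots> = (LINT t|lborel. cos (t * X n) * (w t - w (h n + 1 * t)))"
      unfolding right_diff_distrib by (rule Bochner_Integration.integral_diff[symmetric]) (intro ci int wi)+
    finally have "\<bar>2 * (LINT t|lborel. cos (t * X n) * w t)\<bar> = \<bar>LINT t|lborel. cos (t * X n) * (w t - w (h n + 1 * t))\<bar>" by simp
    also have "\<dots> \<le> (LINT t|lborel. \<bar>w t - w (h n + 1 * t)\<bar>)"
    proof (rule order_trans[OF integral_abs_bound integral_mono])
      show "integrable lborel (\<lambda>t. \<bar>cos (t * X n) * (w t - w (h n + 1 * t))\<bar>)"
        by (intro integrable_abs ci Bochner_Integration.integrable_diff int wi)
      show "integrable lborel (\<lambda>t. \<bar>w t - w (h n + 1 * t)\<bar>)"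
        by (intro integrable_abs Bochner_Integration.integrable_diff int wi)
      show "\<bar>cos (t * X n) * (w t - w (h n + 1 * t))\<bar> \<le> \<bar>w t - w (h n + 1 * t)\<bar>" for t
        unfolding abs_mult by (rule mult_left_le_one_le) auto
    qed
    also have "\<dots> = 2 * D n" by (rule abs_D)
    finally show ?case by simp
  qed
  then show "(\<lambda>n. LINT t|lborel. cos (t * X n) * w t) \<longlonglongrightarrow> 0"
    by (rule Lim_null_comparison[OF _ D])
qed

lemma abel_limit:
  fixes r :: "nat \<Rightarrow> real" and V :: "nat \<Rightarrow> real"
  assumes V: "summable V" "\<And>n. 0 \<le> V n" and r: "\<And>j. 0 \<le> r j" "\<And>j. r j \<le> 1" "r \<longlonglongrightarrow> 1"
  shows "(\<lambda>j. \<Sum>n. r j ^ n * V n) \<longlonglongrightarrow> (\<Sum>n. V n)"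
proof -
  have le: "r j ^ n * V n \<le> V n" for j n
    using V(2)[of n] r(1,2)[of j] by (intro mult_left_le_one_le) (auto intro: power_le_one)
  have s: "summable (\<lambda>n. norm (r j ^ n * V n))" for j
    by (rule summable_comparison_test[OF _ V(1)]) (use le V r in \<open>auto intro!: exI[of _ 0]\<close>)
  have I: "(\<Sum>n. r j ^ n * V n) = (LINT n|count_space UNIV. r j ^ n * V n)" for j
    using s by (intro integral_count_space_nat[symmetric]) (simp add: integrable_count_space_nat_iff)
  have I': "(\<Sum>n. V n) = (LINT n|count_space UNIV. V n)"
    using V by (intro integral_count_space_nat[symmetric]) (simp add: integrable_count_space_nat_iff)
  show ?thesis unfolding I I'
  proof (rule integral_dominated_convergence[where w = V])
    show "integrable (count_space UNIV) V" using V by (simp add: integrable_count_space_nat_iff)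
    have "(\<lambda>j. r j ^ n * V n) \<longlonglongrightarrow> 1 ^ n * V n" for n by (intro tendsto_intros r)
    then show "AE n in count_space UNIV. (\<lambda>j. r j ^ n * V n) \<longlonglongrightarrow> V n" by (simp add: AE_count_space)
    show "AE n in count_space UNIV. norm (r j ^ n * V n) \<le> V n" for j
      using le V r by (simp add: AE_count_space)
  qed auto
qed

text \<open>Expand (y/a + \<theta>a)^2 \<ge> 0. An exponential majorant is what
  \<open>laplace_H\<close> can integrate against the renewal measure.\<close>

lemma normal_density_le_exp:
  assumes a: "a > 0"
  shows "normal_density 0 a y \<le> normal_density 0 a 0 * exp (\<theta>^2 * a^2 / 2) * exp (\<theta> * y)"
proof -
  have "0 \<le> (y / a + \<theta> * a)^2" by simp
  also have "\<dots> = y^2 / a^2 + 2 * (\<theta> * y) + \<theta>^2 * a^2"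
    using a by (simp add: power2_sum power_divide power_mult_distrib)
  finally have "- (y^2 / (2 * a^2)) \<le> \<theta>^2 * a^2 / 2 + \<theta> * y" by (simp add: field_simps)
  then have "exp (- (y^2 / (2 * a^2))) \<le> exp (\<theta>^2 * a^2 / 2) * exp (\<theta> * y)" by (simp add: exp_add[symmetric])
  then show ?thesis by (simp add: normal_density_def mult.assoc divide_right_mono)
qed

text \<open>Merges the bounds y^2 and 2 for 1 - cos y into one multiple of the Cauchy kernel: (1 -
  cos y)/y^2 \<le> 4/(1 + y^2).\<close>

lemma one_minus_cos_le: "(1 - cos (y::real)) * (1 + y^2) \<le> 4 * y^2"
proof (cases "\<bar>y\<bar> \<le> 1")
  case True
  have "1 - cos y = 2 * (sin (y / 2))^2" using cos_double_sin[of "y / 2"] by simp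
  also have "(sin (y / 2))^2 \<le> (y / 2)^2" by (rule abs_le_square_iff[THEN iffD1, OF abs_sin_x_le_abs_x])
  finally have "1 - cos y \<le> 2 * (y^2 / 4)" by (simp add: power_divide)
  then have 1: "1 - cos y \<le> y^2" using zero_le_power2[of y] by linarith
  have "y^2 \<le> 1" using True by (simp add: abs_square_le_1)
  then have "(1 - cos y) * (1 + y^2) \<le> y^2 * 2" using 1 by (intro mult_mono) auto
  then show ?thesis by (rule order_trans) simp
next
  case False
  then have "1 \<le> y^2" using abs_square_le_1[of y] by linarith
  have "1 - cos y \<le> 2" using cos_ge_minus_one[of y] by linarith
  then have "(1 - cos y) * (1 + y^2) \<le> 2 * (2 * y^2)" using \<open>1 \<le> y^2\<close> by (intro mult_mono) auto
  then show ?thesis by simp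
qed

section \<open>The characteristic function near the origin\<close>

context positive_drift begin

abbreviation f :: "real \<Rightarrow> complex" where "f t \<equiv> F (Complex 0 t)"

lemma f_le_1: "cmod (f t) \<le> 1"
  using cmod_F_le[of "Complex 0 t"] by (simp add: Fr_0)

lemma Re_f_le: "Re (f t) \<le> 1"
  using complex_Re_le_cmod[of "f t"] f_le_1[of t] by linarith

lemma f_0: "f 0 = 1"
  using F_of_real[of 0] Fr_0 by (simp add: Complex_eq)

lemma f_cont: "continuous_on UNIV f"
proof -
  have "isCont (\<lambda>t. char \<nu> (- t)) t" for t
    by (intro isCont_o2[OF _ isCont_char] continuous_intros)
  then show ?thesis by (simp add: F_axis_char continuous_on_eq_continuous_at)
qed

lemma f_meas [measurable]: "f \<in> borel_measurable borel"
  using f_cont by (rule borel_measurable_continuous_onI)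

text \<open>Derivative at 0 from the first moment alone, with majorant |u x|. The factor u prepares
  the rescaling t = \<epsilon> v of \<open>spike_limit\<close>.\<close>

lemma f_quotient: "((\<lambda>\<tau>. (1 - f (\<tau> * u)) / of_real \<tau>) \<longlongrightarrow> \<i> * of_real (m * u)) (at 0)"
  unfolding tendsto_at_iff_sequentially
proof safe
  fix T :: "nat \<Rightarrow> real" assume T: "\<forall>i. T i \<in> UNIV - {0}" "T \<longlonglongrightarrow> 0"
  have fl: "filterlim T (at 0) sequentially" using T by (auto simp: filterlim_at)
  have e: "exp (- Complex 0 (T i * u) * of_real x) = iexp (- (T i * u * x))" for i x
    by (rule arg_cong[where f = exp]) (simp add: Complex_eq)
  have int: "integrable \<nu> (\<lambda>x. iexp (- (T i * u * x)))" for i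
    by (rule integrable_const_bound[of _ 1]) auto
  have lim: "(\<lambda>i. CLINT x|\<nu>. (1 - iexp (- (T i * u * x))) / of_real (T i)) \<longlonglongrightarrow> (CLINT x|\<nu>. \<i> * of_real (u * x))"
  proof (rule integral_dominated_convergence[where w = "\<lambda>x. \<bar>u\<bar> * \<bar>x\<bar>"])
    show "integrable \<nu> (\<lambda>x. \<bar>u\<bar> * \<bar>x\<bar>)" using mean_int by (intro integrable_mult_right integrable_abs)
    have "((\<lambda>\<tau>. (1 - iexp (- (\<tau> * u * x))) / of_real \<tau>) \<longlongrightarrow> \<i> * of_real (u * x)) (at 0)" for x :: real
    proof -
      have "((\<lambda>\<tau>::complex. 1 - exp (- \<i> * \<tau> * of_real (u * x))) has_field_derivative \<i> * of_real (u * x)) (at 0)"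
        by (auto intro!: derivative_eq_intros)
      then have "((\<lambda>\<tau>::complex. (1 - exp (- \<i> * \<tau> * of_real (u * x))) / \<tau>) \<longlongrightarrow> \<i> * of_real (u * x)) (at 0)"
        by (simp add: has_field_derivative_iff)
      moreover have "filterlim (complex_of_real) (at 0) (at 0)"
        by (auto simp: filterlim_at eventually_at_filter intro!: tendsto_eq_intros)
      ultimately have "((\<lambda>\<tau>. (1 - exp (- \<i> * complex_of_real \<tau> * of_real (u * x))) / of_real \<tau>) \<longlongrightarrow> \<i> * of_real (u * x)) (at 0)"
        by (rule filterlim_compose)
      then show ?thesis by (simp add: mult_ac)
    qed
    then show "AE x in \<nu>. (\<lambda>i. (1 - iexp (- (T i * u * x))) / of_real (T i)) \<longlonglongrightarrow> \<i> * of_real (u * x)"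
      by (intro AE_I2 filterlim_compose[OF _ fl]) auto
    show "AE x in \<nu>. norm ((1 - iexp (- (T i * u * x))) / complex_of_real (T i)) \<le> \<bar>u\<bar> * \<bar>x\<bar>" for i
    proof (intro AE_I2)
      fix x
      have "cmod (iexp (- (T i * u * x)) - 1) \<le> \<bar>- (T i * u * x)\<bar>"
        using iexp_approx1[of "- (T i * u * x)" 0] by simp
      then have "cmod (1 - iexp (- (T i * u * x))) \<le> \<bar>T i\<bar> * (\<bar>u\<bar> * \<bar>x\<bar>)"
        by (simp add: norm_minus_commute abs_mult mult.assoc)
      moreover have "T i \<noteq> 0" using T(1) by auto
      ultimately show "norm ((1 - iexp (- (T i * u * x))) / complex_of_real (T i)) \<le> \<bar>u\<bar> * \<bar>x\<bar>"
        unfolding norm_divide norm_of_real by (subst pos_divide_le_eq) (auto simp: mult.commute)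
    qed
  qed auto
  have e1: "(CLINT x|\<nu>. (1 - iexp (- (T i * u * x))) / of_real (T i)) = (1 - f (T i * u)) / of_real (T i)" for i
    unfolding F_def e using int[of i] by (simp del: space_eq_univ add: Bochner_Integration.integral_diff prob_space)
  have e2: "(CLINT x|\<nu>. \<i> * of_real (u * x)) = \<i> * of_real (m * u)"
    by (simp add: m_def integral_complex_of_real mult.commute del: of_real_mult)
  show "((\<lambda>\<tau>. (1 - f (\<tau> * u)) / of_real \<tau>) \<circ> T) \<longlonglongrightarrow> \<i> * of_real (m * u)"
    using lim unfolding e1 e2 o_def .
qed

text \<open>Im (f t) is asymptotically -m t. Since m > 0, this bounds |1 - \<rho> f t| below near 0,
  uniformly in discounts \<rho> \<ge> 1/2.\<close>

lemma Im_f_lower: "\<exists>\<eta>>0. \<forall>t. \<bar>t\<bar> \<le> \<eta> \<longrightarrow> m / 2 * \<bar>t\<bar> \<le> \<bar>Im (f t)\<bar>"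
proof -
  have "((\<lambda>\<tau>. Im ((1 - f (\<tau> * 1)) / of_real \<tau>)) \<longlongrightarrow> Im (\<i> * of_real (m * 1))) (at 0)"
    by (intro tendsto_Im f_quotient)
  then have "((\<lambda>\<tau>. - Im (f \<tau>) / \<tau>) \<longlongrightarrow> m) (at 0)" by (simp add: Im_divide_of_real)
  from order_tendstoD(1)[OF this, of "m / 2"] m_pos
  obtain d where d: "d > 0" "\<And>t. t \<noteq> 0 \<Longrightarrow> \<bar>t\<bar> < d \<Longrightarrow> m / 2 < - Im (f t) / t"
    by (auto simp: eventually_at dist_real_def)
  have "m / 2 * \<bar>t\<bar> \<le> \<bar>Im (f t)\<bar>" if "\<bar>t\<bar> \<le> d / 2" for t
  proof (cases "t = 0")
    case False
    have "m / 2 < \<bar>- Im (f t) / t\<bar>" using d(2)[of t] False that d(1) by linarith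
    then show ?thesis using False by (simp add: abs_divide field_simps)
  qed simp
  then show ?thesis using d(1) by (intro exI[of _ "d / 2"]) auto
qed

lemma Re_f: "1 - Re (f t) = (LINT x|\<nu>. 1 - cos (t * x))"
proof -
  have int: "integrable \<nu> (\<lambda>x. exp (- Complex 0 t * of_real x))"
    by (rule integrable_cexp) simp
  have Re: "Re (exp (- Complex 0 t * of_real x)) = cos (t * x)" for x
    by (simp add: Re_exp)
  have ci: "integrable \<nu> (\<lambda>x. cos (t * x))"
    by (rule integrable_const_bound[of _ 1]) auto
  have "Re (f t) = (LINT x|\<nu>. cos (t * x))"
    unfolding F_def by (subst integral_Re[OF int, symmetric]) (simp only: Re)
  then show ?thesis using ci by (simp del: space_eq_univ add: prob_space)
qed

text \<open>The scaling u = t x shows that (1 - cos (t x))/t^2 has t-integral of order |x|, and |x|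
  is integrable. With |1 - f t| at least of order |t| this makes the real part of 1/(1 - f)
  integrable near 0.\<close>

lemma integrable_Re_f: "integrable lborel (\<lambda>t. (1 - Re (f t)) / t^2)"
proof (rule integrableI_nonneg)
  interpret N: pair_sigma_finite lborel \<nu>
    by (simp add: pair_sigma_finite_def sigma_finite_lborel sigma_finite_measure_axioms)
  have cb: "0 \<le> 1 - cos (y::real)" for y by simp
  have nn: "ennreal ((1 - Re (f t)) / t^2) = (\<integral>\<^sup>+x. ennreal ((1 - cos (t * x)) / t^2) \<partial>\<nu>)" for t
  proof -
    have "integrable \<nu> (\<lambda>x. (1 - cos (t * x)) / t^2)"
      by (intro integrable_divide Bochner_Integration.integrable_diff integrable_const integrable_const_bound[of _ 1]) auto
    then show ?thesis unfolding Re_f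
      by (subst nn_integral_eq_integral) (auto simp: cb)
  qed
  have inner: "(\<integral>\<^sup>+t. ennreal ((1 - cos (t * x)) / t^2) \<partial>lborel) \<le> ennreal (4 * pi * \<bar>x\<bar>)" for x
  proof (cases "x = 0")
    case False
    have "(\<integral>\<^sup>+t. ennreal ((1 - cos (t * x)) / t^2) \<partial>lborel)
      = ennreal \<bar>1 / x\<bar> * (\<integral>\<^sup>+u. ennreal ((1 - cos ((0 + 1 / x * u) * x)) / (0 + 1 / x * u)^2) \<partial>lborel)"
      using False by (subst nn_integral_real_affine[where c = "1 / x" and t = 0]) auto
    also have "\<dots> \<le> ennreal \<bar>1 / x\<bar> * (\<integral>\<^sup>+u. ennreal (4 * x^2 * inverse (1 + u^2)) \<partial>lborel)"
    proof (intro mult_left_mono nn_integral_mono ennreal_leI)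
      fix u :: real
      show "(1 - cos ((0 + 1 / x * u) * x)) / (0 + 1 / x * u)^2 \<le> 4 * x^2 * inverse (1 + u^2)"
      proof (cases "u = 0")
        case u: False
        have p: "0 < 1 + u^2" by (simp add: add_pos_nonneg)
        have "(1 - cos u) / u^2 \<le> 4 * inverse (1 + u^2)"
          using one_minus_cos_le[of u] u p by (simp add: field_simps)
        then have "x^2 * ((1 - cos u) / u^2) \<le> x^2 * (4 * inverse (1 + u^2))" by (intro mult_left_mono) auto
        then show ?thesis using False by (simp add: power_divide mult_ac)
      qed simp
    qed simp
    also have "(\<integral>\<^sup>+u. ennreal (4 * x^2 * inverse (1 + u^2)) \<partial>lborel) = ennreal (4 * x^2 * pi)"
      by (subst nn_integral_eq_integral) (auto simp: integrable_inverse_sq integral_inverse_sq intro!: integrable_mult_right AE_I2 mult_nonneg_nonneg)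
    also have "ennreal \<bar>1 / x\<bar> * ennreal (4 * x^2 * pi) = ennreal (\<bar>1 / x\<bar> * (4 * x^2 * pi))"
      by (rule ennreal_mult[symmetric]) auto
    also have "\<bar>1 / x\<bar> * (4 * x^2 * pi) = 4 * pi * \<bar>x\<bar>"
      using False by (simp add: abs_if power2_eq_square)
    finally show ?thesis .
  qed simp
  have "(\<integral>\<^sup>+t. ennreal ((1 - Re (f t)) / t^2) \<partial>lborel) = (\<integral>\<^sup>+x. \<integral>\<^sup>+t. ennreal ((1 - cos (t * x)) / t^2) \<partial>lborel \<partial>\<nu>)"
    unfolding nn by (rule N.Fubini'[symmetric]) measurable
  also have "\<dots> \<le> (\<integral>\<^sup>+x. ennreal (4 * pi * \<bar>x\<bar>) \<partial>\<nu>)"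
    by (intro nn_integral_mono inner)
  also have "\<dots> < \<infinity>"
    using mean_int by (subst nn_integral_eq_integral) (auto intro!: integrable_mult_right integrable_abs)
  finally show "(\<integral>\<^sup>+t. ennreal ((1 - Re (f t)) / t^2) \<partial>lborel) < \<infinity>" .
  show "AE t in lborel. 0 \<le> (1 - Re (f t)) / t^2"
    using Re_f_le by (intro AE_I2 divide_nonneg_nonneg) auto
qed measurable

end

section \<open>Gaussian averages of the renewal measure\<close>

context drift_walk begin

text \<open>Share of S_n in the Gaussian average \<open>U\<close>. The law of S_n may be singular,
  so f^n need not be integrable; the Gaussian factor makes its inversion integral converge
  absolutely.\<close>

definition u :: "real \<Rightarrow> nat \<Rightarrow> real \<Rightarrow> real" where
  "u a n x = (LINT \<omega>|M. normal_density 0 a (x - S n \<omega>))"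

definition U :: "real \<Rightarrow> real \<Rightarrow> real" where
  "U a x = (LINT z|H. normal_density 0 a (x - z))"

lemma u_nonneg: "0 \<le> u a n x"
  unfolding u_def by (intro integral_nonneg_AE) auto

lemma U_nonneg: "0 \<le> U a x"
  unfolding U_def by (intro integral_nonneg_AE) auto

lemma U_integrable_bound:
  assumes a: "a > 0"
  shows "integrable H (\<lambda>z. normal_density 0 a (x - z))" and "\<exists>\<theta> D. 0 < \<theta> \<and> (\<forall>x. U a x \<le> D * exp (\<theta> * x))"
proof -
  obtain \<theta> where th: "0 < \<theta>" "\<theta> \<le> 1" "integrable \<nu> (\<lambda>x. exp (- \<theta> * x))" "Fr \<theta> < 1" by (rule obtain_\<theta>)
  define D where "D = normal_density 0 a 0 * exp (\<theta>^2 * a^2 / 2)"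
  have D: "0 \<le> D" by (simp add: D_def)
  have Hi: "integrable H (\<lambda>z. exp (- \<theta> * z))"
    using laplace_H[OF th(3,4)] by (intro integrableI_nonneg) auto
  have bd: "normal_density 0 a (x - z) \<le> (D * exp (\<theta> * x)) * exp (- \<theta> * z)" for x z
    using normal_density_le_exp[OF a, of "x - z" \<theta>] by (simp add: D_def exp_diff exp_minus right_diff_distrib field_simps)
  have Ei: "integrable H (\<lambda>z. (D * exp (\<theta> * x)) * exp (- \<theta> * z))" for x using Hi by (rule integrable_mult_right)
  show i: "integrable H (\<lambda>z. normal_density 0 a (x - z))" for x
    by (rule Bochner_Integration.integrable_bound[OF Ei[of x]]) (use bd D in \<open>auto simp: abs_mult\<close>)
  have "U a x \<le> (D * (LINT z|H. exp (- \<theta> * z))) * exp (\<theta> * x)" for x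
  proof -
    have "U a x \<le> (LINT z|H. (D * exp (\<theta> * x)) * exp (- \<theta> * z))"
      unfolding U_def by (rule integral_mono[OF i Ei bd])
    also have "\<dots> = (D * exp (\<theta> * x)) * (LINT z|H. exp (- \<theta> * z))" by (rule integral_mult_right_zero)
    finally show ?thesis by (simp add: mult_ac)
  qed
  then show "\<exists>\<theta> D. 0 < \<theta> \<and> (\<forall>x. U a x \<le> D * exp (\<theta> * x))" using th(1) by blast
qed

lemma u_sums: assumes "a > 0" shows "(\<lambda>n. u a n x) sums U a x"
  using sums_renewal_measure[OF P.sigma_finite_measure_axioms X_meas U_integrable_bound(1)[OF assms]]
  unfolding u_def U_def S_def by simp

lemma u_fourier:
  assumes a: "a > 0"
  shows "complex_of_real (u a n x) = 1 / (2 * pi) * (CLINT t|lborel. of_real (exp (- (a^2 * t^2 / 2))) * iexp (t * x) * f t ^ n)"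
proof -
  interpret LM: pair_sigma_finite lborel M
    by (simp add: pair_sigma_finite_def sigma_finite_lborel P.sigma_finite_measure_axioms)
  let ?e = "\<lambda>t. complex_of_real (exp (- (a^2 * t^2 / 2)))"
  let ?f = "\<lambda>(t, \<omega>). ?e t * iexp (t * (x - S n \<omega>))"
  have fm: "?f \<in> borel_measurable (lborel \<Otimes>\<^sub>M M)" by measurable
  have nf: "norm (?f (t, \<omega>)) = exp (- (a^2 * t^2 / 2))" for t \<omega> by (simp add: norm_mult)
  have fi: "integrable (lborel \<Otimes>\<^sub>M M) ?f"
  proof (rule LM.Fubini_integrable[OF fm])
    show "integrable lborel (\<lambda>t. LINT \<omega>|M. norm (?f (t, \<omega>)))"
      unfolding nf using integrable_gauss[OF a] by (simp add: P.prob_space)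
    have "integrable M (\<lambda>\<omega>. ?f (t, \<omega>))" for t
    proof (rule P.integrable_const_bound)
      show "AE \<omega> in M. norm (?f (t, \<omega>)) \<le> exp (- (a^2 * t^2 / 2))" unfolding nf by simp
      show "(\<lambda>\<omega>. ?f (t, \<omega>)) \<in> borel_measurable M" by (rule measurable_Pair2[OF fm]) simp
    qed
    then show "AE t in lborel. integrable M (\<lambda>\<omega>. ?f (t, \<omega>))" by (intro AE_I2)
  qed
  have in1: "(CLINT t|lborel. ?f (t, \<omega>)) = of_real (2 * pi) * of_real (normal_density 0 a (x - S n \<omega>))" for \<omega>
    unfolding normal_density_fourier[OF a] by simp
  have in2: "(CLINT \<omega>|M. ?f (t, \<omega>)) = ?e t * iexp (t * x) * f t ^ n" for t
  proof -
    have "?f (t, \<omega>) = ?e t * iexp (t * x) * exp (- Complex 0 t * of_real (S n \<omega>))" for \<omega>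
    proof -
      have "iexp (t * (x - S n \<omega>)) = iexp (t * x) * exp (- Complex 0 t * of_real (S n \<omega>))"
        unfolding exp_add[symmetric] by (rule arg_cong[where f = exp]) (simp add: Complex_eq algebra_simps)
      then show ?thesis by simp
    qed
    then have "(CLINT \<omega>|M. ?f (t, \<omega>)) = ?e t * iexp (t * x) * (CLINT \<omega>|M. exp (- Complex 0 t * of_real (S n \<omega>)))"
      by (simp only: integral_mult_right_zero)
    also have "(CLINT \<omega>|M. exp (- Complex 0 t * of_real (S n \<omega>))) = f t ^ n"
      by (rule expectation_exp_S(1)) simp
    finally show ?thesis .
  qed
  have "of_real (2 * pi) * complex_of_real (u a n x) = (CLINT \<omega>|M. CLINT t|lborel. ?f (t, \<omega>))"
    unfolding in1 u_def by (simp only: integral_mult_right_zero integral_complex_of_real)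
  also have "\<dots> = (CLINT t|lborel. CLINT \<omega>|M. ?f (t, \<omega>))"
    using LM.Fubini_integral[OF fi] by simp
  also have "\<dots> = (CLINT t|lborel. ?e t * iexp (t * x) * f t ^ n)" unfolding in2 ..
  finally have "of_real (2 * pi) * complex_of_real (u a n x) = (CLINT t|lborel. ?e t * iexp (t * x) * f t ^ n)" .
  then show ?thesis by (simp add: field_simps)
qed

definition E :: "real \<Rightarrow> real \<Rightarrow> real" where "E a t = exp (- (a^2 * t^2 / 2))"

lemma E_meas [measurable]: "E a \<in> borel_measurable borel" unfolding E_def by measurable
lemma E_pos: "0 < E a t" by (simp add: E_def)
lemma E_integrable: "a > 0 \<Longrightarrow> integrable lborel (E a)" unfolding E_def by (rule integrable_gauss)

lemma E_mult_integrable: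
  assumes a: "a > 0" and g: "g \<in> borel_measurable borel" and K: "\<And>t. norm (g t) \<le> K"
  shows "integrable lborel (\<lambda>t. of_real (E a t) * (g t :: 'b :: {real_normed_field, banach, second_countable_topology}))"
proof (rule Bochner_Integration.integrable_bound[OF integrable_mult_left[OF E_integrable[OF a], of K]])
  show "AE t in lborel. norm (of_real (E a t) * g t) \<le> norm (E a t * K)"
    using E_pos[of a] K order_trans[OF K abs_ge_self] by (intro AE_I2) (simp add: norm_mult abs_mult less_imp_le)
  have [measurable]: "g \<in> borel_measurable borel" by fact
  show "(\<lambda>t. of_real (E a t) * g t) \<in> borel_measurable lborel" by measurable
qed

text \<open>Adding the value at -x replaces e^{itx} by 2 cos (t x), so that after summation only the
  real part of 1/(1 - \<rho> f) enters.\<close>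

lemma u_sym:
  assumes a: "a > 0"
  shows "complex_of_real (pi * (u a n x + u a n (- x))) = (CLINT t|lborel. of_real (E a t * cos (t * x)) * f t ^ n)"
proof -
  have fn: "cmod (f t ^ n) \<le> 1" for t using f_le_1[of t] by (simp add: norm_power power_le_one)
  have i: "integrable lborel (\<lambda>t. of_real (E a t) * (iexp (t * y) * f t ^ n))" for y
    by (rule E_mult_integrable[OF a, where K = 1]) (use fn in \<open>auto simp: norm_mult\<close>)
  have uf: "of_real (2 * pi) * complex_of_real (u a n y) = (CLINT t|lborel. of_real (E a t) * (iexp (t * y) * f t ^ n))" for y
    unfolding u_fourier[OF a] E_def by (simp add: mult.assoc)
  have "of_real (2 * pi) * complex_of_real (u a n x + u a n (- x))
     = (CLINT t|lborel. of_real (E a t) * (iexp (t * x) * f t ^ n)) + (CLINT t|lborel. of_real (E a t) * (iexp (t * (- x)) * f t ^ n))"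
    unfolding of_real_add distrib_left uf ..
  also have "\<dots> = (CLINT t|lborel. of_real (E a t) * (iexp (t * x) * f t ^ n) + of_real (E a t) * (iexp (t * (- x)) * f t ^ n))"
    by (rule Bochner_Integration.integral_add[symmetric]) (rule i)+
  also have "\<dots> = (CLINT t|lborel. 2 * (of_real (E a t * cos (t * x)) * f t ^ n))"
  proof (rule Bochner_Integration.integral_cong[OF refl])
    fix t
    have "iexp (t * x) + iexp (t * (- x)) = 2 * of_real (cos (t * x))"
      by (simp add: complex_eq_iff Re_exp Im_exp)
    then have "of_real (E a t) * ((iexp (t * x) + iexp (t * (- x))) * f t ^ n) = of_real (E a t) * (2 * of_real (cos (t * x)) * f t ^ n)"
      by (simp only:)
    then show "of_real (E a t) * (iexp (t * x) * f t ^ n) + of_real (E a t) * (iexp (t * (- x)) * f t ^ n) = 2 * (of_real (E a t * cos (t * x)) * f t ^ n)"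
      by (simp add: algebra_simps)
  qed
  also have "\<dots> = 2 * (CLINT t|lborel. of_real (E a t * cos (t * x)) * f t ^ n)" by (rule integral_mult_right_zero)
  finally show ?thesis by simp
qed

text \<open>Real part of the transform of the renewal measure discounted by \<rho>^n; its
  nonnegativity (\<open>p_nonneg\<close>) drives the estimates that follow.\<close>

definition p :: "real \<Rightarrow> real \<Rightarrow> real" where "p \<rho> t = Re (1 / (1 - of_real \<rho> * f t))"

text \<open>One bound for each regime: the first for fixed \<rho> < 1, the second away from t = 0
  uniformly in \<rho>, the third near t = 0, where the imaginary part is of order t.\<close>

lemma denom_lower:
  assumes "0 \<le> \<rho>" "\<rho> \<le> 1"
  shows "1 - \<rho> \<le> cmod (1 - of_real \<rho> * f t)" and "cmod (1 - f t) / 2 \<le> cmod (1 - of_real \<rho> * f t)"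
    and "\<rho> * \<bar>Im (f t)\<bar> \<le> cmod (1 - of_real \<rho> * f t)"
proof -
  have "1 - cmod (of_real \<rho> * f t) \<le> cmod (1 - of_real \<rho> * f t)" using norm_triangle_ineq2[of 1 "of_real \<rho> * f t"] by simp
  moreover have "cmod (of_real \<rho> * f t) \<le> \<rho>" using assms f_le_1[of t] by (simp add: norm_mult mult_left_le)
  ultimately show 1: "1 - \<rho> \<le> cmod (1 - of_real \<rho> * f t)" by linarith
  have "1 - f t = (1 - of_real \<rho> * f t) - of_real (1 - \<rho>) * f t" by (simp add: algebra_simps)
  then have "cmod (1 - f t) \<le> cmod (1 - of_real \<rho> * f t) + cmod (of_real (1 - \<rho>) * f t)" using norm_triangle_ineq4 by metis
  moreover have "cmod (of_real (1 - \<rho>) * f t) \<le> 1 - \<rho>" unfolding norm_mult norm_of_real using assms f_le_1[of t] by (simp add: mult_left_le)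
  ultimately show "cmod (1 - f t) / 2 \<le> cmod (1 - of_real \<rho> * f t)" using 1 by linarith
  have "\<bar>Im (1 - of_real \<rho> * f t)\<bar> \<le> cmod (1 - of_real \<rho> * f t)" by (rule abs_Im_le_cmod)
  then show "\<rho> * \<bar>Im (f t)\<bar> \<le> cmod (1 - of_real \<rho> * f t)" using assms by (simp add: abs_mult)
qed

lemma p_eq: "p \<rho> t = ((1 - \<rho>) + \<rho> * (1 - Re (f t))) / (cmod (1 - of_real \<rho> * f t))^2"
  unfolding p_def by (simp add: Re_divide cmod_power2 algebra_simps)

lemma p_nonneg: "0 \<le> \<rho> \<Longrightarrow> \<rho> \<le> 1 \<Longrightarrow> 0 \<le> p \<rho> t"
  unfolding p_eq using Re_f_le[of t] by (intro divide_nonneg_nonneg add_nonneg_nonneg mult_nonneg_nonneg) auto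

lemma p_meas [measurable]: "p \<rho> \<in> borel_measurable borel"
  unfolding p_def by measurable

lemma p_le: "0 \<le> \<rho> \<Longrightarrow> \<rho> < 1 \<Longrightarrow> p \<rho> t \<le> 1 / (1 - \<rho>)"
proof -
  assume r: "0 \<le> \<rho>" "\<rho> < 1"
  have "p \<rho> t \<le> cmod (1 / (1 - of_real \<rho> * f t))" unfolding p_def by (rule complex_Re_le_cmod)
  also have "\<dots> = 1 / cmod (1 - of_real \<rho> * f t)" by (simp add: norm_divide)
  also have "\<dots> \<le> 1 / (1 - \<rho>)" using denom_lower(1)[of \<rho> t] r by (intro divide_left_mono mult_pos_pos) auto
  finally show ?thesis .
qed

text \<open>Discounting makes the geometric series in \<rho> f converge absolutely and uniformly in
  t, so sum and integral may be exchanged.\<close>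

lemma V_sums:
  assumes a: "a > 0" and \<rho>: "0 \<le> \<rho>" "\<rho> < 1"
  shows "(\<lambda>n. \<rho> ^ n * (pi * (u a n x + u a n (- x)))) sums (LINT t|lborel. E a t * cos (t * x) * p \<rho> t)"
proof -
  let ?g = "\<lambda>n t. of_real (E a t) * (of_real (cos (t * x)) * (of_real \<rho> * f t) ^ n) :: complex"
  have rf: "cmod (of_real \<rho> * f t) \<le> \<rho>" for t using \<rho> f_le_1[of t] by (simp add: norm_mult mult_left_le)
  have gb: "cmod (of_real (cos (t * x)) * (of_real \<rho> * f t) ^ n) \<le> \<rho> ^ n" for n t
  proof -
    have "cmod (of_real (cos (t * x)) * (of_real \<rho> * f t) ^ n) \<le> 1 * \<rho> ^ n"
      unfolding norm_mult[of "of_real (cos (t * x))"] norm_power using rf by (intro mult_mono power_mono) auto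
    then show ?thesis by simp
  qed
  have gi: "integrable lborel (?g n)" for n
    by (rule E_mult_integrable[OF a, where K = "\<rho> ^ n"]) (use gb in auto)
  have gs: "(\<lambda>n. ?g n t) sums (of_real (E a t) * (of_real (cos (t * x)) * (1 / (1 - of_real \<rho> * f t))))" for t
    using rf[of t] \<rho> by (intro sums_mult geometric_sums) simp
  have gn: "norm (?g n t) \<le> \<rho> ^ n * E a t" for n t
    using mult_left_mono[OF gb[of t n], of "E a t"] E_pos[of a t] by (simp add: norm_mult mult.commute)
  have S: "(\<lambda>n. integral\<^sup>L lborel (?g n)) sums (CLINT t|lborel. \<Sum>n. ?g n t)"
  proof (rule sums_integral[OF gi])
    have geo: "summable (\<lambda>n. \<rho> ^ n * c)" for c :: real
      using \<rho> by (intro summable_mult2 summable_geometric) simp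
    have "summable (\<lambda>n. norm (?g n t))" for t
      by (rule summable_comparison_test'[OF geo[of "E a t"]]) (use gn in simp)
    then show "AE t in lborel. summable (\<lambda>n. norm (?g n t))" by simp
    have le: "(LINT t|lborel. norm (?g n t)) \<le> \<rho> ^ n * (LINT t|lborel. E a t)" for n
    proof -
      have "(LINT t|lborel. norm (?g n t)) \<le> (LINT t|lborel. \<rho> ^ n * E a t)"
        by (rule integral_mono[OF integrable_norm[OF gi] integrable_mult_right[OF E_integrable[OF a]] gn])
      also have "\<dots> = \<rho> ^ n * (LINT t|lborel. E a t)" by (rule integral_mult_right_zero)
      finally show ?thesis .
    qed
    have "norm (LINT t|lborel. norm (?g n t)) \<le> \<rho> ^ n * (LINT t|lborel. E a t)" for n
      using le[of n] unfolding real_norm_def by (subst abs_of_nonneg) (auto intro!: integral_nonneg_AE)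
    then show "summable (\<lambda>n. LINT t|lborel. norm (?g n t))"
      by (rule summable_comparison_test'[OF geo])
  qed
  have gI: "integral\<^sup>L lborel (?g n) = of_real (\<rho> ^ n * (pi * (u a n x + u a n (- x))))" for n
  proof -
    have "integral\<^sup>L lborel (?g n) = (CLINT t|lborel. of_real (\<rho> ^ n) * (of_real (E a t * cos (t * x)) * f t ^ n))"
      by (intro Bochner_Integration.integral_cong) (simp_all add: power_mult_distrib mult_ac)
    also have "\<dots> = of_real (\<rho> ^ n) * of_real (pi * (u a n x + u a n (- x)))"
      unfolding u_sym[OF a] by (rule integral_mult_right_zero)
    finally show ?thesis by simp
  qed
  have sI: "(CLINT t|lborel. \<Sum>n. ?g n t) = (CLINT t|lborel. of_real (E a t) * (of_real (cos (t * x)) * (1 / (1 - of_real \<rho> * f t))))"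
    by (intro Bochner_Integration.integral_cong refl sums_unique[symmetric] gs)
  have wi: "integrable lborel (\<lambda>t. of_real (E a t) * (of_real (cos (t * x)) * (1 / (1 - of_real \<rho> * f t))) :: complex)"
  proof (rule E_mult_integrable[OF a, where K = "1 / (1 - \<rho>)"])
    show "(\<lambda>t. complex_of_real (cos (t * x)) * (1 / (1 - of_real \<rho> * f t))) \<in> borel_measurable borel" by measurable
    fix t
    have "1 / cmod (1 - of_real \<rho> * f t) \<le> 1 / (1 - \<rho>)"
      using denom_lower(1)[of \<rho> t] \<rho> by (intro divide_left_mono mult_pos_pos) auto
    then have "\<bar>cos (t * x)\<bar> * (1 / cmod (1 - of_real \<rho> * f t)) \<le> 1 * (1 / (1 - \<rho>))"
      by (intro mult_mono) auto
    then show "cmod (complex_of_real (cos (t * x)) * (1 / (1 - of_real \<rho> * f t))) \<le> 1 / (1 - \<rho>)"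
      by (simp only: norm_mult norm_divide norm_of_real norm_one mult_1)
  qed
  have "(\<lambda>n. Re (of_real (\<rho> ^ n * (pi * (u a n x + u a n (- x)))))) sums Re (CLINT t|lborel. of_real (E a t) * (of_real (cos (t * x)) * (1 / (1 - of_real \<rho> * f t))))"
    using S unfolding gI sI by (rule sums_Re)
  also have "Re (CLINT t|lborel. of_real (E a t) * (of_real (cos (t * x)) * (1 / (1 - of_real \<rho> * f t)))) = (LINT t|lborel. E a t * cos (t * x) * p \<rho> t)"
  proof -
    have re: "Re (of_real A * (of_real B * z)) = A * B * Re z" for A B and z :: complex by simp
    show ?thesis unfolding p_def by (subst integral_Re[OF wi, symmetric]) (simp only: re)
  qed
  finally show ?thesis by simp
qed

text \<open>Abel summation: the undiscounted series has nonnegative terms and converges by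
  \<open>u_sums\<close>, although its kernel Re (1/(1 - f)) is singular at 0.\<close>

lemma V_limit:
  assumes a: "a > 0" and r: "\<And>j. 0 \<le> r j" "\<And>j. r j < 1" "r \<longlonglongrightarrow> 1"
  shows "(\<lambda>j. LINT t|lborel. E a t * cos (t * x) * p (r j) t) \<longlonglongrightarrow> pi * (U a x + U a (- x))"
proof -
  have s: "(\<lambda>n. pi * (u a n x + u a n (- x))) sums (pi * (U a x + U a (- x)))"
    by (intro sums_mult sums_add u_sums a)
  have "(\<lambda>j. \<Sum>n. r j ^ n * (pi * (u a n x + u a n (- x)))) \<longlonglongrightarrow> (\<Sum>n. pi * (u a n x + u a n (- x)))"
    using s r by (intro abel_limit) (auto simp: sums_iff u_nonneg less_imp_le)
  moreover have "(\<Sum>n. r j ^ n * (pi * (u a n x + u a n (- x)))) = (LINT t|lborel. E a t * cos (t * x) * p (r j) t)" for j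
    using V_sums[OF a r(1,2)] by (simp add: sums_iff)
  ultimately show ?thesis using s by (simp add: sums_iff)
qed

lemma Ep_integrable:
  assumes a: "a > 0" and \<rho>: "0 \<le> \<rho>" "\<rho> < 1" and g: "g \<in> borel_measurable borel" "\<And>t. \<bar>g t\<bar> \<le> (1::real)"
  shows "integrable lborel (\<lambda>t. E a t * g t * p \<rho> t)"
proof -
  have [measurable]: "g \<in> borel_measurable borel" by fact
  have "\<bar>g t * p \<rho> t\<bar> \<le> 1 / (1 - \<rho>)" for t
    using mult_mono[OF g(2)[of t] p_le[OF \<rho>, of t]] p_nonneg[of \<rho> t] \<rho> by (simp add: abs_mult)
  then have "integrable lborel (\<lambda>t. of_real (E a t) * (g t * p \<rho> t))"
    by (intro E_mult_integrable[OF a, where K = "1 / (1 - \<rho>)"]) auto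
  then show ?thesis by (simp add: mult.assoc)
qed

lemma V0_bound:
  assumes a: "a > 0" and \<rho>: "0 \<le> \<rho>" "\<rho> < 1"
  shows "(LINT t|lborel. E a t * p \<rho> t) \<le> 2 * pi * U a 0"
proof -
  have s: "(\<lambda>n. pi * (u a n 0 + u a n 0)) sums (pi * (U a 0 + U a 0))"
    by (intro sums_mult sums_add u_sums a)
  have v: "(\<lambda>n. \<rho> ^ n * (pi * (u a n 0 + u a n 0))) sums (LINT t|lborel. E a t * p \<rho> t)"
    using V_sums[OF a \<rho>, of 0] by simp
  have "\<rho> ^ n * (pi * (u a n 0 + u a n 0)) \<le> pi * (u a n 0 + u a n 0)" for n
    using \<rho> u_nonneg[of a n 0] by (intro mult_left_le_one_le) (auto intro: power_le_one)
  from sums_le[OF this v s] show ?thesis by simp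
qed

text \<open>As for positive definite functions, the symmetrised value is largest at the origin,
  because cos \<le> 1 and p \<ge> 0. Then U a (-x) \<ge> 0 is discarded.\<close>

lemma U_bounded:
  assumes a: "a > 0"
  shows "U a x \<le> 2 * U a 0"
proof -
  define r where "r j = 1 - inverse (real (Suc j))" for j
  have r: "\<And>j. 0 \<le> r j" "\<And>j. r j < 1" "r \<longlonglongrightarrow> 1"
    using tendsto_diff[OF tendsto_const[of 1] LIMSEQ_inverse_real_of_nat] by (auto simp: r_def[abs_def] field_simps)
  have "(LINT t|lborel. E a t * cos (t * x) * p (r j) t) \<le> 2 * pi * U a 0" for j
  proof -
    have "(LINT t|lborel. E a t * cos (t * x) * p (r j) t) \<le> (LINT t|lborel. E a t * 1 * p (r j) t)"
    proof (intro integral_mono Ep_integrable a r)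
      fix t
      show "E a t * cos (t * x) * p (r j) t \<le> E a t * 1 * p (r j) t"
        using r(1,2)[of j] E_pos[of a t] p_nonneg[of "r j" t] by (intro mult_right_mono mult_left_mono) auto
    qed auto
    then show ?thesis using V0_bound[OF a r(1,2), of j] by simp
  qed
  then have "pi * (U a x + U a (- x)) \<le> 2 * pi * U a 0"
    using V_limit[OF a r, of x] by (intro LIMSEQ_le_const2) auto
  then have "pi * (U a x + U a (- x)) \<le> pi * (2 * U a 0)" by simp
  then have "U a x + U a (- x) \<le> 2 * U a 0" by (subst (asm) mult_le_cancel_left_pos) auto
  then show ?thesis using U_nonneg[of a "- x"] by linarith
qed

text \<open>Turns two lower bounds on W, one constant and one linear in t, into the Cauchy-type
  majorant for the rescaled kernel.\<close>

lemma cmod_sq_bounds: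
  assumes c: "c > 0" and e: "e > 0" and w: "e \<le> W" "c * \<bar>t\<bar> \<le> (W::real)"
  shows "e^2 / W^2 \<le> (1 + 1 / c^2) * inverse (1 + (t / e)^2)"
proof -
  have W: "W > 0" using w(1) e by linarith
  have 1: "e^2 \<le> W^2" using w(1) e by (intro power_mono) auto
  have "(c * \<bar>t\<bar>)^2 \<le> W^2" using w(2) c by (intro power_mono) auto
  then have "c^2 * t^2 \<le> W^2" by (simp add: power_mult_distrib)
  then have 2: "t^2 \<le> W^2 / c^2" using c by (simp add: field_simps)
  have "e^2 + t^2 \<le> W^2 * (1 + 1 / c^2)" using 1 2 by (simp add: algebra_simps)
  moreover have "e^2 + t^2 = e^2 * (1 + (t / e)^2)" using e by (simp add: power_divide field_simps)
  ultimately have "e^2 * (1 + (t / e)^2) \<le> W^2 * (1 + 1 / c^2)" by simp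
  moreover have "0 < 1 + (t / e)^2" by (simp add: add_pos_nonneg)
  ultimately show ?thesis using W by (simp add: field_simps)
qed

end

section \<open>The renewal theorem for Gaussian averages\<close>

locale blackwell = drift_walk \<nu> \<theta>0 M X for \<nu> \<theta>0 M X +
  assumes nonarithmetic: "\<not> arithmetic_law \<nu>"
begin

lemma f_ne_1: "t \<noteq> 0 \<Longrightarrow> f t \<noteq> 1"
  by (rule F_nonarith[OF nonarithmetic])

text \<open>The offset 2 keeps \<rho> \<ge> 1/2, which the third bound of \<open>w_lower\<close>
  uses.\<close>

definition \<epsilon> :: "nat \<Rightarrow> real" where "\<epsilon> j = inverse (real (Suc (Suc j)))"
definition \<rho> :: "nat \<Rightarrow> real" where "\<rho> j = 1 - \<epsilon> j"

lemma \<epsilon>: "0 < \<epsilon> j" "\<epsilon> j \<le> 1/2" "\<epsilon> \<longlonglongrightarrow> 0"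
proof -
  show "0 < \<epsilon> j" "\<epsilon> j \<le> 1/2" by (auto simp: \<epsilon>_def field_simps)
  show "\<epsilon> \<longlonglongrightarrow> 0" unfolding \<epsilon>_def[abs_def] using LIMSEQ_Suc[OF LIMSEQ_inverse_real_of_nat] .
qed

lemma \<rho>: "1/2 \<le> \<rho> j" "0 \<le> \<rho> j" "\<rho> j < 1" "\<rho> j \<le> 1" "\<rho> \<longlonglongrightarrow> 1"
proof -
  show "1/2 \<le> \<rho> j" "0 \<le> \<rho> j" "\<rho> j < 1" "\<rho> j \<le> 1" using \<epsilon>(1,2)[of j] by (auto simp: \<rho>_def)
  show "\<rho> \<longlonglongrightarrow> 1" unfolding \<rho>_def[abs_def] using tendsto_diff[OF tendsto_const[of 1] \<epsilon>(3)] by simp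
qed

definition w :: "nat \<Rightarrow> real \<Rightarrow> complex" where "w j t = 1 - of_real (\<rho> j) * f t"

lemma w_meas [measurable]: "w j \<in> borel_measurable borel" unfolding w_def by measurable

lemma w_lower: "\<epsilon> j \<le> cmod (w j t)" "cmod (1 - f t) / 2 \<le> cmod (w j t)" "\<bar>Im (f t)\<bar> / 2 \<le> cmod (w j t)"
proof -
  show "\<epsilon> j \<le> cmod (w j t)" using denom_lower(1)[of "\<rho> j" t] \<rho>(1-4)[of j] by (simp add: w_def \<rho>_def)
  show "cmod (1 - f t) / 2 \<le> cmod (w j t)" using denom_lower(2)[of "\<rho> j" t] \<rho>(1-4)[of j] by (simp add: w_def)
  have "1/2 * \<bar>Im (f t)\<bar> \<le> \<rho> j * \<bar>Im (f t)\<bar>" using \<rho>(1)[of j] by (intro mult_right_mono) auto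
  then show "\<bar>Im (f t)\<bar> / 2 \<le> cmod (w j t)" using denom_lower(3)[of "\<rho> j" t] \<rho>(1-4)[of j] by (simp add: w_def)
qed

lemma w_pos: "0 < cmod (w j t)" using \<epsilon>(1) w_lower(1) by (rule less_le_trans)

text \<open>In p = (\<epsilon> + \<rho> (1 - Re f)) / |w|^2 the \<epsilon> part near the origin
  tends to a point mass and has no fixed integrable majorant. It is cut out here, and what remains
  of p near the origin is dominated.\<close>

definition spike :: "real \<Rightarrow> nat \<Rightarrow> real \<Rightarrow> real" where
  "spike \<eta> j t = indicator {-\<eta>..\<eta>} t * (\<epsilon> j / (cmod (w j t))^2)"

lemma spike_meas [measurable]: "spike \<eta> j \<in> borel_measurable borel" unfolding spike_def by measurable

text \<open>Near the origin the discounted kernel concentrates to a point mass: after rescaling by \<open>\<epsilon>\<close> it becomes the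
  Cauchy kernel \<open>1 / (1 + m\<^sup>2 v\<^sup>2)\<close>.\<close>

lemma spike_limit:
  assumes a: "a > 0" and \<eta>: "\<eta> > 0" and Im: "\<And>t. \<bar>t\<bar> \<le> \<eta> \<Longrightarrow> m / 2 * \<bar>t\<bar> \<le> \<bar>Im (f t)\<bar>"
  shows "(\<lambda>j. LINT t|lborel. E a t * cos (t * x) * spike \<eta> j t) \<longlonglongrightarrow> pi / m"
proof -
  \<comment> \<open>Substituting t = \<epsilon> v brings a Jacobian \<epsilon>, hence \<epsilon>^2 /
    |w|^2.\<close>
  define g where "g j v = E a (\<epsilon> j * v) * cos (\<epsilon> j * v * x) * (indicator {-\<eta>..\<eta>} (\<epsilon> j * v) * ((\<epsilon> j)^2 / (cmod (w j (\<epsilon> j * v)))^2))" for j v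
  have sub: "(LINT t|lborel. E a t * cos (t * x) * spike \<eta> j t) = (LINT v|lborel. g j v)" for j
  proof -
    have "(LINT t|lborel. E a t * cos (t * x) * spike \<eta> j t) = \<bar>\<epsilon> j\<bar> *\<^sub>R (LINT v|lborel. E a (0 + \<epsilon> j * v) * cos ((0 + \<epsilon> j * v) * x) * spike \<eta> j (0 + \<epsilon> j * v))"
      using \<epsilon>(1)[of j] by (intro lborel_integral_real_affine) auto
    also have "\<dots> = (LINT v|lborel. \<bar>\<epsilon> j\<bar> * (E a (0 + \<epsilon> j * v) * cos ((0 + \<epsilon> j * v) * x) * spike \<eta> j (0 + \<epsilon> j * v)))"
      by simp
    also have "\<dots> = (LINT v|lborel. g j v)"
      using \<epsilon>(1)[of j] by (intro Bochner_Integration.integral_cong) (auto simp: g_def spike_def power2_eq_square)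
    finally show ?thesis .
  qed
  have gm: "g j \<in> borel_measurable lborel" for j unfolding g_def by measurable
  \<comment> \<open>m/2 from the hypothesis on Im f, halved once more by
    \<open>w_lower\<close>.\<close>
  define c where "c = m / 4"
  have c: "c > 0" using m_pos by (simp add: c_def)
  have "(\<lambda>j. LINT v|lborel. g j v) \<longlonglongrightarrow> (LINT v|lborel. inverse (1 + (m * v)^2))"
  proof (rule integral_dominated_convergence[where w = "\<lambda>v. (1 + 1 / c^2) * inverse (1 + v^2)"])
    show "integrable lborel (\<lambda>v::real. (1 + 1 / c^2) * inverse (1 + v^2))"
      using integrable_inverse_sq by (rule integrable_mult_right)
    show "AE v in lborel. norm (g j v) \<le> (1 + 1 / c^2) * inverse (1 + v^2)" for j
    proof (intro AE_I2)
      fix v :: real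
      have rhs: "0 \<le> (1 + 1 / c^2) * inverse (1 + v^2)" using c by (intro mult_nonneg_nonneg) auto
      show "norm (g j v) \<le> (1 + 1 / c^2) * inverse (1 + v^2)"
      proof (cases "\<epsilon> j * v \<in> {-\<eta>..\<eta>}")
        case True
        then have "m / 2 * \<bar>\<epsilon> j * v\<bar> \<le> \<bar>Im (f (\<epsilon> j * v))\<bar>" by (intro Im) auto
        then have "c * \<bar>\<epsilon> j * v\<bar> \<le> cmod (w j (\<epsilon> j * v))" using w_lower(3)[of "\<epsilon> j * v" j] by (simp add: c_def)
        from cmod_sq_bounds[OF c \<epsilon>(1) w_lower(1) this]
        have b: "(\<epsilon> j)^2 / (cmod (w j (\<epsilon> j * v)))^2 \<le> (1 + 1 / c^2) * inverse (1 + v^2)" using \<epsilon>(1)[of j] by simp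
        have "E a (\<epsilon> j * v) \<le> 1" by (simp add: E_def)
        then have "norm (g j v) \<le> 1 * 1 * ((\<epsilon> j)^2 / (cmod (w j (\<epsilon> j * v)))^2)"
          unfolding g_def real_norm_def abs_mult using True E_pos[of a "\<epsilon> j * v"]
          by (intro mult_mono) (auto simp: abs_mult)
        then show ?thesis using b by simp
      next
        case False
        then show ?thesis using rhs by (simp add: g_def)
      qed
    qed
    show "AE v in lborel. (\<lambda>j. g j v) \<longlonglongrightarrow> inverse (1 + (m * v)^2)"
    proof (intro AE_I2)
      fix v :: real
      have ev: "(\<lambda>j. \<epsilon> j * v) \<longlonglongrightarrow> 0" using tendsto_mult_left_zero[OF \<epsilon>(3)] .
      \<comment> \<open>Since w = \<epsilon> + \<rho> (1 - f), dividing by \<epsilon> and using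
        \<open>f_quotient\<close> gives the limit 1 + i m v.\<close>
      have "(\<lambda>j. 1 - of_real (\<rho> j) * f (\<epsilon> j * v)) = (\<lambda>j. of_real (\<epsilon> j) + of_real (\<rho> j) * (1 - f (\<epsilon> j * v)))"
        by (simp add: \<rho>_def algebra_simps)
      then have we: "w j (\<epsilon> j * v) / of_real (\<epsilon> j) = 1 + of_real (\<rho> j) * ((1 - f (\<epsilon> j * v)) / of_real (\<epsilon> j))" for j
        using \<epsilon>(1)[of j] unfolding w_def by (simp add: fun_eq_iff add_divide_distrib)
      have fl: "filterlim \<epsilon> (at 0) sequentially"
        using \<epsilon>(1,3) by (auto simp: filterlim_at intro!: always_eventually) (metis less_irrefl)
      have "(\<lambda>j. 1 + of_real (\<rho> j) * ((1 - f (\<epsilon> j * v)) / of_real (\<epsilon> j))) \<longlonglongrightarrow> 1 + of_real 1 * (\<i> * of_real (m * v))"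
        by (intro tendsto_intros \<rho>(5) filterlim_compose[OF f_quotient fl])
      then have "(\<lambda>j. cmod (w j (\<epsilon> j * v) / of_real (\<epsilon> j))) \<longlonglongrightarrow> cmod (1 + of_real 1 * (\<i> * of_real (m * v)))"
        unfolding we by (rule tendsto_norm)
      then have "(\<lambda>j. inverse ((cmod (w j (\<epsilon> j * v) / of_real (\<epsilon> j)))^2)) \<longlonglongrightarrow> inverse ((cmod (1 + of_real 1 * (\<i> * of_real (m * v))))^2)"
        by (intro tendsto_inverse tendsto_power) (auto simp: complex_eq_iff)
      moreover have "(cmod (1 + of_real 1 * (\<i> * of_real (m * v))))^2 = 1 + (m * v)^2" by (simp add: cmod_power2)
      moreover have "inverse ((cmod (w j (\<epsilon> j * v) / of_real (\<epsilon> j)))^2) = (\<epsilon> j)^2 / (cmod (w j (\<epsilon> j * v)))^2" for j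
        using \<epsilon>(1)[of j] by (simp add: norm_divide power_divide inverse_eq_divide)
      ultimately have l3: "(\<lambda>j. (\<epsilon> j)^2 / (cmod (w j (\<epsilon> j * v)))^2) \<longlonglongrightarrow> inverse (1 + (m * v)^2)" by simp
      have "eventually (\<lambda>j. \<bar>\<epsilon> j * v\<bar> < \<eta>) sequentially" using tendstoD[OF ev \<eta>] by simp
      then have "eventually (\<lambda>j. indicat_real {-\<eta>..\<eta>} (\<epsilon> j * v) = 1) sequentially" by eventually_elim (auto simp: indicator_def)
      then have l2: "(\<lambda>j. indicat_real {-\<eta>..\<eta>} (\<epsilon> j * v)) \<longlonglongrightarrow> 1" by (rule tendsto_eventually)
      have "(\<lambda>j. E a (\<epsilon> j * v) * cos (\<epsilon> j * v * x)) \<longlonglongrightarrow> exp (- (a^2 * 0^2 / 2)) * cos (0 * x)"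
        unfolding E_def by (intro tendsto_intros ev) auto
      then have l1: "(\<lambda>j. E a (\<epsilon> j * v) * cos (\<epsilon> j * v * x)) \<longlonglongrightarrow> 1" by simp
      from tendsto_mult[OF l1 tendsto_mult[OF l2 l3]]
      show "(\<lambda>j. g j v) \<longlonglongrightarrow> inverse (1 + (m * v)^2)" by (simp add: g_def)
    qed
  qed (use gm in auto)
  also have "(LINT v|lborel. inverse (1 + (m * v)^2)) = pi / m"
  proof -
    have "pi = \<bar>m\<bar> *\<^sub>R (LINT v|lborel. inverse (1 + (0 + m * v)^2))"
      unfolding integral_inverse_sq[symmetric] using m_pos by (intro lborel_integral_real_affine) auto
    then show ?thesis using m_pos by (simp add: field_simps)
  qed
  finally show ?thesis unfolding sub .
qed

text \<open>\<open>P1 0 = 0\<close>, by division by zero.\<close>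

definition P1 :: "real \<Rightarrow> real" where "P1 t = Re (1 / (1 - f t))"

lemma P1_eq: "P1 t = (1 - Re (f t)) / (cmod (1 - f t))^2"
  unfolding P1_def by (simp add: Re_divide cmod_power2)

lemma P1_nonneg: "0 \<le> P1 t"
  unfolding P1_eq using Re_f_le[of t] by (intro divide_nonneg_nonneg) auto

lemma P1_meas [measurable]: "P1 \<in> borel_measurable borel"
  unfolding P1_def by measurable

lemma p_w: "p (\<rho> j) t = (\<epsilon> j + \<rho> j * (1 - Re (f t))) / (cmod (w j t))^2"
  unfolding p_eq w_def by (simp add: \<rho>_def)

text \<open>Near the origin the remainder carries the factor 1 - Re f, which is integrable against
  1/t^2.\<close>

lemma p_minus_spike: "p (\<rho> j) t - spike \<eta> j t = (if \<bar>t\<bar> \<le> \<eta> then \<rho> j * (1 - Re (f t)) / (cmod (w j t))^2 else p (\<rho> j) t)"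
  by (auto simp: p_w spike_def indicator_def abs_le_iff add_divide_distrib)

text \<open>Dominated convergence as \<rho> tends to 1. Near 0 the majorant is a multiple of (1 - Re
  f)/t^2, integrable thanks to the first moment; for \<eta> \<le> |t| \<le> T continuity and f
  \<noteq> 1 bound 1/|w|.\<close>

lemma regular_part:
  assumes a: "a > 0" and \<eta>: "\<eta> > 0" "\<eta> \<le> T" and Im: "\<And>t. \<bar>t\<bar> \<le> \<eta> \<Longrightarrow> m / 2 * \<bar>t\<bar> \<le> \<bar>Im (f t)\<bar>"
  shows "(\<lambda>j. LINT t|lborel. E a t * cos (t * x) * (indicator {-T..T} t * (p (\<rho> j) t - spike \<eta> j t)))
      \<longlonglongrightarrow> (LINT t|lborel. cos (t * x) * (E a t * (indicator {-T..T} t * P1 t)))"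
    and "integrable lborel (\<lambda>t. E a t * (indicator {-T..T} t * P1 t))"
proof -
  let ?A = "{-T..-\<eta>} \<union> {\<eta>..T}"
  have 1: "compact ?A" by (intro compact_Un compact_Icc)
  have 2: "?A \<noteq> {}" using \<eta> by auto
  have "continuous_on ?A f" by (rule continuous_on_subset[OF f_cont]) simp
  then have 3: "continuous_on ?A (\<lambda>t. cmod (1 - f t))" by (intro continuous_intros)
  obtain t0 where t0: "t0 \<in> ?A" "\<And>t. t \<in> ?A \<Longrightarrow> cmod (1 - f t0) \<le> cmod (1 - f t)"
    using continuous_attains_inf[OF 1 2 3] by metis
  \<comment> \<open>t0 minimises |1 - f| on the compact set; the factor 2 is the loss in
    \<open>w_lower\<close>.\<close>
  define K where "K = 2 / cmod (1 - f t0)"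
  have "f t0 \<noteq> 1" using t0(1) \<eta> by (intro f_ne_1) auto
  then have k0: "0 < cmod (1 - f t0)" by simp
  have K0: "0 < K" using k0 by (simp add: K_def)
  have Kb: "1 / cmod (w j t) \<le> K" if "t \<in> ?A" for j t
  proof -
    have "cmod (1 - f t0) / 2 \<le> cmod (w j t)" using t0(2)[OF that] w_lower(2)[of t j] by linarith
    then have "1 / cmod (w j t) \<le> 1 / (cmod (1 - f t0) / 2)" using k0 w_pos by (intro divide_left_mono mult_pos_pos) auto
    then show ?thesis by (simp add: K_def)
  qed
  \<comment> \<open>16/m^2 is the square of 4/m, from |w| \<ge> (m/4) |t| for |t| \<le>
    \<eta>.\<close>
  define dom where "dom t = 16 / m^2 * ((1 - Re (f t)) / t^2) + indicator {-T..T} t * K" for t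
  have domi: "integrable lborel dom"
    unfolding dom_def by (intro Bochner_Integration.integrable_add integrable_mult_right integrable_mult_left integrable_Re_f integrable_real_indicator) (auto simp: emeasure_lborel_Icc_eq)
  have dnn: "0 \<le> (1 - Re (f t)) / t^2" for t using Re_f_le[of t] by (intro divide_nonneg_nonneg) auto
  have dom0: "0 \<le> dom t" for t unfolding dom_def using dnn K0 by (intro add_nonneg_nonneg mult_nonneg_nonneg) (auto simp: indicator_def)
  have near: "(1 - Re (f t)) / W^2 \<le> 16 / m^2 * ((1 - Re (f t)) / t^2)" if "\<bar>t\<bar> \<le> \<eta>" "\<bar>Im (f t)\<bar> / 2 \<le> W" for t W
  proof (cases "t = 0")
    case True then show ?thesis by (simp add: f_0)
  next
    case False
    have W: "m / 4 * \<bar>t\<bar> \<le> W" using Im[OF that(1)] that(2) by linarith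
    have p: "0 < m / 4 * \<bar>t\<bar>" using False m_pos by simp
    have sq: "(m / 4 * \<bar>t\<bar>)^2 \<le> W^2" using W less_imp_le[OF p] by (rule power_mono)
    have "0 < W^2 * (m / 4 * \<bar>t\<bar>)^2" by (rule mult_pos_pos[OF zero_less_power[OF less_le_trans[OF p W]] zero_less_power[OF p]])
    then have "(1 - Re (f t)) / W^2 \<le> (1 - Re (f t)) / (m / 4 * \<bar>t\<bar>)^2"
      using Re_f_le[of t] by (intro divide_left_mono[OF sq]) auto
    also have "\<dots> = 16 / m^2 * ((1 - Re (f t)) / t^2)" by (simp add: power_mult_distrib power_divide)
    finally show ?thesis .
  qed
  have bound: "\<bar>indicator {-T..T} t * (p (\<rho> j) t - spike \<eta> j t)\<bar> \<le> dom t" for j t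
  proof (cases "t \<in> {-T..T}")
    case False then show ?thesis using dom0 by simp
  next
    case T: True
    show ?thesis
    proof (cases "\<bar>t\<bar> \<le> \<eta>")
      case True
      define v where "v = (1 - Re (f t)) / (cmod (w j t))^2"
      have eq: "p (\<rho> j) t - spike \<eta> j t = \<rho> j * v" using True by (simp add: p_minus_spike v_def)
      have v0: "0 \<le> v" unfolding v_def using Re_f_le[of t] by (intro divide_nonneg_nonneg) auto
      have "\<rho> j * v \<le> 1 * v" using \<rho>(4) v0 by (rule mult_right_mono)
      also have "1 * v \<le> 16 / m^2 * ((1 - Re (f t)) / t^2)"
        unfolding v_def mult_1 using True w_lower(3) by (rule near)
      also have "\<dots> \<le> dom t" using T K0 by (simp add: dom_def)
      finally have "\<rho> j * v \<le> dom t" .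
      moreover have "0 \<le> \<rho> j * v" using \<rho>(2) v0 by (rule mult_nonneg_nonneg)
      ultimately show ?thesis using T by (simp add: eq)
    next
      case False
      then have A: "t \<in> ?A" using T by auto
      have "p (\<rho> j) t \<le> cmod (1 / w j t)" unfolding p_def w_def by (rule complex_Re_le_cmod)
      also have "\<dots> \<le> K" using Kb[OF A] by (simp add: norm_divide)
      also have "K \<le> dom t" using T mult_nonneg_nonneg[OF _ dnn[of t], of "16 / m^2"] by (simp add: dom_def)
      finally have "p (\<rho> j) t \<le> dom t" .
      moreover have "p (\<rho> j) t - spike \<eta> j t = p (\<rho> j) t" using False by (simp add: p_minus_spike)
      moreover have "0 \<le> p (\<rho> j) t" using \<rho> by (intro p_nonneg) auto
      ultimately show ?thesis using T by simp
    qed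
  qed
  have lim: "(\<lambda>j. p (\<rho> j) t - spike \<eta> j t) \<longlonglongrightarrow> P1 t" if t: "t \<noteq> 0" for t
  proof -
    have wl: "(\<lambda>j. w j t) \<longlonglongrightarrow> 1 - of_real 1 * f t" unfolding w_def by (intro tendsto_intros \<rho>(5))
    have nz: "1 - f t \<noteq> 0" using f_ne_1[OF t] by simp
    show ?thesis
    proof (cases "\<bar>t\<bar> \<le> \<eta>")
      case True
      have "(\<lambda>j. \<rho> j * (1 - Re (f t)) / (cmod (w j t))^2) \<longlonglongrightarrow> 1 * (1 - Re (f t)) / (cmod (1 - of_real 1 * f t))^2"
        using nz by (intro tendsto_intros \<rho>(5) wl) auto
      then show ?thesis using True by (simp add: p_minus_spike P1_eq)
    next
      case False
      have "(\<lambda>j. Re (1 / w j t)) \<longlonglongrightarrow> Re (1 / (1 - of_real 1 * f t))"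
        using nz by (intro tendsto_intros wl) auto
      moreover have "p (\<rho> j) t - spike \<eta> j t = Re (1 / w j t)" for j
        using False unfolding p_minus_spike by (simp add: p_def w_def)
      ultimately show ?thesis by (simp only: P1_def of_real_1 mult_1)
    qed
  qed
  have AE0: "AE t in lborel. t \<noteq> (0::real)" by (rule AE_lborel_singleton)
  show "integrable lborel (\<lambda>t. E a t * (indicator {-T..T} t * P1 t))"
  proof (rule Bochner_Integration.integrable_bound[OF domi])
    show "AE t in lborel. norm (E a t * (indicator {-T..T} t * P1 t)) \<le> norm (dom t)"
      using AE0
    proof eventually_elim
      case (elim t)
      have "(\<lambda>j. indicator {-T..T} t * (p (\<rho> j) t - spike \<eta> j t)) \<longlonglongrightarrow> indicator {-T..T} t * P1 t"
        by (intro tendsto_intros lim elim)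
      then have "(\<lambda>j. \<bar>indicator {-T..T} t * (p (\<rho> j) t - spike \<eta> j t)\<bar>) \<longlonglongrightarrow> \<bar>indicator {-T..T} t * P1 t\<bar>"
        by (rule tendsto_rabs)
      then have "\<bar>indicator {-T..T} t * P1 t\<bar> \<le> dom t" using bound by (intro LIMSEQ_le_const2) auto
      moreover have "E a t * \<bar>indicator {-T..T} t * P1 t\<bar> \<le> 1 * \<bar>indicator {-T..T} t * P1 t\<bar>"
        by (intro mult_right_mono) (auto simp: E_def)
      ultimately show ?case using E_pos[of a t] dom0[of t] by (simp add: abs_mult)
    qed
  qed measurable
  have "(\<lambda>j. LINT t|lborel. E a t * cos (t * x) * (indicator {-T..T} t * (p (\<rho> j) t - spike \<eta> j t)))
      \<longlonglongrightarrow> (LINT t|lborel. E a t * cos (t * x) * (indicator {-T..T} t * P1 t))"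
  proof (rule integral_dominated_convergence[OF _ _ domi])
    show "AE t in lborel. (\<lambda>j. E a t * cos (t * x) * (indicator {-T..T} t * (p (\<rho> j) t - spike \<eta> j t))) \<longlonglongrightarrow> E a t * cos (t * x) * (indicator {-T..T} t * P1 t)"
      using AE0 by eventually_elim (intro tendsto_intros lim)
    show "AE t in lborel. norm (E a t * cos (t * x) * (indicator {-T..T} t * (p (\<rho> j) t - spike \<eta> j t))) \<le> dom t" for j
    proof (intro AE_I2)
      fix t
      have "\<bar>E a t * cos (t * x)\<bar> * \<bar>indicator {-T..T} t * (p (\<rho> j) t - spike \<eta> j t)\<bar> \<le> 1 * dom t"
      proof (intro mult_mono bound)
        have "E a t * \<bar>cos (t * x)\<bar> \<le> 1 * 1" by (intro mult_mono) (auto simp: E_def)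
        then show "\<bar>E a t * cos (t * x)\<bar> \<le> 1" using E_pos[of a t] by (simp add: abs_mult)
      qed auto
      then show "norm (E a t * cos (t * x) * (indicator {-T..T} t * (p (\<rho> j) t - spike \<eta> j t))) \<le> dom t"
        by (simp add: abs_mult)
    qed
  qed measurable
  then show "(\<lambda>j. LINT t|lborel. E a t * cos (t * x) * (indicator {-T..T} t * (p (\<rho> j) t - spike \<eta> j t)))
      \<longlonglongrightarrow> (LINT t|lborel. cos (t * x) * (E a t * (indicator {-T..T} t * P1 t)))"
    by (simp add: mult_ac)
qed

text \<open>For large t nothing bounds 1 - f away from 0, so smallness must come from the Gaussian.
  It is split into two factors with parameter a / sqrt 2: outside [-T, T] one is at most exp (- a^2
  T^2 / 4), and the integral of the other against p is bounded uniformly in j by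
  \<open>V0_bound\<close>.\<close>

lemma tail_part:
  assumes a: "a > 0" and T: "T \<ge> 0"
  shows "\<bar>LINT t|lborel. E a t * ((1 - indicator {-T..T} t) * cos (t * x)) * p (\<rho> j) t\<bar> \<le> exp (- (a^2 * T^2 / 4)) * (2 * pi * U (a / sqrt 2) 0)"
proof -
  have a': "a / sqrt 2 > 0" using a by simp
  have p0: "0 \<le> p (\<rho> j) t" for t using \<rho>(2,4) by (rule p_nonneg)
  have gm: "(\<lambda>t. (1 - indicat_real {-T..T} t) * cos (t * x)) \<in> borel_measurable borel" by measurable
  have gb: "\<bar>(1 - indicat_real {-T..T} t) * cos (t * x)\<bar> \<le> 1" for t by (auto simp: indicator_def)
  have i1: "integrable lborel (\<lambda>t. E a t * ((1 - indicat_real {-T..T} t) * cos (t * x)) * p (\<rho> j) t)"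
    by (rule Ep_integrable[OF a \<rho>(2,3) gm gb])
  have i2: "integrable lborel (\<lambda>t. E (a / sqrt 2) t * 1 * p (\<rho> j) t)"
    by (rule Ep_integrable[OF a' \<rho>(2,3)]) auto
  have "\<bar>LINT t|lborel. E a t * ((1 - indicator {-T..T} t) * cos (t * x)) * p (\<rho> j) t\<bar>
    \<le> (LINT t|lborel. exp (- (a^2 * T^2 / 4)) * (E (a / sqrt 2) t * 1 * p (\<rho> j) t))"
  proof (rule order_trans[OF integral_abs_bound integral_mono[OF integrable_abs[OF i1] integrable_mult_right[OF i2]]])
    fix t
    show "\<bar>E a t * ((1 - indicat_real {-T..T} t) * cos (t * x)) * p (\<rho> j) t\<bar> \<le> exp (- (a^2 * T^2 / 4)) * (E (a / sqrt 2) t * 1 * p (\<rho> j) t)"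
    proof (cases "t \<in> {-T..T}")
      case True
      then show ?thesis using p0[of t] E_pos[of "a / sqrt 2" t] by simp
    next
      case False
      then have "T < \<bar>t\<bar>" by auto
      then have "T^2 \<le> t^2" using T by (metis abs_le_square_iff abs_of_nonneg less_imp_le)
      then have "a^2 * T^2 \<le> a^2 * t^2" by (intro mult_left_mono) auto
      then have "E a t \<le> exp (- (a^2 * T^2 / 4)) * E (a / sqrt 2) t"
        unfolding E_def exp_add[symmetric] by (simp add: power_divide)
      then have "E a t * \<bar>cos (t * x)\<bar> * p (\<rho> j) t \<le> (exp (- (a^2 * T^2 / 4)) * E (a / sqrt 2) t) * 1 * p (\<rho> j) t"
        using p0[of t] E_pos[of "a / sqrt 2" t] by (intro mult_right_mono mult_mono) auto
      then show ?thesis using False E_pos[of a t] p0[of t] by (simp add: abs_mult mult.assoc)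
    qed
  qed
  also have "\<dots> = exp (- (a^2 * T^2 / 4)) * (LINT t|lborel. E (a / sqrt 2) t * 1 * p (\<rho> j) t)"
    by (rule integral_mult_right_zero)
  also have "\<dots> \<le> exp (- (a^2 * T^2 / 4)) * (2 * pi * U (a / sqrt 2) 0)"
    using V0_bound[OF a' \<rho>(2,3), of j] by (intro mult_left_mono) auto
  finally show ?thesis .
qed

text \<open>Under a first moment alone only the real part of \<open>1 / (1 - f)\<close> is integrable at \<open>0\<close>, which forces the
  symmetrisation.\<close>

lemma U_symmetric_limit:
  assumes a: "a > 0"
  shows "((\<lambda>x. U a x + U a (- x)) \<longlongrightarrow> 1 / m) at_top"
proof -
  obtain \<eta> where \<eta>: "\<eta> > 0" and Im: "\<And>t. \<bar>t\<bar> \<le> \<eta> \<Longrightarrow> m / 2 * \<bar>t\<bar> \<le> \<bar>Im (f t)\<bar>"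
    using Im_f_lower by blast
  define G where "G T x = (LINT t|lborel. cos (t * x) * (E a t * (indicator {-T..T} t * P1 t)))" for T x
  define e where "e T = exp (- (a^2 * T^2 / 4)) * (2 * pi * U (a / sqrt 2) 0)" for T
  \<comment> \<open>The discounted integral is spike plus regular part plus tail; letting j tend to
    infinity keeps the tail bound \<open>e T\<close>, which does not depend on x.\<close>
  have main: "\<bar>pi * (U a x + U a (- x)) - pi / m - G T x\<bar> \<le> e T" if T: "\<eta> \<le> T" for T x
  proof -
    have T0: "T \<ge> 0" using T \<eta> by linarith
    let ?s = "\<lambda>j. LINT t|lborel. E a t * cos (t * x) * spike \<eta> j t"
    let ?r = "\<lambda>j. LINT t|lborel. E a t * cos (t * x) * (indicator {-T..T} t * (p (\<rho> j) t - spike \<eta> j t))"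
    let ?t = "\<lambda>j. LINT t|lborel. E a t * ((1 - indicator {-T..T} t) * cos (t * x)) * p (\<rho> j) t"
    let ?v = "\<lambda>j. LINT t|lborel. E a t * cos (t * x) * p (\<rho> j) t"
    have vi: "integrable lborel (\<lambda>t. E a t * cos (t * x) * p (\<rho> j) t)" for j
      by (rule Ep_integrable[OF a \<rho>(2,3)]) auto
    have ti: "integrable lborel (\<lambda>t. E a t * ((1 - indicat_real {-T..T} t) * cos (t * x)) * p (\<rho> j) t)" for j
      by (rule Ep_integrable[OF a \<rho>(2,3)]) (auto simp: indicator_def)
    have si: "integrable lborel (\<lambda>t. E a t * cos (t * x) * spike \<eta> j t)" for j
    proof -
      have sb: "\<bar>spike \<eta> j t\<bar> \<le> \<epsilon> j / (\<epsilon> j)^2" for t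
      proof -
        have "\<epsilon> j / (cmod (w j t))^2 \<le> \<epsilon> j / (\<epsilon> j)^2"
          using w_lower(1)[of j t] \<epsilon>(1)[of j] w_pos[of j t] by (intro divide_left_mono power_mono mult_pos_pos) auto
        then show ?thesis using \<epsilon>(1)[of j] by (auto simp: spike_def indicator_def)
      qed
      have b: "\<bar>cos (t * x) * spike \<eta> j t\<bar> \<le> \<epsilon> j / (\<epsilon> j)^2" for t
        using mult_mono[OF abs_cos_le_one[of "t * x"] sb[of t]] by (simp add: abs_mult)
      have "integrable lborel (\<lambda>t. of_real (E a t) * (cos (t * x) * spike \<eta> j t))"
        by (rule E_mult_integrable[OF a, where K = "\<epsilon> j / (\<epsilon> j)^2"]) (use b in auto)
      then show ?thesis by (simp add: mult.assoc)
    qed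
    have r_eq: "E a t * cos (t * x) * (indicat_real {-T..T} t * (p (\<rho> j) t - spike \<eta> j t))
       = E a t * cos (t * x) * p (\<rho> j) t - E a t * cos (t * x) * spike \<eta> j t - E a t * ((1 - indicat_real {-T..T} t) * cos (t * x)) * p (\<rho> j) t" for j t
    proof -
      have "indicat_real {-T..T} t * spike \<eta> j t = spike \<eta> j t" using T by (auto simp: spike_def indicator_def)
      then show ?thesis by (simp add: algebra_simps)
    qed
    have dec: "?r j = ?v j - ?s j - ?t j" for j
      unfolding r_eq
      by (subst Bochner_Integration.integral_diff[OF Bochner_Integration.integrable_diff[OF vi si] ti],
          subst Bochner_Integration.integral_diff[OF vi si]) (rule refl)
    have "(\<lambda>j. ?v j - ?s j - ?r j) \<longlonglongrightarrow> pi * (U a x + U a (- x)) - pi / m - G T x"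
      unfolding G_def
      by (intro tendsto_diff V_limit[OF a \<rho>(2,3,5)] spike_limit[OF a \<eta> Im] regular_part(1)[OF a \<eta> T Im]) auto
    then have "(\<lambda>j. \<bar>?v j - ?s j - ?r j\<bar>) \<longlonglongrightarrow> \<bar>pi * (U a x + U a (- x)) - pi / m - G T x\<bar>"
      by (rule tendsto_rabs)
    moreover have "\<bar>?v j - ?s j - ?r j\<bar> \<le> e T" for j
    proof -
      have "?v j - ?s j - ?r j = ?t j" unfolding dec by simp
      then show ?thesis unfolding e_def using tail_part[OF a T0, of x j] by simp
    qed
    ultimately show ?thesis by (intro LIMSEQ_le_const2) auto
  qed
  have RL: "((\<lambda>x. G T x) \<longlongrightarrow> 0) at_top" if T: "\<eta> \<le> T" for T
    unfolding G_def
  proof (rule riemann_lebesgue_cos)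
    show "integrable lborel (\<lambda>t. E a t * (indicator {-T..T} t * P1 t))" by (rule regular_part(2)[OF a \<eta> T Im])
    show "0 \<le> E a t * (indicator {-T..T} t * P1 t)" for t
      using E_pos[of a t] P1_nonneg[of t] by (auto simp: indicator_def)
    \<comment> \<open>The cut-off jumps at T and -T, and 1/(1 - f) is singular at 0.\<close>
    have "isCont (\<lambda>t. E a t * (indicator {-T..T} t * P1 t)) t" if t: "t \<notin> {0, T, -T}" for t
    proof -
      have "isCont f t" using f_cont by (simp add: continuous_on_eq_continuous_at)
      then have "isCont (\<lambda>t. 1 / (1 - f t)) t" using f_ne_1[of t] t by (intro isCont_divide isCont_diff continuous_const) auto
      then have P: "isCont P1 t" unfolding P1_def[abs_def] by (rule isCont_Re)
      have "t \<notin> frontier {-T..T}" using t by (auto simp: frontier_def)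
      then have I: "isCont (indicat_real {-T..T}) t" by (intro isCont_indicator[THEN iffD2])
      show ?thesis unfolding E_def using P I by (intro continuous_intros) auto
    qed
    moreover have "AE t in lborel. t \<notin> {0, T, -T}"
      by (intro AE_not_in finite_imp_null_set_lborel) auto
    ultimately show "AE t in lborel. isCont (\<lambda>t. E a t * (indicator {-T..T} t * P1 t)) t"
      by (auto elim: eventually_mono)
  qed
  have e0: "(e \<longlongrightarrow> 0) at_top"
  proof -
    have "((\<lambda>T. exp (- (a^2 * T^2 / 4))) \<longlongrightarrow> 0) at_top" using a by real_asymp
    then show ?thesis unfolding e_def[abs_def] by (rule tendsto_mult_left_zero)
  qed
  have "((\<lambda>x. pi * (U a x + U a (- x))) \<longlongrightarrow> pi / m) at_top"
  proof (rule tendstoI)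
    fix d :: real assume d: "d > 0"
    have "eventually (\<lambda>T. \<bar>e T\<bar> < d / 2) at_top" using tendstoD[OF e0, of "d / 2"] d by simp
    then have "eventually (\<lambda>T. \<bar>e T\<bar> < d / 2 \<and> \<eta> \<le> T) at_top" using eventually_ge_at_top[of \<eta>] by (rule eventually_conj)
    then obtain T where T: "\<bar>e T\<bar> < d / 2" "\<eta> \<le> T" by (auto simp: eventually_at_top_linorder)
    have "eventually (\<lambda>x. \<bar>G T x\<bar> < d / 2) at_top" using tendstoD[OF RL[OF T(2)], of "d / 2"] d by simp
    then show "eventually (\<lambda>x. dist (pi * (U a x + U a (- x))) (pi / m) < d) at_top"
    proof eventually_elim
      case (elim x)
      then show ?case using main[OF T(2), of x] T(1) unfolding dist_real_def by linarith
    qed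
  qed
  then have "((\<lambda>x. (1 / pi) * (pi * (U a x + U a (- x)))) \<longlongrightarrow> (1 / pi) * (pi / m)) at_top"
    by (intro tendsto_intros)
  then show ?thesis by simp
qed

text \<open>At minus infinity U decays exponentially, so the symmetrised limit belongs entirely to
  plus infinity.\<close>

lemma U_limit:
  assumes a: "a > 0"
  shows "(U a \<longlongrightarrow> 1 / m) at_top"
proof -
  obtain \<theta> D where th: "0 < \<theta>" "\<And>x. U a x \<le> D * exp (\<theta> * x)" using U_integrable_bound(2)[OF a] by blast
  have "((\<lambda>x. U a (- x)) \<longlongrightarrow> 0) at_top"
  proof (rule Lim_null_comparison)
    show "\<forall>\<^sub>F x in at_top. norm (U a (- x)) \<le> D * exp (- \<theta> * x)"
      using th(2)[of "- _"] U_nonneg[of a] by (intro always_eventually) simp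
    have "((\<lambda>x. exp (- \<theta> * x)) \<longlongrightarrow> 0) at_top" using th(1) by real_asymp
    then show "((\<lambda>x. D * exp (- \<theta> * x)) \<longlongrightarrow> 0) at_top" by (rule tendsto_mult_right_zero)
  qed
  from tendsto_diff[OF U_symmetric_limit[OF a] this] show ?thesis by simp
qed

section \<open>From Gaussian averages to Q\<close>

definition QN :: "real \<Rightarrow> real \<Rightarrow> real" where
  "QN a x = (LINT v|lborel. kexp v * U a (x - v))"

lemma kexp_integrable: "integrable lborel kexp" and kexp_integral: "(LINT v|lborel. kexp v) = 1"
proof -
  have AE: "AE v in lborel. kexp v = indicator {0<..} v *\<^sub>R exp (- 1 * v)"
    using AE_lborel_singleton[of 0] by eventually_elim (auto simp: kexp_def indicator_def)
  show "integrable lborel kexp"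
    using exp_tail_integral_real(1)[of 1 0] unfolding set_integrable_def by (subst integrable_cong_AE[OF _ _ AE]) auto
  have "(LINT v|lborel. kexp v) = (LINT v:{0<..}|lborel. exp (- 1 * v))"
    unfolding set_lebesgue_integral_def by (rule integral_cong_AE[OF _ _ AE]) measurable
  then show "(LINT v|lborel. kexp v) = 1" using exp_tail_integral_real(2)[of 1 0] by simp
qed

lemma U_meas [measurable]: "U a \<in> borel_measurable borel"
proof -
  interpret H: sigma_finite_measure H by (rule sigma_finite_H)
  show ?thesis unfolding U_def[abs_def] by measurable
qed

lemma kU_integrable:
  assumes a: "a > 0"
  shows "integrable lborel (\<lambda>v. kexp v * U a (x - v))"
  by (rule Bochner_Integration.integrable_bound[OF integrable_mult_right[OF kexp_integrable, of "2 * U a 0"]])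
     (use U_bounded[OF a] U_nonneg[of a] kexp_nonneg in \<open>auto simp: abs_mult mult.commute intro!: AE_I2 mult_left_mono\<close>)

lemma QN_limit:
  assumes a: "a > 0"
  shows "(QN a \<longlongrightarrow> 1 / m) at_top"
proof (rule tendsto_at_topI_sequentially)
  fix X :: "nat \<Rightarrow> real" assume X: "filterlim X at_top sequentially"
  have "(\<lambda>n. QN a (X n)) \<longlonglongrightarrow> (LINT v|lborel. kexp v * (1 / m))"
    unfolding QN_def
  proof (rule integral_dominated_convergence[where w = "\<lambda>v. 2 * U a 0 * kexp v"])
    show "integrable lborel (\<lambda>v. 2 * U a 0 * kexp v)" by (rule integrable_mult_right[OF kexp_integrable])
    show "AE v in lborel. (\<lambda>n. kexp v * U a (X n - v)) \<longlonglongrightarrow> kexp v * (1 / m)"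
    proof (intro AE_I2 tendsto_mult tendsto_const)
      fix v
      have "filterlim (\<lambda>n. X n - v) at_top sequentially"
        using filterlim_tendsto_add_at_top[OF tendsto_const[of "- v"] X] by simp
      then show "(\<lambda>n. U a (X n - v)) \<longlonglongrightarrow> 1 / m" by (rule filterlim_compose[OF U_limit[OF a]])
    qed
    show "AE v in lborel. norm (kexp v * U a (X n - v)) \<le> 2 * U a 0 * kexp v" for n
      using U_bounded[OF a] U_nonneg[of a] kexp_nonneg
      by (intro AE_I2) (simp add: abs_mult mult.commute mult_left_mono)
  qed auto
  then show "(\<lambda>n. QN a (X n)) \<longlonglongrightarrow> 1 / m" by (simp add: kexp_integral integral_mult_left_zero)
qed

text \<open>By Tonelli the two smoothings commute: the Gaussian average of Q is the exponential
  average of U. In the second form the limit follows by dominated convergence from that of the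
  bounded function U.\<close>

lemma QN_eq:
  assumes a: "a > 0"
  shows "(\<integral>\<^sup>+y. ennreal (normal_density 0 a (x - y) * Q y) \<partial>lborel) = ennreal (QN a x)"
proof -
  interpret HL: pair_sigma_finite H lborel by (simp add: pair_sigma_finite_def sigma_finite_H sigma_finite_lborel)
  interpret LH: pair_sigma_finite lborel H by (simp add: pair_sigma_finite_def sigma_finite_H sigma_finite_lborel)
  have "(\<integral>\<^sup>+y. ennreal (normal_density 0 a (x - y) * Q y) \<partial>lborel) = (\<integral>\<^sup>+y. \<integral>\<^sup>+z. ennreal (normal_density 0 a (x - y) * kexp (y - z)) \<partial>H \<partial>lborel)"
  proof (rule nn_integral_cong)
    fix y :: real
    have "ennreal (normal_density 0 a (x - y) * Q y) = ennreal (normal_density 0 a (x - y)) * (\<integral>\<^sup>+z. ennreal (kexp (y - z)) \<partial>H)"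
      unfolding ennreal_Q[symmetric] by (rule ennreal_mult) (auto simp: Q_nonneg)
    also have "\<dots> = (\<integral>\<^sup>+z. ennreal (normal_density 0 a (x - y) * kexp (y - z)) \<partial>H)"
      by (simp add: nn_integral_cmult[symmetric] ennreal_mult kexp_nonneg)
    finally show "ennreal (normal_density 0 a (x - y) * Q y) = (\<integral>\<^sup>+z. ennreal (normal_density 0 a (x - y) * kexp (y - z)) \<partial>H)" .
  qed
  also have "\<dots> = (\<integral>\<^sup>+z. \<integral>\<^sup>+y. ennreal (normal_density 0 a (x - y) * kexp (y - z)) \<partial>lborel \<partial>H)"
    by (rule LH.Fubini'[symmetric]) measurable
  also have "\<dots> = (\<integral>\<^sup>+z. \<integral>\<^sup>+v. ennreal (normal_density 0 a (x - v - z) * kexp v) \<partial>lborel \<partial>H)"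
  proof (rule nn_integral_cong)
    fix z :: real
    have "(\<integral>\<^sup>+y. ennreal (normal_density 0 a (x - y) * kexp (y - z)) \<partial>lborel)
      = ennreal \<bar>1\<bar> * (\<integral>\<^sup>+v. ennreal (normal_density 0 a (x - (z + 1 * v)) * kexp (z + 1 * v - z)) \<partial>lborel)"
      by (rule nn_integral_real_affine) auto
    then show "(\<integral>\<^sup>+y. ennreal (normal_density 0 a (x - y) * kexp (y - z)) \<partial>lborel) = (\<integral>\<^sup>+v. ennreal (normal_density 0 a (x - v - z) * kexp v) \<partial>lborel)"
      by (simp add: algebra_simps)
  qed
  also have "\<dots> = (\<integral>\<^sup>+v. \<integral>\<^sup>+z. ennreal (normal_density 0 a (x - v - z) * kexp v) \<partial>H \<partial>lborel)"
    by (rule HL.Fubini'[symmetric]) measurable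
  also have "\<dots> = (\<integral>\<^sup>+v. ennreal (kexp v * U a (x - v)) \<partial>lborel)"
  proof (rule nn_integral_cong)
    fix v :: real
    have "(\<integral>\<^sup>+z. ennreal (normal_density 0 a (x - v - z) * kexp v) \<partial>H) = ennreal (LINT z|H. normal_density 0 a (x - v - z) * kexp v)"
      by (rule nn_integral_eq_integral[OF integrable_mult_left[OF U_integrable_bound(1)[OF a]]]) (auto simp: kexp_nonneg)
    also have "(LINT z|H. normal_density 0 a (x - v - z) * kexp v) = kexp v * U a (x - v)"
      unfolding U_def by (subst integral_mult_left_zero) (rule mult.commute)
    finally show "(\<integral>\<^sup>+z. ennreal (normal_density 0 a (x - v - z) * kexp v) \<partial>H) = ennreal (kexp v * U a (x - v))" .
  qed
  also have "\<dots> = ennreal (QN a x)"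
    unfolding QN_def by (rule nn_integral_eq_integral[OF kU_integrable[OF a]]) (auto simp: kexp_nonneg U_nonneg)
  finally show ?thesis .
qed

lemma QN_integral:
  assumes a: "a > 0"
  shows "integrable lborel (\<lambda>y. normal_density 0 a (x - y) * Q y)" and "(LINT y|lborel. normal_density 0 a (x - y) * Q y) = QN a x"
proof -
  have nn: "0 \<le> QN a x" unfolding QN_def by (intro integral_nonneg_AE AE_I2 mult_nonneg_nonneg kexp_nonneg U_nonneg)
  show "integrable lborel (\<lambda>y. normal_density 0 a (x - y) * Q y)"
    using QN_eq[OF a, of x] by (intro integrableI_nonneg) (auto simp: Q_nonneg)
  show "(LINT y|lborel. normal_density 0 a (x - y) * Q y) = QN a x"
    using nn QN_eq[OF a, of x] by (subst integral_eq_nn_integral) (auto simp: Q_nonneg)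
qed

text \<open>Chebyshev: standard deviation h^2 means variance h^4, so a window of half-width h leaves
  mass at most h^4 / h^2 = h^2 outside.\<close>

lemma normal_mass:
  assumes h: "h > 0"
  shows "1 - h^2 \<le> (LINT v|lborel. normal_density 0 (h^2) v * indicator {-h..h} v)"
    and "(LINT v|lborel. normal_density 0 (h^2) v * (1 - indicator {-h..h} v)) \<le> h^2"
proof -
  have h2: "0 < h^2" using h by simp
  have i0: "integrable lborel (normal_density 0 (h^2))" by (rule integrable_normal_density[OF h2])
  have i1: "integrable lborel (\<lambda>v. normal_density 0 (h^2) v * (1 - indicat_real {-h..h} v))"
    by (rule Bochner_Integration.integrable_bound[OF i0]) (auto simp: indicator_def)
  have i2: "integrable lborel (\<lambda>v. normal_density 0 (h^2) v * v^2)"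
    using integrable_normal_moment[OF h2, of 0 2] by simp
  have m2: "(LINT v|lborel. normal_density 0 (h^2) v * v^2) = h^4"
    using has_bochner_integral_integral_eq[OF normal_moment_even[OF h2, of 0 1]] by (simp add: fact_numeral power2_eq_square power4_eq_xxxx)
  have "(LINT v|lborel. normal_density 0 (h^2) v * (1 - indicat_real {-h..h} v)) \<le> (LINT v|lborel. (1 / h^2) * (normal_density 0 (h^2) v * v^2))"
  proof (rule integral_mono[OF i1 integrable_mult_right[OF i2]])
    fix v
    show "normal_density 0 (h^2) v * (1 - indicat_real {-h..h} v) \<le> (1 / h^2) * (normal_density 0 (h^2) v * v^2)"
    proof (cases "v \<in> {-h..h}")
      case False
      then have "h \<le> \<bar>v\<bar>" by auto
      then have "h^2 \<le> v^2" using h by (metis abs_le_square_iff abs_of_pos)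
      then have "1 \<le> v^2 / h^2" using h2 by simp
      then have "normal_density 0 (h^2) v * 1 \<le> normal_density 0 (h^2) v * (v^2 / h^2)" by (intro mult_left_mono) auto
      then show ?thesis using False by simp
    qed simp
  qed
  also have "\<dots> = (1 / h^2) * h^4" by (simp only: integral_mult_right_zero m2)
  also have "\<dots> = h^2" using h by (simp add: power2_eq_square power4_eq_xxxx)
  finally show 2: "(LINT v|lborel. normal_density 0 (h^2) v * (1 - indicator {-h..h} v)) \<le> h^2" .
  have "(LINT v|lborel. normal_density 0 (h^2) v * indicat_real {-h..h} v) = (LINT v|lborel. normal_density 0 (h^2) v - normal_density 0 (h^2) v * (1 - indicat_real {-h..h} v))"
    by (simp add: algebra_simps)
  also have "\<dots> = 1 - (LINT v|lborel. normal_density 0 (h^2) v * (1 - indicat_real {-h..h} v))"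
    by (subst Bochner_Integration.integral_diff[OF i0 i1]) (simp add: integral_normal_density[OF h2])
  finally show "1 - h^2 \<le> (LINT v|lborel. normal_density 0 (h^2) v * indicator {-h..h} v)" using 2 by linarith
qed

lemma QN_shift:
  assumes a: "a > 0"
  shows "integrable lborel (\<lambda>v. normal_density 0 a v * Q (x - v))" and "(LINT v|lborel. normal_density 0 a v * Q (x - v)) = QN a x"
proof -
  show "integrable lborel (\<lambda>v. normal_density 0 a v * Q (x - v))"
    using lborel_integrable_real_affine[OF QN_integral(1)[OF a, of x], of "-1" x] by simp
  show "(LINT v|lborel. normal_density 0 a v * Q (x - v)) = QN a x"
    unfolding QN_integral(2)[OF a, symmetric]
    using lborel_integral_real_affine[of "-1" "\<lambda>y. normal_density 0 a (x - y) * Q y" x] by simp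
qed

lemma Q_compare: "x \<le> y \<Longrightarrow> Q x \<le> exp (y - x) * Q y"
proof -
  assume "x \<le> y"
  from exp_Q_mono[OF this] have "exp (- x) * (exp x * Q x) \<le> exp (- x) * (exp y * Q y)" by (intro mult_left_mono) auto
  then show ?thesis by (simp add: exp_minus exp_diff field_simps)
qed

text \<open>Since \<open>e\<^sup>x Q x\<close> is nondecreasing, \<open>Q\<close> is squeezed between its Gaussian averages over windows of width \<open>2 h\<close>.\<close>

lemma Q_upper:
  assumes h: "h > 0" "h < 1"
  shows "(1 - h^2) * Q x \<le> exp (2 * h) * QN (h^2) (x + h)"
proof -
  let ?N = "normal_density 0 (h^2)"
  have h2: "0 < h^2" using h by simp
  have iI: "integrable lborel (\<lambda>v. ?N v * indicat_real {-h..h} v)"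
    by (rule Bochner_Integration.integrable_bound[OF integrable_normal_density[OF h2, of 0]]) (auto simp: indicator_def)
  have "(1 - h^2) * Q x \<le> (LINT v|lborel. ?N v * indicator {-h..h} v) * Q x"
    by (rule mult_right_mono[OF normal_mass(1)[OF h(1)] Q_nonneg])
  also have "\<dots> = (LINT v|lborel. ?N v * indicator {-h..h} v * Q x)" by (rule integral_mult_left_zero[symmetric])
  \<comment> \<open>For |v| \<le> h the point x + h - v lies in [x, x + 2h], where Q is at least
    e^{-2h} Q x.\<close>
  also have "\<dots> \<le> (LINT v|lborel. exp (2 * h) * (?N v * Q (x + h - v)))"
  proof (rule integral_mono[OF integrable_mult_left[OF iI] integrable_mult_right[OF QN_shift(1)[OF h2]]])
    fix v
    show "?N v * indicat_real {-h..h} v * Q x \<le> exp (2 * h) * (?N v * Q (x + h - v))"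
    proof (cases "v \<in> {-h..h}")
      case True
      then have "Q x \<le> exp (x + h - v - x) * Q (x + h - v)" by (intro Q_compare) auto
      also have "\<dots> \<le> exp (2 * h) * Q (x + h - v)" using True Q_nonneg by (intro mult_right_mono) auto
      finally have "?N v * Q x \<le> ?N v * (exp (2 * h) * Q (x + h - v))" by (intro mult_left_mono) auto
      then show ?thesis using True by (simp add: mult_ac)
    next
      case False
      then show ?thesis using Q_nonneg by simp
    qed
  qed
  also have "\<dots> = exp (2 * h) * QN (h^2) (x + h)"
    by (simp only: integral_mult_right_zero QN_shift(2)[OF h2])
  finally show ?thesis .
qed

text \<open>The window now lies in [x - 2h, x]. The mass outside it is controlled only by a bound K
  on Q, hence the hypothesis; \<open>Q_bounded\<close> supplies K from \<open>Q_upper\<close>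
  alone.\<close>

lemma Q_lower:
  assumes h: "h > 0" and K: "\<And>y. Q y \<le> K"
  shows "QN (h^2) (x - h) \<le> exp (2 * h) * Q x + K * h^2"
proof -
  let ?N = "normal_density 0 (h^2)"
  have h2: "0 < h^2" using h by simp
  have K0: "0 \<le> K" using K[of 0] Q_nonneg[of 0] by linarith
  have i1: "integrable lborel (\<lambda>v. ?N v * (1 - indicat_real {-h..h} v))"
    by (rule Bochner_Integration.integrable_bound[OF integrable_normal_density[OF h2, of 0]]) (auto simp: indicator_def)
  have i0: "integrable lborel ?N" by (rule integrable_normal_density[OF h2])
  have "QN (h^2) (x - h) = (LINT v|lborel. ?N v * Q (x - h - v))" by (rule QN_shift(2)[OF h2, symmetric])
  also have "\<dots> \<le> (LINT v|lborel. (exp (2 * h) * Q x) * ?N v + K * (?N v * (1 - indicat_real {-h..h} v)))"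
  proof (rule integral_mono[OF QN_shift(1)[OF h2] Bochner_Integration.integrable_add[OF integrable_mult_right[OF i0] integrable_mult_right[OF i1]]])
    fix v
    show "?N v * Q (x - h - v) \<le> (exp (2 * h) * Q x) * ?N v + K * (?N v * (1 - indicat_real {-h..h} v))"
    proof (cases "v \<in> {-h..h}")
      case True
      then have "Q (x - h - v) \<le> exp (x - (x - h - v)) * Q x" by (intro Q_compare) auto
      also have "\<dots> \<le> exp (2 * h) * Q x" using True Q_nonneg by (intro mult_right_mono) auto
      finally have "?N v * Q (x - h - v) \<le> ?N v * (exp (2 * h) * Q x)" by (intro mult_left_mono) auto
      then show ?thesis using True by (simp add: mult_ac)
    next
      case False
      have "?N v * Q (x - h - v) \<le> ?N v * K" using K by (intro mult_left_mono) auto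
      moreover have "0 \<le> (exp (2 * h) * Q x) * ?N v" using Q_nonneg by simp
      ultimately show ?thesis using False by (simp add: mult.commute)
    qed
  qed
  also have "\<dots> = (exp (2 * h) * Q x) * 1 + K * (LINT v|lborel. ?N v * (1 - indicat_real {-h..h} v))"
    by (subst Bochner_Integration.integral_add[OF integrable_mult_right[OF i0] integrable_mult_right[OF i1]])
       (simp only: integral_mult_right_zero integral_normal_density[OF h2])
  also have "\<dots> \<le> exp (2 * h) * Q x + K * h^2"
    using mult_left_mono[OF normal_mass(2)[OF h] K0] by simp
  finally show ?thesis .
qed

text \<open>\<open>Q_upper\<close> at one fixed window size already gives boundedness, because the
  averages \<open>QN\<close> inherit the bound of \<open>U\<close>.\<close>

lemma Q_bounded: "\<exists>K. \<forall>y. Q y \<le> K"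
proof -
  define h :: real where "h = 1/2"
  have h: "h > 0" "h < 1" "0 < h^2" by (auto simp: h_def)
  have "QN (h^2) y \<le> 2 * U (h^2) 0" for y
  proof -
    have "QN (h^2) y \<le> (LINT v|lborel. (2 * U (h^2) 0) * kexp v)"
      unfolding QN_def
      by (rule integral_mono[OF kU_integrable[OF h(3)] integrable_mult_right[OF kexp_integrable]])
         (use U_bounded[OF h(3)] kexp_nonneg in \<open>simp add: mult.commute mult_left_mono\<close>)
    then show ?thesis by (simp only: integral_mult_right_zero kexp_integral mult_1_right)
  qed
  then have "(1 - h^2) * Q x \<le> exp (2 * h) * (2 * U (h^2) 0)" for x
    by (intro order_trans[OF Q_upper[OF h(1,2)]] mult_left_mono) auto
  moreover have "1 - h^2 = 3/4" by (simp add: h_def power2_eq_square)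
  ultimately have "Q x \<le> exp (2 * h) * (2 * U (h^2) 0) * (4/3)" for x by (simp add: mult.commute)
  then show ?thesis by blast
qed

text \<open>The window size h is fixed first, small enough for both sides of the squeeze; only then
  does x tend to infinity, so \<open>QN_limit\<close> is needed at a single width.\<close>

theorem Q_limit: "(Q \<longlongrightarrow> 1 / m) at_top"
proof (rule tendstoI)
  fix d :: real assume d: "d > 0"
  obtain K where K: "\<And>y. Q y \<le> K" using Q_bounded by blast
  have c1: "((\<lambda>h. exp (2 * h) * (1 / m + h) / (1 - h^2)) \<longlongrightarrow> exp (2 * 0) * (1 / m + 0) / (1 - 0^2)) (at_right 0)"
    by (intro tendsto_intros) auto
  have c2: "((\<lambda>h. (1 / m - h - K * h^2) / exp (2 * h)) \<longlongrightarrow> (1 / m - 0 - K * 0^2) / exp (2 * 0)) (at_right 0)"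
    by (intro tendsto_intros) auto
  have "eventually (\<lambda>h. exp (2 * h) * (1 / m + h) / (1 - h^2) < 1 / m + d) (at_right 0)"
    by (rule order_tendstoD(2)[OF c1]) (use d in simp)
  moreover have "eventually (\<lambda>h. 1 / m - d < (1 / m - h - K * h^2) / exp (2 * h)) (at_right 0)"
    by (rule order_tendstoD(1)[OF c2]) (use d in simp)
  moreover have "eventually (\<lambda>h::real. 0 < h \<and> h < 1) (at_right 0)"
    unfolding eventually_at_right_field by (intro exI[of _ 1]) auto
  ultimately have "eventually (\<lambda>h. exp (2 * h) * (1 / m + h) / (1 - h^2) < 1 / m + d \<and>
     1 / m - d < (1 / m - h - K * h^2) / exp (2 * h) \<and> 0 < h \<and> h < 1) (at_right 0)"
    by eventually_elim auto
  then obtain h where h: "exp (2 * h) * (1 / m + h) / (1 - h^2) < 1 / m + d"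
      "1 / m - d < (1 / m - h - K * h^2) / exp (2 * h)" "0 < h" "h < 1"
    using eventually_happens'[OF trivial_limit_at_right_real] by blast
  have h2: "0 < h^2" "h^2 < 1" using h(3,4) by (auto simp: power_less_one_iff)
  have ev: "eventually (\<lambda>x. \<bar>QN (h^2) x - 1 / m\<bar> < h) at_top"
    using tendstoD[OF QN_limit[OF h2(1)] h(3)] by (simp add: dist_real_def)
  then obtain x0 where x0: "\<And>x. x \<ge> x0 \<Longrightarrow> \<bar>QN (h^2) x - 1 / m\<bar> < h" by (auto simp: eventually_at_top_linorder)
  have fin: "dist (Q x) (1 / m) < d" if x: "x \<ge> x0 + h" for x
  proof -
    have "QN (h^2) (x + h) \<le> 1 / m + h" using x0[of "x + h"] x h(3) by linarith
    then have "(1 - h^2) * Q x \<le> exp (2 * h) * (1 / m + h)"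
      using order_trans[OF Q_upper[OF h(3,4)] mult_left_mono] by simp
    then have "Q x \<le> exp (2 * h) * (1 / m + h) / (1 - h^2)" using h2 by (simp add: pos_le_divide_eq mult.commute)
    moreover have "1 / m - h \<le> QN (h^2) (x - h)" using x0[of "x - h"] x by linarith
    then have "1 / m - h - K * h^2 \<le> exp (2 * h) * Q x" using Q_lower[OF h(3) K, of x] by linarith
    then have "(1 / m - h - K * h^2) / exp (2 * h) \<le> Q x" by (simp add: pos_divide_le_eq mult.commute)
    ultimately show ?thesis using h(1,2) unfolding dist_real_def by linarith
  qed
  show "eventually (\<lambda>x. dist (Q x) (1 / m) < d) at_top"
    using eventually_ge_at_top[of "x0 + h"] by eventually_elim (rule fin)
qed

end

text \<open>Half the rate is given up for summability: with n the integer part of -Z the exponential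
  is at most e^{r(n+1)/2}, while P(Z \<le> -n) \<le> e^{-rn} from some n on, leaving a geometric
  series of ratio e^{-r/2}.\<close>

lemma left_tail_integrable:
  assumes M: "prob_space M" and Z [measurable]: "Z \<in> borel_measurable M" and r: "r > 0"
    and o: "(\<lambda>x. measure M {\<omega> \<in> space M. Z \<omega> \<le> x}) \<in> o[at_bot](\<lambda>x. exp (r * x))"
  shows "integrable M (\<lambda>\<omega>. exp (- (r / 2) * Z \<omega>))"
proof (rule integrableI_nonneg)
  interpret prob_space M by fact
  have "eventually (\<lambda>x. prob {\<omega> \<in> space M. Z \<omega> \<le> x} \<le> exp (r * x)) at_bot"
    using landau_o.smallD[OF o, of 1] by simp
  then obtain b where b: "\<And>x. x \<le> b \<Longrightarrow> prob {\<omega> \<in> space M. Z \<omega> \<le> x} \<le> exp (r * x)"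
    by (auto simp: eventually_at_bot_linorder)
  obtain N :: nat where N: "- b \<le> real N" using real_arch_simple by blast
  \<comment> \<open>The events are nested rather than disjoint; the sum only overestimates, and its
    single term at the integer part of -Z already dominates the exponential.\<close>
  let ?A = "\<lambda>n. if N \<le> n then {\<omega> \<in> space M. Z \<omega> \<le> - real n} else {}"
  let ?c = "\<lambda>n. exp (r / 2 * (real n + 1))"
  have A [measurable]: "?A n \<in> sets M" for n by auto
  have "(\<integral>\<^sup>+\<omega>. ennreal (exp (- (r / 2) * Z \<omega>)) \<partial>M) \<le> (\<integral>\<^sup>+\<omega>. ennreal (exp (r / 2 * N)) + (\<Sum>n. ennreal (?c n) * indicator (?A n) \<omega>) \<partial>M)"
  proof (rule nn_integral_mono)
    fix \<omega> assume w: "\<omega> \<in> space M"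
    show "ennreal (exp (- (r / 2) * Z \<omega>)) \<le> ennreal (exp (r / 2 * N)) + (\<Sum>n. ennreal (?c n) * indicator (?A n) \<omega>)"
    proof (cases "- real N \<le> Z \<omega>")
      case True
      then have "(r / 2) * (- Z \<omega>) \<le> r / 2 * N" using r by (intro mult_left_mono) auto
      then have "ennreal (exp (- (r / 2) * Z \<omega>)) \<le> ennreal (exp (r / 2 * N))" by (intro ennreal_leI) simp
      then show ?thesis by (rule add_increasing2[rotated]) simp
    next
      case False
      define n where "n = nat \<lfloor>- Z \<omega>\<rfloor>"
      have n: "real n \<le> - Z \<omega>" "- Z \<omega> \<le> real n + 1" using False by (auto simp: n_def)
      have nN: "N \<le> n" using False by (auto simp: n_def le_nat_floor)
      have "(r / 2) * (- Z \<omega>) \<le> r / 2 * (real n + 1)" using r n by (intro mult_left_mono) auto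
      then have "ennreal (exp (- (r / 2) * Z \<omega>)) \<le> ennreal (?c n)" by (intro ennreal_leI) simp
      also have "\<dots> = ennreal (?c n) * indicator (?A n) \<omega>" using nN n w by simp
      also have "\<dots> \<le> (\<Sum>n. ennreal (?c n) * indicator (?A n) \<omega>)"
      proof -
        define h where "h n = ennreal (?c n) * indicator (?A n) \<omega>" for n
        have "(\<Sum>n\<in>{n}. h n) \<le> (\<Sum>n. h n)" by (rule sum_le_suminf) auto
        then have "h n \<le> (\<Sum>n. h n)" by simp
        then show ?thesis unfolding h_def .
      qed
      finally show ?thesis by (rule add_increasing[rotated]) simp
    qed
  qed
  also have "\<dots> = ennreal (exp (r / 2 * N)) + (\<Sum>n. ennreal (?c n) * emeasure M (?A n))"
    by (subst nn_integral_add) (auto simp: emeasure_space_1 nn_integral_suminf nn_integral_cmult_indicator)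
  also have "(\<Sum>n. ennreal (?c n) * emeasure M (?A n)) \<le> (\<Sum>n. ennreal (exp (r / 2) * exp (- (r / 2)) ^ n))"
  proof (rule suminf_le)
    fix n
    have "ennreal (?c n) * emeasure M (?A n) = ennreal (?c n * prob (?A n))"
      by (simp only: emeasure_eq_measure ennreal_mult'' measure_nonneg)
    also have "\<dots> \<le> ennreal (exp (r / 2) * exp (- (r / 2)) ^ n)"
    proof (rule ennreal_leI)
      have "prob (?A n) \<le> exp (r * - real n)"
        using b[of "- real n"] N by auto
      then have "?c n * prob (?A n) \<le> ?c n * exp (r * - real n)" by (intro mult_left_mono) auto
      also have "\<dots> = exp (r / 2) * exp (- (r / 2)) ^ n"
      proof -
        have e: "r / 2 * (real n + 1) + r * - real n = r / 2 + real n * (- (r / 2))" by (simp add: field_simps)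
        show ?thesis unfolding exp_of_nat_mult[symmetric] exp_add[symmetric] e ..
      qed
      finally show "?c n * prob (?A n) \<le> exp (r / 2) * exp (- (r / 2)) ^ n" .
    qed
    finally show "ennreal (?c n) * emeasure M (?A n) \<le> ennreal (exp (r / 2) * exp (- (r / 2)) ^ n)" .
  qed auto
  also have "(\<Sum>n. ennreal (exp (r / 2) * exp (- (r / 2)) ^ n)) = ennreal (\<Sum>n. exp (r / 2) * exp (- (r / 2)) ^ n)"
    using r by (intro suminf_ennreal2 summable_mult summable_geometric) auto
  finally show "(\<integral>\<^sup>+\<omega>. ennreal (exp (- (r / 2) * Z \<omega>)) \<partial>M) < \<infinity>"
    by (rule le_less_trans) (auto simp: add_left_mono)
qed (use Z in auto)

section \<open>The two asymptotic statements\<close>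

context renewal_setting begin

lemma slow_conclusion:
  assumes Q: "(W.Q \<longlongrightarrow> 1 / W.m) at_top" and adm: "admissible \<alpha> c g"
  shows "((\<lambda>x. inverse (L_tilde L (exp x)) * (LINT z|W.H. renewal_integrand M B \<alpha> g x z))
          \<longlongrightarrow> \<alpha> / W.m * (LINT r:{1..}|lborel. g r * r powr (- \<alpha> - 1))) at_top"
proof (rule tendstoI)
  fix d :: real assume d: "d > 0"
  interpret A: admissible_fun \<alpha> c g by unfold_locales (rule R.\<alpha> adm)+
  let ?I = "\<lambda>x. LINT z|W.H. renewal_integrand M B \<alpha> g x z"
  define k1 where "k1 = A.sg + c"
  define k2 where "k2 = A.sg * (1 + 2 / \<alpha>) / W.m"
  have k: "0 \<le> k1" "0 \<le> k2" using A.sg_nonneg A.c_nonneg R.\<alpha> W.m_pos by (auto simp: k1_def k2_def)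
  \<comment> \<open>The summand 1 keeps the denominator positive when k1 and k2 vanish and makes (k1
    + k2) e < d strict.\<close>
  define e where "e = d / (2 * (k1 + k2 + 1))"
  have e: "e > 0" using d k by (simp add: e_def)
  have "(k1 + k2) * d < (2 * (k1 + k2 + 1)) * d" using d k by (intro mult_strict_right_mono) auto
  then have ek: "(k1 + k2) * e < d" using k by (simp add: e_def pos_divide_less_eq mult.commute)
  have "eventually (\<lambda>x. R.l x \<le> 1 * R.\<Lambda> x) at_top" by (rule R.l_little_o) simp
  then show "eventually (\<lambda>x. dist (inverse (L_tilde L (exp x)) * ?I x) (\<alpha> / W.m * (LINT r:{1..}|lborel. g r * r powr (- \<alpha> - 1))) < d) at_top"
    using R.l_little_o[OF e] err_slow[OF Q e]
  proof eventually_elim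
    case (elim x)
    have \<Lambda>: "0 < R.\<Lambda> x" using elim(1) R.l_pos[of x] by simp
    have "\<bar>?I x - \<alpha> / W.m * R.\<Lambda> x * A.\<gamma>\<bar> \<le> k1 * err x + k2 * R.l x"
      using main_estimate(2)[OF adm, of x] unfolding k1_def k2_def A.sg_def A.\<gamma>_def .
    also have "\<dots> \<le> k1 * (e * R.\<Lambda> x) + k2 * (e * R.\<Lambda> x)"
      using elim k by (intro add_mono mult_left_mono) auto
    also have "\<dots> = ((k1 + k2) * e) * R.\<Lambda> x" by (simp add: algebra_simps)
    also have "\<dots> < d * R.\<Lambda> x" using ek \<Lambda> by (rule mult_strict_right_mono)
    finally have 1: "\<bar>?I x - \<alpha> / W.m * R.\<Lambda> x * A.\<gamma>\<bar> < d * R.\<Lambda> x" .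
    have "inverse (R.\<Lambda> x) * ?I x - \<alpha> / W.m * A.\<gamma> = inverse (R.\<Lambda> x) * (?I x - \<alpha> / W.m * R.\<Lambda> x * A.\<gamma>)"
      using \<Lambda> by (simp add: algebra_simps)
    then have "\<bar>inverse (R.\<Lambda> x) * ?I x - \<alpha> / W.m * A.\<gamma>\<bar> = inverse (R.\<Lambda> x) * \<bar>?I x - \<alpha> / W.m * R.\<Lambda> x * A.\<gamma>\<bar>"
      using \<Lambda> by (simp only: abs_mult) simp
    also have "\<dots> < inverse (R.\<Lambda> x) * (d * R.\<Lambda> x)" using 1 \<Lambda> by (intro mult_strict_left_mono) auto
    also have "\<dots> = d" using \<Lambda> by simp
    finally show ?case unfolding dist_real_def R.\<Lambda>_eq A.\<gamma>_def .
  qed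
qed

text \<open>\<open>err x\<close> is at most a multiple of l x independently of g, so one threshold
  in x serves all admissible g and C can be linear in s + c. Positive slope also gives the
  divergence in either argument while the other one is nonnegative.\<close>

lemma fast_conclusion:
  assumes w: "\<exists>\<eta>>0. integrable lborel (\<lambda>u. exp (\<eta> * \<bar>u\<bar>) * \<bar>q u\<bar>)"
  shows "\<exists>C :: real \<Rightarrow> real \<Rightarrow> real.
          (LIM (s, c) at_top \<times>\<^sub>F principal {0..}. C s c :> at_top) \<and>
          (LIM (s, c) principal {0..} \<times>\<^sub>F at_top. C s c :> at_top) \<and>
          (\<forall>\<^sub>F x in at_top. \<forall>g c. admissible \<alpha> c g \<longrightarrow>
             \<bar>(LINT z|W.H. renewal_integrand M B \<alpha> g x z)
               - \<alpha> / W.m * L_tilde L (exp x)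
                   * (LINT r:{1..}|lborel. g r * r powr (- \<alpha> - 1))\<bar>
             \<le> C (SUP r. \<bar>g r\<bar>) c * L (exp x))"
proof -
  obtain K where K: "eventually (\<lambda>x. err x \<le> K * R.l x) at_top" using w err_fast by blast
  \<comment> \<open>The summand 1 makes K1 at least 1, so that K1 (s + c) dominates s + c.\<close>
  define K1 where "K1 = \<bar>K\<bar> + (1 + 2 / \<alpha>) / W.m + 1"
  have K1: "1 \<le> K1" using R.\<alpha> W.m_pos by (simp add: K1_def)
  have lim: "Z \<le> K1 * (s + c)" if "\<bar>Z\<bar> \<le> s" "0 \<le> c" for Z s c :: real
  proof -
    have "Z \<le> 1 * (s + c)" using that by simp
    also have "\<dots> \<le> K1 * (s + c)" using that K1 by (intro mult_right_mono) auto
    finally show ?thesis .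
  qed
  have lim2: "Z \<le> K1 * (s + c)" if "0 \<le> s" "\<bar>Z\<bar> \<le> c" for Z s c :: real
    using lim[OF that(2,1)] by (simp add: add.commute)
  have L1: "LIM (s, c) at_top \<times>\<^sub>F principal {0..}. K1 * (s + c) :> at_top"
    unfolding filterlim_at_top
  proof
    fix Z
    show "eventually (\<lambda>p. Z \<le> (case p of (s, c) \<Rightarrow> K1 * (s + c))) (at_top \<times>\<^sub>F principal {0..})"
      unfolding eventually_prod_filter
      by (rule exI[of _ "\<lambda>s. \<bar>Z\<bar> \<le> s"], rule exI[of _ "\<lambda>c. 0 \<le> c"]) (use lim[of Z] eventually_ge_at_top[of "\<bar>Z\<bar>"] in \<open>auto simp: eventually_principal\<close>)
  qed
  have L2: "LIM (s, c) principal {0..} \<times>\<^sub>F at_top. K1 * (s + c) :> at_top"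
    unfolding filterlim_at_top
  proof
    fix Z
    show "eventually (\<lambda>p. Z \<le> (case p of (s, c) \<Rightarrow> K1 * (s + c))) (principal {0..} \<times>\<^sub>F at_top)"
      unfolding eventually_prod_filter
      by (rule exI[of _ "\<lambda>s. 0 \<le> s"], rule exI[of _ "\<lambda>c. \<bar>Z\<bar> \<le> c"]) (use lim2[of _ Z] eventually_ge_at_top[of "\<bar>Z\<bar>"] in \<open>auto simp: eventually_principal\<close>)
  qed
  have "\<forall>\<^sub>F x in at_top. \<forall>g c. admissible \<alpha> c g \<longrightarrow>
             \<bar>(LINT z|W.H. renewal_integrand M B \<alpha> g x z)
               - \<alpha> / W.m * L_tilde L (exp x)
                   * (LINT r:{1..}|lborel. g r * r powr (- \<alpha> - 1))\<bar>
             \<le> K1 * ((SUP r. \<bar>g r\<bar>) + c) * L (exp x)"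
    using K
  proof eventually_elim
    case (elim x)
    show ?case
    proof (intro allI impI)
      fix g c assume adm: "admissible \<alpha> c g"
      interpret A: admissible_fun \<alpha> c g by unfold_locales (rule R.\<alpha> adm)+
      have sc: "0 \<le> A.sg" "0 \<le> c" by (rule A.sg_nonneg A.c_nonneg)+
      have l: "0 \<le> R.l x" using R.l_pos[of x] by simp
      have "(A.sg + c) * err x + A.sg * (1 + 2 / \<alpha>) / W.m * R.l x \<le> (A.sg + c) * (\<bar>K\<bar> * R.l x) + (A.sg + c) * ((1 + 2 / \<alpha>) / W.m) * R.l x"
      proof (intro add_mono mult_left_mono mult_right_mono)
        show "err x \<le> \<bar>K\<bar> * R.l x" using elim mult_right_mono[OF abs_ge_self l, of K] by linarith
        have "A.sg * ((1 + 2 / \<alpha>) / W.m) \<le> (A.sg + c) * ((1 + 2 / \<alpha>) / W.m)"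
          using sc R.\<alpha> W.m_pos by (intro mult_right_mono) auto
        then show "A.sg * (1 + 2 / \<alpha>) / W.m \<le> (A.sg + c) * ((1 + 2 / \<alpha>) / W.m)" by simp
      qed (use sc l in auto)
      also have "\<dots> = ((\<bar>K\<bar> + (1 + 2 / \<alpha>) / W.m) * (A.sg + c)) * R.l x"
      proof -
        have "p * (a * y) + p * b * y = ((a + b) * p) * y" for a b p y :: real by (simp add: algebra_simps)
        then show ?thesis .
      qed
      also have "\<dots> \<le> (K1 * (A.sg + c)) * R.l x"
        using sc l by (intro mult_right_mono) (auto simp: K1_def)
      finally show "\<bar>(LINT z|W.H. renewal_integrand M B \<alpha> g x z) - \<alpha> / W.m * L_tilde L (exp x) * (LINT r:{1..}|lborel. g r * r powr (- \<alpha> - 1))\<bar>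
             \<le> K1 * ((SUP r. \<bar>g r\<bar>) + c) * L (exp x)"
        using main_estimate(2)[OF adm, of x] unfolding A.sg_def R.\<Lambda>_eq R.l_eq by linarith
    qed
  qed
  with L1 L2 show ?thesis by (intro exI[of _ "\<lambda>s c. K1 * (s + c)"] conjI)
qed

end

theorem theorem3p1:
  fixes M :: "'a measure" and Z B :: "'a \<Rightarrow> real" and X :: "nat \<Rightarrow> 'a \<Rightarrow> real"
    and L :: "real \<Rightarrow> real" and \<alpha> :: real
  assumes "prob_space M"
    and "0 < \<alpha>"
    and "Z \<in> borel_measurable M"
    and "integrable M Z" and "0 < (LINT \<omega>|M. Z \<omega>)"
    and "\<not> arithmetic_law (distr M borel Z)"
    and "\<exists>r>0. (\<lambda>x. measure M {\<omega> \<in> space M. Z \<omega> \<le> x}) \<in> o[at_bot](\<lambda>x. exp (r * x))"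
    and "prob_space.indep_vars M (\<lambda>_. borel) X UNIV"
    and "\<And>n. distr M borel (X n) = distr M borel Z"
    and "B \<in> borel_measurable M"
    and "slowly_varying L"
    and "\<And>x. 0 < x \<Longrightarrow> measure M {\<omega> \<in> space M. x < B \<omega>} = x powr (- \<alpha>) * L x"
  shows
    "(\<forall>g c. admissible \<alpha> c g \<longrightarrow>
        (\<forall>x. integrable (renewal_measure M X) (renewal_integrand M B \<alpha> g x)) \<and>
        ((\<lambda>x. inverse (L_tilde L (exp x)) *
              (LINT z|renewal_measure M X. renewal_integrand M B \<alpha> g x z))
          \<longlongrightarrow> \<alpha> / (LINT \<omega>|M. Z \<omega>) * (LINT r:{1..}|lborel. g r * r powr (- \<alpha> - 1))) at_top) \<and>
     ((\<exists>\<epsilon>>0. integrable M (\<lambda>\<omega>. exp (\<epsilon> * Z \<omega>))) \<and> strongly_nonlattice_law (distr M borel Z) \<longrightarrow>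
       (\<exists>C :: real \<Rightarrow> real \<Rightarrow> real.
          (LIM (s, c) at_top \<times>\<^sub>F principal {0..}. C s c :> at_top) \<and>
          (LIM (s, c) principal {0..} \<times>\<^sub>F at_top. C s c :> at_top) \<and>
          (\<forall>\<^sub>F x in at_top. \<forall>g c. admissible \<alpha> c g \<longrightarrow>
             \<bar>(LINT z|renewal_measure M X. renewal_integrand M B \<alpha> g x z)
               - \<alpha> / (LINT \<omega>|M. Z \<omega>) * L_tilde L (exp x)
                   * (LINT r:{1..}|lborel. g r * r powr (- \<alpha> - 1))\<bar>
             \<le> C (SUP r. \<bar>g r\<bar>) c * L (exp x))))"
proof -
  note prob = assms(1) and \<alpha> = assms(2) and Zm [measurable] = assms(3) and Zi = assms(4) and Zpos = assms(5)
  let ?\<nu> = "distr M borel Z"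
  obtain r where r: "r > 0" "(\<lambda>x. measure M {\<omega> \<in> space M. Z \<omega> \<le> x}) \<in> o[at_bot](\<lambda>x. exp (r * x))"
    using assms(7) by blast
  have m_eq: "(LINT x|?\<nu>. x) = (LINT \<omega>|M. Z \<omega>)" by (rule integral_distr) auto
  \<comment> \<open>r / 2 is the exponent for which \<open>left_tail_integrable\<close> provides a
    finite moment.\<close>
  interpret Bl: blackwell ?\<nu> "r / 2" M X
  proof (intro blackwell.intro drift_walk.intro positive_drift.intro)
    show "real_distribution ?\<nu>" by (rule prob_space.real_distribution_distr[OF prob Zm])
    show "positive_drift_axioms ?\<nu> (r / 2)"
    proof
      show "integrable ?\<nu> (\<lambda>x. x)" using Zi by (subst integrable_distr_eq) auto
      show "0 < (LINT x|?\<nu>. x)" unfolding m_eq by (rule Zpos)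
      show "0 < r / 2" using r(1) by simp
      show "integrable ?\<nu> (\<lambda>x. exp (- (r / 2) * x))"
        using left_tail_integrable[OF prob Zm r] by (subst integrable_distr_eq) auto
    qed
    show "prob_space M" by (rule prob)
    show "drift_walk_axioms ?\<nu> M X" by unfold_locales (use assms(8,9) in auto)
    show "blackwell_axioms ?\<nu>" by unfold_locales (rule assms(6))
  qed
  interpret S: renewal_setting ?\<nu> "r / 2" M X B L \<alpha>
    by unfold_locales (use assms in auto)
  have m: "Bl.m = (LINT \<omega>|M. Z \<omega>)" unfolding Bl.m_def by (rule m_eq)
  show ?thesis
  proof (intro conjI allI impI)
    fix g c x assume adm: "admissible \<alpha> c g"
    show "integrable (renewal_measure M X) (renewal_integrand M B \<alpha> g x)"
      by (rule S.main_estimate(1)[OF adm])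
  next
    fix g c assume adm: "admissible \<alpha> c g"
    show "((\<lambda>x. inverse (L_tilde L (exp x)) * (LINT z|renewal_measure M X. renewal_integrand M B \<alpha> g x z))
          \<longlongrightarrow> \<alpha> / (LINT \<omega>|M. Z \<omega>) * (LINT r:{1..}|lborel. g r * r powr (- \<alpha> - 1))) at_top"
      using S.slow_conclusion[OF Bl.Q_limit adm] unfolding m .
  next
    assume a: "(\<exists>\<epsilon>>0. integrable M (\<lambda>\<omega>. exp (\<epsilon> * Z \<omega>))) \<and> strongly_nonlattice_law ?\<nu>"
    then obtain \<epsilon> where \<epsilon>: "\<epsilon> > 0" "integrable M (\<lambda>\<omega>. exp (\<epsilon> * Z \<omega>))" by blast
    have "integrable ?\<nu> (\<lambda>x. exp (\<epsilon> * x))" using \<epsilon>(2) by (subst integrable_distr_eq) auto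
    from S.fast_conclusion[OF S.exponential_weight[OF \<epsilon>(1) this assms(6)]] a
    show "\<exists>C :: real \<Rightarrow> real \<Rightarrow> real.
          (LIM (s, c) at_top \<times>\<^sub>F principal {0..}. C s c :> at_top) \<and>
          (LIM (s, c) principal {0..} \<times>\<^sub>F at_top. C s c :> at_top) \<and>
          (\<forall>\<^sub>F x in at_top. \<forall>g c. admissible \<alpha> c g \<longrightarrow>
             \<bar>(LINT z|renewal_measure M X. renewal_integrand M B \<alpha> g x z)
               - \<alpha> / (LINT \<omega>|M. Z \<omega>) * L_tilde L (exp x)
                   * (LINT r:{1..}|lborel. g r * r powr (- \<alpha> - 1))\<bar>
             \<le> C (SUP r. \<bar>g r\<bar>) c * L (exp x))"
      unfolding m by blast
  qed
qed

end
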